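(* Let $N\ge4$, $h\ge0$ a half-integer and $\sigma\in\{-,+\}^N$; let $R=R_N$, $X=V(I_N)$ and $M=M_h^\sigma$. Then for every Zariski closed subset $Y\subset X$ of codimension $\ge2$, restriction from $X$ to $X-Y$ induces an isomorphism $M\cong\widetilde M(X-Y)$.
   Context: $k_i=\begin{pmatrix}a_i&b_i\\c_i&d_i\end{pmatrix}$, $Q_i=a_id_i-b_ic_i$, $I_N\subset\mathbb C[k_1,\dots,k_N]$ generated by the entries of $k_1+\dots+k_N$ and $Q_1,\dots,Q_N$; $R_N=\mathbb C[k]/I_N$, an integral domain, coordinate ring of $X$. For $k=\begin{pmatrix}a&b\\c&d\end{pmatrix}$ with $ad=bc$ in the ring, $S^{2h}k^+$ is the $(2h+1)\times(2h+1)$ matrix with $(i,j)$ entry ($0\le i,j\le 2h$) equal to $a^{2h-i-j}b^jc^i$ if $i+j\le2h$ and $b^{2h-i}c^{2h-j}d^{i+j-2h}$ if $i+j\ge2h$ (well defined modulo $ad-bc$), and $S^{2h}k^-$ is its transpose. $M_h^\sigma$ is the (graded, finitely generated) $R$-submodule of $R^{(2h+1)^N}$ given by the image of the Kronecker product $S^{2h}k_1^{\sigma_1}\otimes\cdots\otimes S^{2h}k_N^{\sigma_N}$. For a finitely generated $R$-module $M$, $\widetilde M$ is the associated coherent sheaf on $X$ with $\widetilde M(D_f)=M_f$ for $0\ne f\in R$, $D_f=\{f\ne0\}$; note $\widetilde M(X)=M$. *)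

theory Defs
  imports Complex_Main
begin

text \<open>Points of the affine space C^(4N) are functions x :: nat => complex that vanish
  from index 4N on. Coordinates of the i-th matrix k_i (0 <= i < N):
  a_i = x(4i), b_i = x(4i+1), c_i = x(4i+2), d_i = x(4i+3).\<close>

inductive_set polyfun :: "nat \<Rightarrow> ((nat \<Rightarrow> complex) \<Rightarrow> complex) set" for m :: nat where
  pf_const: "(\<lambda>x. c) \<in> polyfun m"
| pf_var: "j < m \<Longrightarrow> (\<lambda>x. x j) \<in> polyfun m"
| pf_add: "p \<in> polyfun m \<Longrightarrow> q \<in> polyfun m \<Longrightarrow> (\<lambda>x. p x + q x) \<in> polyfun m"
| pf_mult: "p \<in> polyfun m \<Longrightarrow> q \<in> polyfun m \<Longrightarrow> (\<lambda>x. p x * q x) \<in> polyfun m"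

definition Xvar :: "nat \<Rightarrow> (nat \<Rightarrow> complex) set" where
  "Xvar N = {x. (\<forall>j\<ge>4*N. x j = 0)
      \<and> (\<forall>i<N. x (4*i) * x (4*i+3) = x (4*i+1) * x (4*i+2))
      \<and> (\<Sum>i<N. x (4*i)) = 0 \<and> (\<Sum>i<N. x (4*i+1)) = 0
      \<and> (\<Sum>i<N. x (4*i+2)) = 0 \<and> (\<Sum>i<N. x (4*i+3)) = 0}"

definition zariski_closed :: "nat \<Rightarrow> (nat \<Rightarrow> complex) set \<Rightarrow> bool" where
  "zariski_closed N Y \<longleftrightarrow>
     (\<exists>S \<subseteq> polyfun (4*N). Y = {x \<in> Xvar N. \<forall>p\<in>S. p x = 0})"

definition irreducible_closed :: "nat \<Rightarrow> (nat \<Rightarrow> complex) set \<Rightarrow> bool" where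
  "irreducible_closed N Z \<longleftrightarrow> zariski_closed N Z \<and> Z \<noteq> {} \<and>
     (\<forall>A B. zariski_closed N A \<longrightarrow> zariski_closed N B \<longrightarrow> Z \<subseteq> A \<union> B \<longrightarrow> Z \<subseteq> A \<or> Z \<subseteq> B)"

definition codim_ge2 :: "nat \<Rightarrow> (nat \<Rightarrow> complex) set \<Rightarrow> bool" where
  "codim_ge2 N Y \<longleftrightarrow> (\<forall>Z. irreducible_closed N Z \<and> Z \<subseteq> Y \<longrightarrow>
     (\<exists>Z1 Z2. irreducible_closed N Z1 \<and> irreducible_closed N Z2 \<and> Z \<subset> Z1 \<and> Z1 \<subset> Z2))"

text \<open>Entries of S^n k^+ (n = 2h), indices 0..n.\<close>
definition Smat :: "nat \<Rightarrow> complex \<Rightarrow> complex \<Rightarrow> complex \<Rightarrow> complex \<Rightarrow> nat \<Rightarrow> nat \<Rightarrow> complex" where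
  "Smat n a b c d i j = (if i + j \<le> n then a^(n-i-j) * b^j * c^i
                         else b^(n-i) * c^(n-j) * d^(i+j-n))"

text \<open>Sign: True = +, False = - (transpose).\<close>
definition Ssig :: "nat \<Rightarrow> bool \<Rightarrow> complex \<Rightarrow> complex \<Rightarrow> complex \<Rightarrow> complex \<Rightarrow> nat \<Rightarrow> nat \<Rightarrow> complex" where
  "Ssig n s a b c d i j = (if s then Smat n a b c d i j else Smat n a b c d j i)"

text \<open>Multi-indices (i_0,...,i_{N-1}) with 0 <= i_l <= n, indexing basis of C^((n+1)^N).\<close>
definition multi_idx :: "nat \<Rightarrow> nat \<Rightarrow> (nat \<Rightarrow> nat) set" where
  "multi_idx N n = {I. (\<forall>l<N. I l \<le> n) \<and> (\<forall>l\<ge>N. I l = 0)}"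

definition kron :: "nat \<Rightarrow> nat \<Rightarrow> (nat \<Rightarrow> bool) \<Rightarrow> (nat \<Rightarrow> complex) \<Rightarrow> (nat \<Rightarrow> nat) \<Rightarrow> (nat \<Rightarrow> nat) \<Rightarrow> complex" where
  "kron N n \<sigma> x I J = (\<Prod>l<N. Ssig n (\<sigma> l) (x (4*l)) (x (4*l+1)) (x (4*l+2)) (x (4*l+3)) (I l) (J l))"

text \<open>The module M = M_h^sigma (n = 2h): image of the Kronecker product, i.e. R-span of its
  columns; elements are vectors of polynomial functions, regarded on X.\<close>
definition Mmod :: "nat \<Rightarrow> nat \<Rightarrow> (nat \<Rightarrow> bool) \<Rightarrow> ((nat \<Rightarrow> complex) \<Rightarrow> (nat \<Rightarrow> nat) \<Rightarrow> complex) set" where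
  "Mmod N n \<sigma> = {m. \<exists>r. (\<forall>J\<in>multi_idx N n. r J \<in> polyfun (4*N)) \<and>
      m = (\<lambda>x I. \<Sum>J\<in>multi_idx N n. r J x * kron N n \<sigma> x I J)}"

text \<open>Sections of the coherent sheaf M~ over an open U of X: a vector-valued function on U
  whose restriction to every basic open D_f contained in U lies in M_f.\<close>
definition is_section :: "nat \<Rightarrow> nat \<Rightarrow> (nat \<Rightarrow> bool) \<Rightarrow> (nat \<Rightarrow> complex) set
    \<Rightarrow> ((nat \<Rightarrow> complex) \<Rightarrow> (nat \<Rightarrow> nat) \<Rightarrow> complex) \<Rightarrow> bool" where
  "is_section N n \<sigma> U s \<longleftrightarrow>
     (\<forall>f\<in>polyfun (4*N). {x \<in> Xvar N. f x \<noteq> 0} \<subseteq> U \<longrightarrow>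
        (\<exists>m\<in>Mmod N n \<sigma>. \<exists>k::nat. \<forall>x\<in>Xvar N. f x \<noteq> 0 \<longrightarrow>
           (\<forall>I\<in>multi_idx N n. s x I = m x I / f x ^ k)))"

end

theory Submission
  imports Defs "HOL-Computational_Algebra.Fundamental_Theorem_Algebra"
begin

text \<open>
  Write \<open>k\<^sub>l = \<lambda>\<^sub>l \<mu>\<^sub>l\<^sup>T\<close> with spinors \<open>\<lambda>\<^sub>l, \<mu>\<^sub>l \<in> \<complex>\<^sup>2\<close>. Then \<open>X\<close> is the quotient by a torus of rank \<open>N\<close> of the
  variety \<open>Z\<close> of pairs of \<open>N \<times> 2\<close> matrices with \<open>\<Lambda>\<^sup>T \<Omega> = 0\<close> (rows \<open>\<lambda>\<^sub>l\<close>, \<open>\<mu>\<^sub>l\<close>), and \<open>S\<^bsup>n\<^esup> k\<^sub>l\<close> is the rank one matrix of monomials of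
  degree \<open>n\<close> in \<open>\<lambda>\<^sub>l\<close> times those in \<open>\<mu>\<^sub>l\<close>. Hence \<open>M\<close> is a weight space of the coordinate ring of \<open>Z\<close>.
  The four equations of \<open>Z\<close> have, for suitable weights of the variables, pairwise coprime leading monomials.
  This stays true if one adds the two coordinates of a spinor or one \<open>2 \<times> 2\<close> minor of each of
  \<open>\<Lambda>\<close> and \<open>\<Omega>\<close>, which are therefore regular sequences on \<open>Z\<close>; \<open>N \<ge> 4\<close> is what makes room for the
  monomials.

  On \<open>X\<close> there are rational charts whose denominators are products of spinor coordinates and one minor.
  In a chart the quotient \<open>m / f\<close> defining a section has no polar divisor: its components
  in the chart would be closed sets of codimension one contained in \<open>Y\<close>. So the section extends after multiplication
  by a power of the denominator of any chart, and on \<open>Z\<close> the denominators of the various charts cancel because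
  of the regular sequences.
\<close>

section \<open>Polynomial functions\<close>

text \<open>Codimension enters only through chains of irreducible closed sets. A polar component can
  therefore be excluded only by showing that no two-step chain fits above it. In a chart this
  becomes a degree argument: over the fraction field of all but one chart variable, ideals are
  principal, and below the prime ideal of a hypersurface there is no other nonzero prime. The price
  is that factors free of the chosen variable are invisible. Hence every chart variable is used in
  turn, and the results are glued by interpolation.

  On the spinor side, leading monomials speak about the ideal of the four equations, while functions
  are compared at points. The link is Cramer's rule: it solves the equations after inverting one
  minor, and this minor is a nonzerodivisor by the leading monomials. So the four equations generate
  the whole vanishing ideal, and this ideal is prime, without a general Nullstellensatz.\<close>

lemma polyfun_uminus: "p \<in> polyfun m \<Longrightarrow> (\<lambda>x. - p x) \<in> polyfun m"
  using pf_mult[OF pf_const[of "-1"], of p m] by simp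

lemma polyfun_diff: "p \<in> polyfun m \<Longrightarrow> q \<in> polyfun m \<Longrightarrow> (\<lambda>x. p x - q x) \<in> polyfun m"
  using pf_add[OF _ polyfun_uminus, of p m q] by simp

lemma polyfun_power: "p \<in> polyfun m \<Longrightarrow> (\<lambda>x. p x ^ k) \<in> polyfun m"
  by (induction k) (auto intro: polyfun.intros)

lemma polyfun_sum: "(\<And>i. i \<in> A \<Longrightarrow> f i \<in> polyfun m) \<Longrightarrow> (\<lambda>x. \<Sum>i\<in>A. f i x) \<in> polyfun m"
  by (induction A rule: infinite_finite_induct) (auto intro: polyfun.intros)

lemma polyfun_prod: "(\<And>i. i \<in> A \<Longrightarrow> f i \<in> polyfun m) \<Longrightarrow> (\<lambda>x. \<Prod>i\<in>A. f i x) \<in> polyfun m"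
  by (induction A rule: infinite_finite_induct) (auto intro: polyfun.intros)

lemmas polyfun_intros =
  pf_const pf_var pf_add pf_mult polyfun_uminus polyfun_diff polyfun_power polyfun_sum polyfun_prod

lemma polyfun_compose:
  assumes "p \<in> polyfun m" "\<And>j. j < m \<Longrightarrow> (\<lambda>x. g x j) \<in> polyfun k"
  shows "(\<lambda>x. p (g x)) \<in> polyfun k"
  using assms(1)
proof (induction)
  case (pf_const c)
  show ?case by (rule polyfun.pf_const)
next
  case (pf_var j)
  then show ?case by (rule assms(2))
next
  case (pf_add p q)
  from pf_add.IH show ?case by (rule polyfun.pf_add)
next
  case (pf_mult p q)
  from pf_mult.IH show ?case by (rule polyfun.pf_mult)
qed

lemma polyfun_cong:
  assumes "p \<in> polyfun m" "\<And>j. j < m \<Longrightarrow> x j = y j"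
  shows "p x = p y"
  using assms(1) by (induction) (auto simp: assms(2))

lemma polyfun_mono: "p \<in> polyfun m \<Longrightarrow> m \<le> k \<Longrightarrow> p \<in> polyfun k"
  using polyfun_compose[of p m "\<lambda>x. x" k] pf_var[of _ k] by simp

text \<open>Restriction to polynomial curves, in particular to lines, reduces statements on several
  variables to facts on \<open>poly\<close>.\<close>

lemma polyfun_curve:
  assumes "p \<in> polyfun m"
  shows "\<exists>P. \<forall>t. p (\<lambda>j. poly (g j) t) = poly P t"
  using assms
proof (induction)
  case (pf_const c)
  show ?case by (rule exI[of _ "[:c:]"]) simp
next
  case (pf_var j)
  show ?case by (rule exI[of _ "g j"]) simp
next
  case (pf_add p q)
  then show ?case by (metis poly_add)
next
  case (pf_mult p q)
  then show ?case by (metis poly_mult)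
qed

lemma polyfun_slice:
  assumes "p \<in> polyfun m"
  shows "\<exists>P. \<forall>v. p (y(j := v)) = poly P v"
proof -
  obtain P where P: "\<forall>t. p (\<lambda>i. poly (if i = j then [:0, 1:] else [:y i:]) t) = poly P t"
    using polyfun_curve[OF assms, of "\<lambda>i. if i = j then [:0, 1:] else [:y i:]"] by auto
  have "(\<lambda>i. poly (if i = j then [:0, 1:] else [:y i:]) t) = y(j := t)" for t
    by (auto simp: fun_eq_iff)
  with P show ?thesis by auto
qed

text \<open>On the line through \<open>x\<close> and \<open>y\<close> both functions become nonzero
  polynomials in one variable, whose product is nonzero. This is the domain property of the ring of
  polynomial functions.\<close>

lemma polyfun_common_nonzero:
  assumes "p \<in> polyfun m" "q \<in> polyfun m" "p x \<noteq> 0" "q y \<noteq> 0"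
  shows "\<exists>z. p z \<noteq> 0 \<and> q z \<noteq> 0"
proof -
  let ?g = "\<lambda>i. [:x i, y i - x i:]"
  obtain P where P: "\<forall>t. p (\<lambda>i. poly (?g i) t) = poly P t" using polyfun_curve[OF assms(1), of ?g] by auto
  obtain Q where Q: "\<forall>t. q (\<lambda>i. poly (?g i) t) = poly Q t" using polyfun_curve[OF assms(2), of ?g] by auto
  have "poly P 0 = p x" using P[rule_format, of 0] by simp
  moreover have "poly Q 1 = q y" using Q[rule_format, of 1] by simp
  ultimately have "P * Q \<noteq> 0" using assms by auto
  then obtain t where "poly (P * Q) t \<noteq> 0" by (meson poly_all_0_iff_0)
  then have "poly P t \<noteq> 0" "poly Q t \<noteq> 0" by auto
  then show ?thesis using P Q by (intro exI[of _ "\<lambda>i. poly (?g i) t"]) (simp only: simp_thms)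
qed

text \<open>Density of the set where \<open>p\<close> is nonzero: later \<open>p\<close> is a
  denominator, and an identity is checked only where it can be divided out.\<close>

lemma polyfun_cancel:
  assumes "p \<in> polyfun m" "q \<in> polyfun m" "p x0 \<noteq> 0" "\<And>x. p x \<noteq> 0 \<Longrightarrow> q x = 0"
  shows "q x = 0"
  using polyfun_common_nonzero[OF assms(1-3)] assms(4) by blast

lemma polyfun_prod_common_nonzero:
  assumes "finite A" "\<And>i. i \<in> A \<Longrightarrow> f i \<in> polyfun m" "\<And>i. i \<in> A \<Longrightarrow> \<exists>x. f i x \<noteq> 0"
  shows "\<exists>x. \<forall>i\<in>A. f i x \<noteq> 0"
  using assms
proof (induction A)
  case empty
  show ?case by simp
next
  case (insert a A)
  then obtain x y where x: "\<forall>i\<in>A. f i x \<noteq> 0" and y: "f a y \<noteq> 0" by (metis insertCI)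
  have "(\<lambda>x. \<Prod>i\<in>A. f i x) \<in> polyfun m" using insert by (intro polyfun_prod) auto
  moreover have "(\<Prod>i\<in>A. f i x) \<noteq> 0" using x insert.hyps by simp
  ultimately obtain z where z: "(\<Prod>i\<in>A. f i z) \<noteq> 0" "f a z \<noteq> 0"
    using polyfun_common_nonzero[of "\<lambda>x. \<Prod>i\<in>A. f i x" m "f a" x y] y insert.prems by auto
  with insert.hyps show ?case by (intro exI[of _ z]) (auto simp: prod_zero_iff)
qed

section \<open>Monomials and linear combinations\<close>

definition lcomb :: "'e set \<Rightarrow> ('e \<Rightarrow> (nat \<Rightarrow> complex) \<Rightarrow> complex) \<Rightarrow> ((nat \<Rightarrow> complex) \<Rightarrow> complex) set" where
  "lcomb S b = {f. \<exists>A c. finite A \<and> A \<subseteq> S \<and> f = (\<lambda>x. \<Sum>e\<in>A. c e * b e x)}"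

lemma lcombI: "finite A \<Longrightarrow> A \<subseteq> S \<Longrightarrow> f = (\<lambda>x. \<Sum>e\<in>A. c e * b e x) \<Longrightarrow> f \<in> lcomb S b"
  unfolding lcomb_def by blast

lemma lcomb_zero: "(\<lambda>x. 0) \<in> lcomb S b"
  by (rule lcombI[of "{}"]) auto

lemma lcomb_base: "e \<in> S \<Longrightarrow> b e \<in> lcomb S b"
  by (rule lcombI[of "{e}" _ _ "\<lambda>_. 1"]) auto

lemma lcomb_scale: "f \<in> lcomb S b \<Longrightarrow> (\<lambda>x. c * f x) \<in> lcomb S b"
proof -
  assume "f \<in> lcomb S b"
  then obtain A d where A: "finite A" "A \<subseteq> S" "f = (\<lambda>x. \<Sum>e\<in>A. d e * b e x)" unfolding lcomb_def by blast
  show ?thesis by (rule lcombI[OF A(1,2), of _ "\<lambda>e. c * d e"]) (simp add: A(3) sum_distrib_left mult.assoc)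
qed

lemma lcomb_add: "f \<in> lcomb S b \<Longrightarrow> g \<in> lcomb S b \<Longrightarrow> (\<lambda>x. f x + g x) \<in> lcomb S b"
proof -
  assume "f \<in> lcomb S b" "g \<in> lcomb S b"
  then obtain A c B d where A: "finite A" "A \<subseteq> S" "f = (\<lambda>x. \<Sum>e\<in>A. c e * b e x)"
    and B: "finite B" "B \<subseteq> S" "g = (\<lambda>x. \<Sum>e\<in>B. d e * b e x)" unfolding lcomb_def by blast
  have "f x = (\<Sum>e\<in>A\<union>B. (if e \<in> A then c e else 0) * b e x)" for x
    unfolding A(3) using A(1) B(1) by (intro sum.mono_neutral_cong_left) auto
  moreover have "g x = (\<Sum>e\<in>A\<union>B. (if e \<in> B then d e else 0) * b e x)" for x
    unfolding B(3) using A(1) B(1) by (intro sum.mono_neutral_cong_left) auto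
  ultimately have "(\<lambda>x. f x + g x) = (\<lambda>x. \<Sum>e\<in>A\<union>B. ((if e \<in> A then c e else 0) + (if e \<in> B then d e else 0)) * b e x)"
    by (simp add: sum.distrib distrib_right)
  with A(1,2) B(1,2) show ?thesis by (intro lcombI[of "A \<union> B"]) auto
qed

lemma lcomb_diff: "f \<in> lcomb S b \<Longrightarrow> g \<in> lcomb S b \<Longrightarrow> (\<lambda>x. f x - g x) \<in> lcomb S b"
  using lcomb_add[OF _ lcomb_scale[of _ _ _ "-1"], of f S b g] by simp

lemma lcomb_sum: "(\<And>i. i \<in> A \<Longrightarrow> f i \<in> lcomb S b) \<Longrightarrow> (\<lambda>x. \<Sum>i\<in>A. f i x) \<in> lcomb S b"
  by (induction A rule: infinite_finite_induct) (auto intro: lcomb_zero lcomb_add)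

lemma lcomb_subset:
  assumes "f \<in> lcomb S b" "\<And>e. e \<in> S \<Longrightarrow> b e \<in> lcomb T b'"
  shows "f \<in> lcomb T b'"
proof -
  obtain A c where A: "finite A" "A \<subseteq> S" "f = (\<lambda>x. \<Sum>e\<in>A. c e * b e x)" using assms(1) unfolding lcomb_def by blast
  show ?thesis unfolding A(3) using A(2) assms(2) by (intro lcomb_sum lcomb_scale) auto
qed

lemma lcomb_mono: "f \<in> lcomb S b \<Longrightarrow> S \<subseteq> T \<Longrightarrow> f \<in> lcomb T b"
  by (erule lcomb_subset) (auto intro: lcomb_base)

lemma lcomb_mult:
  assumes "f \<in> lcomb S b" "g \<in> lcomb T b'" "\<And>e e'. e \<in> S \<Longrightarrow> e' \<in> T \<Longrightarrow> (\<lambda>x. b e x * b' e' x) \<in> lcomb U b''"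
  shows "(\<lambda>x. f x * g x) \<in> lcomb U b''"
proof -
  obtain A c where A: "finite A" "A \<subseteq> S" "f = (\<lambda>x. \<Sum>e\<in>A. c e * b e x)" using assms(1) unfolding lcomb_def by blast
  obtain B d where B: "finite B" "B \<subseteq> T" "g = (\<lambda>x. \<Sum>e\<in>B. d e * b' e x)" using assms(2) unfolding lcomb_def by blast
  have "(\<lambda>x. f x * g x) = (\<lambda>x. \<Sum>e\<in>A. \<Sum>e'\<in>B. (c e * d e') * (b e x * b' e' x))"
    unfolding A(3) B(3) by (simp add: sum_product mult_ac)
  also have "\<dots> \<in> lcomb U b''"
    using A(2) B(2) by (intro lcomb_sum lcomb_scale assms(3)) auto
  finally show ?thesis .
qed

text \<open>Exponents vanish from \<open>m\<close> on because \<open>mon m\<close> does not read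
  them there; otherwise distinct exponents could have the same monomial.\<close>

definition exps :: "nat \<Rightarrow> (nat \<Rightarrow> nat) set" where
  "exps m = {e. \<forall>j\<ge>m. e j = 0}"

definition mon :: "nat \<Rightarrow> (nat \<Rightarrow> nat) \<Rightarrow> (nat \<Rightarrow> complex) \<Rightarrow> complex" where
  "mon m e x = (\<Prod>j<m. x j ^ e j)"

lemma mon_add: "mon m (\<lambda>j. e j + e' j) x = mon m e x * mon m e' x"
  unfolding mon_def by (simp add: power_add prod.distrib)

lemma exps_add: "e \<in> exps m \<Longrightarrow> e' \<in> exps m \<Longrightarrow> (\<lambda>j. e j + e' j) \<in> exps m"
  unfolding exps_def by simp

lemma polyfun_mon: "mon m e \<in> polyfun m"
  unfolding mon_def[abs_def] by (intro polyfun_intros) auto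

lemma mon_zero: "mon m (\<lambda>_. 0) = (\<lambda>x. 1)"
  unfolding mon_def[abs_def] by simp

lemma mon_single: "j < m \<Longrightarrow> mon m (\<lambda>i. if i = j then 1 else 0) x = x j"
proof -
  assume "j < m"
  have "mon m (\<lambda>i. if i = j then 1 else 0) x = (\<Prod>i<m. if i = j then x i else 1)"
    unfolding mon_def by (rule prod.cong) auto
  with \<open>j < m\<close> show ?thesis by simp
qed

lemma polyfun_lcomb_mon:
  assumes "p \<in> polyfun m"
  shows "p \<in> lcomb (exps m) (mon m)"
  using assms
proof (induction)
  case (pf_const c)
  have "(\<lambda>x. c * mon m (\<lambda>_. 0) x) \<in> lcomb (exps m) (mon m)"
    by (intro lcomb_scale lcomb_base) (simp add: exps_def)
  then show ?case by (simp add: mon_zero)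
next
  case (pf_var j)
  then have "mon m (\<lambda>i. if i = j then 1 else 0) \<in> lcomb (exps m) (mon m)"
    by (intro lcomb_base) (simp add: exps_def)
  moreover have "mon m (\<lambda>i. if i = j then 1 else 0) = (\<lambda>x. x j)" using pf_var mon_single by auto
  ultimately show ?case by simp
next
  case (pf_add p q)
  then show ?case by (auto intro: lcomb_add)
next
  case (pf_mult p q)
  show ?case
  proof (rule lcomb_mult[OF pf_mult.IH])
    fix e e' assume "e \<in> exps m" "e' \<in> exps m"
    then show "(\<lambda>x. mon m e x * mon m e' x) \<in> lcomb (exps m) (mon m)"
      using lcomb_base[OF exps_add[of e m e'], of "mon m"] unfolding mon_add[abs_def] by auto
  qed
qed

lemma lcomb_polyfun: "f \<in> lcomb S b \<Longrightarrow> (\<And>e. e \<in> S \<Longrightarrow> b e \<in> polyfun m) \<Longrightarrow> f \<in> polyfun m"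
  unfolding lcomb_def by (auto intro!: polyfun_intros)

text \<open>Reduction modulo \<open>W\<close> isolates the lowest digit; division by
  \<open>W\<close> leaves the same statement for the remaining digits.\<close>

lemma digits_unique:
  fixes e e' :: "nat \<Rightarrow> nat"
  assumes "\<And>j. j < m \<Longrightarrow> e j < W" "\<And>j. j < m \<Longrightarrow> e' j < W"
    "(\<Sum>j<m. e j * W ^ j) = (\<Sum>j<m. e' j * W ^ j)" "j < m"
  shows "e j = e' j"
  using assms
proof (induction m arbitrary: e e' j)
  case (Suc m)
  have sh: "(\<Sum>j<Suc m. d j * W ^ j) = d 0 + W * (\<Sum>j<m. d (Suc j) * W ^ j)" for d :: "nat \<Rightarrow> nat"
    by (subst sum.lessThan_Suc_shift) (simp only: sum_distrib_left power_0 mult_1_right power_Suc mult.left_commute)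
  have lt: "e 0 < W" "e' 0 < W" using Suc.prems by auto
  have eq: "e 0 + W * (\<Sum>j<m. e (Suc j) * W ^ j) = e' 0 + W * (\<Sum>j<m. e' (Suc j) * W ^ j)"
    using Suc.prems(3) unfolding sh .
  have "(e 0 + W * (\<Sum>j<m. e (Suc j) * W ^ j)) mod W = e 0" using lt by simp
  moreover have "(e' 0 + W * (\<Sum>j<m. e' (Suc j) * W ^ j)) mod W = e' 0" using lt by simp
  ultimately have 0: "e 0 = e' 0" using eq by metis
  with eq have "W * (\<Sum>j<m. e (Suc j) * W ^ j) = W * (\<Sum>j<m. e' (Suc j) * W ^ j)" by linarith
  with lt have "(\<Sum>j<m. e (Suc j) * W ^ j) = (\<Sum>j<m. e' (Suc j) * W ^ j)" by simp
  then have "e (Suc i) = e' (Suc i)" if "i < m" for i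
    by (rule Suc.IH[rotated 2]) (use Suc.prems(1,2) that in simp_all)
  with 0 Suc.prems(4) show ?case by (cases j) simp_all
qed simp

text \<open>Kronecker substitution \<open>x\<^sub>j = t\<^bsup>W^j\<^esup>\<close> makes finitely many monomials distinct powers of \<open>t\<close>.\<close>

lemma mon_independent:
  assumes "finite A" "A \<subseteq> exps m" "\<And>x. (\<Sum>e\<in>A. c e * mon m e x) = 0" "e0 \<in> A"
  shows "c e0 = 0"
proof -
  \<comment> \<open>\<open>W\<close> exceeds every exponent in \<open>A\<close>, so the exponents
    are base \<open>W\<close> digits and \<open>code\<close> is injective on
    \<open>A\<close>.\<close>
  define W where "W = Suc (\<Sum>e\<in>A. \<Sum>j<m. e j)"
  define code where "code e = (\<Sum>j<m. e j * W ^ j)" for e :: "nat \<Rightarrow> nat"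
  have lt: "e j < W" if "e \<in> A" "j < m" for e j
  proof -
    have "e j \<le> (\<Sum>j<m. e j)" using that by (intro member_le_sum) auto
    also have "\<dots> \<le> (\<Sum>e\<in>A. \<Sum>j<m. e j)" using that assms(1) by (intro member_le_sum[of e A "\<lambda>e. \<Sum>j<m. e j"]) auto
    finally show ?thesis by (simp add: W_def)
  qed
  have inj: "e = e'" if "e \<in> A" "e' \<in> A" "code e = code e'" for e e'
  proof
    fix j
    show "e j = e' j"
    proof (cases "j < m")
      case True
      show ?thesis
        by (rule digits_unique[of m e W e' j]) (use lt that True in \<open>auto simp: code_def\<close>)
    next
      case False
      with that assms(2) have "e j = 0" "e' j = 0" unfolding exps_def by auto
      then show ?thesis by simp
    qed
  qed
  have "poly (\<Sum>e\<in>A. monom (c e) (code e)) t = poly 0 t" for t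
  proof -
    have "mon m e (\<lambda>j. t ^ (W ^ j)) = t ^ code e" for e
      unfolding mon_def code_def by (simp add: power_mult[symmetric] power_sum mult.commute)
    then show ?thesis using assms(3)[of "\<lambda>j. t ^ (W ^ j)"] by (simp add: poly_sum poly_monom)
  qed
  then have "(\<Sum>e\<in>A. monom (c e) (code e)) = 0" by (intro poly_ext)
  then have "0 = coeff (\<Sum>e\<in>A. monom (c e) (code e)) (code e0)" by simp
  also have "\<dots> = (\<Sum>e\<in>A. if e = e0 then c e else 0)"
    unfolding coeff_sum using inj assms(4) by (intro sum.cong) auto
  finally show ?thesis using assms by simp
qed

section \<open>Regular sequences from coprime leading monomials\<close>

definition gideal :: "nat \<Rightarrow> 'i set \<Rightarrow> ('i \<Rightarrow> (nat \<Rightarrow> complex) \<Rightarrow> complex) \<Rightarrow> ((nat \<Rightarrow> complex) \<Rightarrow> complex) set" where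
  "gideal m I g = {f. \<exists>H. (\<forall>i\<in>I. H i \<in> polyfun m) \<and> f = (\<lambda>x. \<Sum>i\<in>I. g i x * H i x)}"

lemma gideal_zero: "(\<lambda>x. 0) \<in> gideal m I g"
  unfolding gideal_def by (auto intro!: exI[of _ "\<lambda>_ _. 0"] polyfun_intros)

lemma gideal_add: "f \<in> gideal m I g \<Longrightarrow> f' \<in> gideal m I g \<Longrightarrow> (\<lambda>x. f x + f' x) \<in> gideal m I g"
proof -
  assume "f \<in> gideal m I g" "f' \<in> gideal m I g"
  then obtain H H' where H: "\<forall>i\<in>I. H i \<in> polyfun m" "f = (\<lambda>x. \<Sum>i\<in>I. g i x * H i x)"
    and H': "\<forall>i\<in>I. H' i \<in> polyfun m" "f' = (\<lambda>x. \<Sum>i\<in>I. g i x * H' i x)" unfolding gideal_def by blast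
  have "\<forall>i\<in>I. (\<lambda>x. H i x + H' i x) \<in> polyfun m" using H(1) H'(1) by (auto intro: pf_add)
  moreover have "(\<lambda>x. f x + f' x) = (\<lambda>x. \<Sum>i\<in>I. g i x * (H i x + H' i x))"
    unfolding H(2) H'(2) by (simp add: distrib_left sum.distrib)
  ultimately show ?thesis unfolding gideal_def by (intro CollectI exI[of _ "\<lambda>i x. H i x + H' i x"]) simp
qed

lemma gideal_mult: "f \<in> gideal m I g \<Longrightarrow> p \<in> polyfun m \<Longrightarrow> (\<lambda>x. p x * f x) \<in> gideal m I g"
proof -
  assume "f \<in> gideal m I g" and p: "p \<in> polyfun m"
  then obtain H where H: "\<forall>i\<in>I. H i \<in> polyfun m" "f = (\<lambda>x. \<Sum>i\<in>I. g i x * H i x)" unfolding gideal_def by blast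
  have "\<forall>i\<in>I. (\<lambda>x. p x * H i x) \<in> polyfun m" using H(1) p by (auto intro: pf_mult)
  moreover have "(\<lambda>x. p x * f x) = (\<lambda>x. \<Sum>i\<in>I. g i x * (p x * H i x))"
    unfolding H(2) by (simp add: sum_distrib_left mult.left_commute)
  ultimately show ?thesis unfolding gideal_def by (intro CollectI exI[of _ "\<lambda>i x. p x * H i x"]) simp
qed

lemma gideal_diff: "f \<in> gideal m I g \<Longrightarrow> f' \<in> gideal m I g \<Longrightarrow> (\<lambda>x. f x - f' x) \<in> gideal m I g"
  using gideal_add[OF _ gideal_mult[OF _ pf_const[of "-1"]], of f m I g f'] by simp

lemma gideal_base: "finite I \<Longrightarrow> i \<in> I \<Longrightarrow> g i \<in> gideal m I g"
proof -
  assume I: "finite I" "i \<in> I"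
  have "g i = (\<lambda>x. \<Sum>i'\<in>I. g i' x * (if i' = i then 1 else 0))"
    using I by (simp add: if_distrib[of "(*) _"] cong: if_cong)
  moreover have "\<forall>i'\<in>I. (\<lambda>x. if i' = i then 1 else 0) \<in> polyfun m" by (auto intro: pf_const)
  ultimately show ?thesis unfolding gideal_def by (intro CollectI exI[of _ "\<lambda>i' x. if i' = i then 1 else 0"]) simp
qed

lemma gideal_sum: "(\<And>e. e \<in> A \<Longrightarrow> f e \<in> gideal m I g) \<Longrightarrow> (\<lambda>x. \<Sum>e\<in>A. f e x) \<in> gideal m I g"
  by (induction A rule: infinite_finite_induct) (simp_all add: gideal_zero gideal_add)

section \<open>Weights and leading monomials\<close>

definition wt :: "nat \<Rightarrow> (nat \<Rightarrow> nat) \<Rightarrow> (nat \<Rightarrow> nat) \<Rightarrow> nat" where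
  "wt m w e = (\<Sum>j<m. w j * e j)"

definition low :: "nat \<Rightarrow> (nat \<Rightarrow> nat) \<Rightarrow> nat \<Rightarrow> ((nat \<Rightarrow> complex) \<Rightarrow> complex) set" where
  "low m w k = lcomb {e \<in> exps m. wt m w e < k} (mon m)"

text \<open>A weight takes the place of a monomial order: ties among lower monomials are allowed,
  but the top one is unique and has coefficient 1.\<close>

definition leads :: "nat \<Rightarrow> (nat \<Rightarrow> nat) \<Rightarrow> ((nat \<Rightarrow> complex) \<Rightarrow> complex) \<Rightarrow> (nat \<Rightarrow> nat) \<Rightarrow> bool" where
  "leads m w f e \<longleftrightarrow> e \<in> exps m \<and> (\<lambda>x. f x - mon m e x) \<in> low m w (wt m w e)"

lemma wt_add: "wt m w (\<lambda>j. e j + e' j) = wt m w e + wt m w e'"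
  unfolding wt_def by (simp add: distrib_left sum.distrib)

lemma low_mon: "e \<in> exps m \<Longrightarrow> wt m w e < k \<Longrightarrow> mon m e \<in> low m w k"
  unfolding low_def by (rule lcomb_base) simp

lemma low_mult:
  assumes "f \<in> low m w k" "f' \<in> low m w k'"
  shows "(\<lambda>x. f x * f' x) \<in> low m w (k + k')"
  unfolding low_def
proof (rule lcomb_mult[OF assms[unfolded low_def]])
  fix e e' assume "e \<in> {e \<in> exps m. wt m w e < k}" "e' \<in> {e \<in> exps m. wt m w e < k'}"
  then have "(\<lambda>j. e j + e' j) \<in> {e \<in> exps m. wt m w e < k + k'}" by (simp add: exps_add wt_add)
  from lcomb_base[OF this, of "mon m"]
  show "(\<lambda>x. mon m e x * mon m e' x) \<in> lcomb {e \<in> exps m. wt m w e < k + k'} (mon m)"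
    unfolding mon_add[abs_def] .
qed

lemma low_mono: "f \<in> low m w k \<Longrightarrow> k \<le> k' \<Longrightarrow> f \<in> low m w k'"
  unfolding low_def by (erule lcomb_mono) auto

lemma low_mult_mon:
  assumes "f \<in> low m w k" "e \<in> exps m"
  shows "(\<lambda>x. mon m e x * f x) \<in> low m w (wt m w e + k)"
proof -
  have "mon m e \<in> lcomb {e} (mon m)" by (rule lcomb_base) simp
  then show ?thesis
    unfolding low_def
  proof (rule lcomb_mult[OF _ assms(1)[unfolded low_def]])
    fix e1 e2 assume "e1 \<in> {e}" "e2 \<in> {e \<in> exps m. wt m w e < k}"
    then have "(\<lambda>j. e1 j + e2 j) \<in> {e' \<in> exps m. wt m w e' < wt m w e + k}"
      using assms(2) by (simp add: exps_add wt_add)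
    from lcomb_base[OF this, of "mon m"]
    show "(\<lambda>x. mon m e1 x * mon m e2 x) \<in> lcomb {e' \<in> exps m. wt m w e' < wt m w e + k} (mon m)"
      unfolding mon_add[abs_def] .
  qed
qed

lemma leads_mon: "e \<in> exps m \<Longrightarrow> leads m w (mon m e) e"
  unfolding leads_def low_def by (simp add: lcomb_zero)

lemma leads_mult:
  assumes "leads m w f e" "leads m w f' e'"
  shows "leads m w (\<lambda>x. f x * f' x) (\<lambda>j. e j + e' j)"
proof -
  let ?d = "\<lambda>x. f x - mon m e x" and ?d' = "\<lambda>x. f' x - mon m e' x"
  have e: "e \<in> exps m" "e' \<in> exps m" and d: "?d \<in> low m w (wt m w e)" "?d' \<in> low m w (wt m w e')"
    using assms unfolding leads_def by auto
  have 1: "(\<lambda>x. ?d x * ?d' x) \<in> low m w (wt m w e + wt m w e')" by (rule low_mult[OF d])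
  have 2: "(\<lambda>x. mon m e x * ?d' x) \<in> low m w (wt m w e + wt m w e')" by (rule low_mult_mon[OF d(2) e(1)])
  have 3: "(\<lambda>x. mon m e' x * ?d x) \<in> low m w (wt m w e + wt m w e')"
    using low_mult_mon[OF d(1) e(2)] by (simp add: add.commute)
  have "(\<lambda>x. f x * f' x - mon m (\<lambda>j. e j + e' j) x) = (\<lambda>x. (?d x * ?d' x + mon m e x * ?d' x) + mon m e' x * ?d x)"
    unfolding mon_add by (simp add: algebra_simps)
  also have "\<dots> \<in> low m w (wt m w e + wt m w e')"
    using 1 2 3 unfolding low_def by (intro lcomb_add)
  finally show ?thesis unfolding leads_def using e by (simp add: exps_add wt_add)
qed

lemma leads_power: "leads m w f e \<Longrightarrow> leads m w (\<lambda>x. f x ^ k) (\<lambda>j. k * e j)"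
proof (induction k)
  case 0
  have "leads m w (mon m (\<lambda>_. 0)) (\<lambda>_. 0)" by (rule leads_mon) (simp add: exps_def)
  then show ?case by (simp add: mon_zero)
next
  case (Suc k)
  from leads_mult[OF Suc.prems Suc.IH[OF Suc.prems]] show ?case by simp
qed

lemma leads_prod:
  "finite I \<Longrightarrow> (\<And>i. i \<in> I \<Longrightarrow> leads m w (f i) (e i)) \<Longrightarrow> leads m w (\<lambda>x. \<Prod>i\<in>I. f i x) (\<lambda>j. \<Sum>i\<in>I. e i j)"
proof (induction I rule: finite_induct)
  case empty
  have "leads m w (mon m (\<lambda>_. 0)) (\<lambda>_. 0)" by (rule leads_mon) (simp add: exps_def)
  then show ?case by (simp add: mon_zero)
next
  case (insert i I)
  then have "leads m w (\<lambda>x. f i x * (\<Prod>i\<in>I. f i x)) (\<lambda>j. e i j + (\<Sum>i\<in>I. e i j))"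
    by (intro leads_mult) auto
  with insert.hyps show ?case by simp
qed

lemma leads_polyfun: "leads m w f e \<Longrightarrow> f \<in> polyfun m"
proof -
  assume "leads m w f e"
  then have "(\<lambda>x. f x - mon m e x) \<in> polyfun m"
    unfolding leads_def low_def by (auto elim!: lcomb_polyfun intro: polyfun_mon)
  from pf_add[OF this polyfun_mon[of m e]] show ?thesis by simp
qed

definition ind :: "nat set \<Rightarrow> nat \<Rightarrow> nat" where
  "ind V j = (if j \<in> V then 1 else 0)"

text \<open>The leading monomials are squarefree, \<open>V i\<close> being the set of variables of
  the one with index \<open>i\<close>, and disjointness of these sets is coprimality. This is the
  situation in which a family is a Groebner basis of its ideal and a regular sequence in any
  order.\<close>

locale coprime_leads =
  fixes m :: nat and w :: "nat \<Rightarrow> nat" and I :: "'i set" and V :: "'i \<Rightarrow> nat set"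
    and g :: "'i \<Rightarrow> (nat \<Rightarrow> complex) \<Rightarrow> complex"
  assumes finI: "finite I"
    and Vne: "i \<in> I \<Longrightarrow> V i \<noteq> {}"
    and Vsub: "i \<in> I \<Longrightarrow> V i \<subseteq> {..<m}"
    and disj: "i \<in> I \<Longrightarrow> i' \<in> I \<Longrightarrow> i \<noteq> i' \<Longrightarrow> V i \<inter> V i' = {}"
    and lead: "i \<in> I \<Longrightarrow> leads m w (g i) (ind (V i))"
begin

lemma finV: "i \<in> I \<Longrightarrow> finite (V i)"
  using Vsub finite_subset by blast

text \<open>The largest power of the squarefree monomial of \<open>V i\<close> that divides the
  monomial with exponent \<open>e\<close>; \<open>rest e\<close> is the cofactor once all these
  powers are removed.\<close>

definition mlt :: "(nat \<Rightarrow> nat) \<Rightarrow> 'i \<Rightarrow> nat" where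
  "mlt e i = Min (e ` V i)"

definition rest :: "(nat \<Rightarrow> nat) \<Rightarrow> nat \<Rightarrow> nat" where
  "rest e j = e j - (\<Sum>i\<in>I. mlt e i * ind (V i) j)"

text \<open>The polynomials \<open>ghat e\<close> form a basis of the polynomial ring: \<open>ghat e\<close> has leading monomial
  \<open>e\<close>. Multiplication by \<open>g i\<close> acts on it as multiplication by the monomial of \<open>V i\<close> acts on monomials.\<close>

definition ghat :: "(nat \<Rightarrow> nat) \<Rightarrow> (nat \<Rightarrow> complex) \<Rightarrow> complex" where
  "ghat e x = (\<Prod>i\<in>I. g i x ^ mlt e i) * mon m (rest e) x"

text \<open>Disjointness leaves at most one summand at each \<open>j\<close>. Hence the truncated
  subtraction in \<open>rest\<close> is a true one.\<close>

lemma mlt_sum_le: "(\<Sum>i\<in>I. mlt e i * ind (V i) j) \<le> e j"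
proof (cases "\<exists>i\<in>I. j \<in> V i")
  case True
  then obtain i where i: "i \<in> I" "j \<in> V i" by blast
  have "(\<Sum>i'\<in>I. mlt e i' * ind (V i') j) = (\<Sum>i'\<in>I. if i' = i then mlt e i else 0)"
    using disj[OF i(1)] i by (intro sum.cong) (auto simp: ind_def)
  also have "\<dots> = mlt e i" using finI i(1) by simp
  also have "\<dots> \<le> e j" unfolding mlt_def using finV[OF i(1)] i(2) by simp
  finally show ?thesis .
next
  case False
  then have "(\<Sum>i\<in>I. mlt e i * ind (V i) j) = 0" by (auto simp: ind_def)
  then show ?thesis by simp
qed

lemma rest_exps: "e \<in> exps m \<Longrightarrow> rest e \<in> exps m"
  unfolding exps_def rest_def by simp

lemma leads_ghat:
  assumes "e \<in> exps m"
  shows "leads m w (ghat e) e"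
proof -
  have "leads m w (\<lambda>x. (\<Prod>i\<in>I. g i x ^ mlt e i) * mon m (rest e) x)
     (\<lambda>j. (\<Sum>i\<in>I. mlt e i * ind (V i) j) + rest e j)"
    by (intro leads_mult leads_prod[OF finI] leads_power lead leads_mon rest_exps assms)
  moreover have "(\<lambda>j. (\<Sum>i\<in>I. mlt e i * ind (V i) j) + rest e j) = e"
    using mlt_sum_le[of e] by (simp add: rest_def fun_eq_iff)
  ultimately show ?thesis unfolding ghat_def[abs_def] by simp
qed

text \<open>By disjointness the additional factor raises the multiplicity at \<open>i\<close> by one
  and changes neither the other multiplicities nor the cofactor.\<close>

lemma ghat_shift:
  assumes "i \<in> I"
  shows "ghat (\<lambda>j. e j + ind (V i) j) x = g i x * ghat e x"
proof -
  let ?e = "\<lambda>j. e j + ind (V i) j"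
  have m1: "mlt ?e i = Suc (mlt e i)"
  proof -
    have "?e ` V i = Suc ` (e ` V i)" by (force simp: ind_def)
    then have "mlt ?e i = Min (Suc ` (e ` V i))" unfolding mlt_def by (rule arg_cong)
    also have "\<dots> = Suc (Min (e ` V i))"
      using finV[OF assms] Vne[OF assms] by (intro mono_Min_commute[symmetric]) (auto simp: mono_def)
    finally show ?thesis unfolding mlt_def .
  qed
  have m2: "mlt ?e i' = mlt e i'" if "i' \<in> I" "i' \<noteq> i" for i'
  proof -
    have "?e ` V i' = e ` V i'" using disj[OF that(1) assms that(2)] by (force simp: ind_def)
    then show ?thesis unfolding mlt_def by (rule arg_cong)
  qed
  have "(\<Sum>i'\<in>I. mlt ?e i' * ind (V i') j) = (\<Sum>i'\<in>I. mlt e i' * ind (V i') j) + ind (V i) j" for j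
  proof -
    have "(\<Sum>i'\<in>I. mlt ?e i' * ind (V i') j) = mlt ?e i * ind (V i) j + (\<Sum>i'\<in>I - {i}. mlt ?e i' * ind (V i') j)"
      by (rule sum.remove[OF finI assms])
    also have "(\<Sum>i'\<in>I - {i}. mlt ?e i' * ind (V i') j) = (\<Sum>i'\<in>I - {i}. mlt e i' * ind (V i') j)"
      by (intro sum.cong) (auto simp: m2)
    finally show ?thesis using sum.remove[OF finI assms, of "\<lambda>i'. mlt e i' * ind (V i') j"] m1 by simp
  qed
  then have r: "rest ?e = rest e" by (simp add: rest_def fun_eq_iff)
  have "(\<Prod>i'\<in>I. g i' x ^ mlt ?e i') = g i x * (\<Prod>i'\<in>I. g i' x ^ mlt e i')"
  proof -
    have "(\<Prod>i'\<in>I. g i' x ^ mlt ?e i') = g i x ^ mlt ?e i * (\<Prod>i'\<in>I - {i}. g i' x ^ mlt ?e i')"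
      by (rule prod.remove[OF finI assms])
    also have "(\<Prod>i'\<in>I - {i}. g i' x ^ mlt ?e i') = (\<Prod>i'\<in>I - {i}. g i' x ^ mlt e i')"
      by (intro prod.cong) (auto simp: m2)
    finally show ?thesis using prod.remove[OF finI assms, of "\<lambda>i'. g i' x ^ mlt e i'"] m1 by simp
  qed
  then show ?thesis unfolding ghat_def r by simp
qed

text \<open>The change from monomials to \<open>ghat\<close> is unitriangular for the weight, so
  induction on the weight inverts it.\<close>

lemma mon_ghat: "e \<in> exps m \<Longrightarrow> mon m e \<in> lcomb (exps m) ghat"
proof (induction "wt m w e" arbitrary: e rule: less_induct)
  case less
  have "(\<lambda>x. ghat e x - mon m e x) \<in> lcomb {e' \<in> exps m. wt m w e' < wt m w e} (mon m)"
    using leads_ghat[OF less.prems] unfolding leads_def low_def by simp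
  then have "(\<lambda>x. ghat e x - mon m e x) \<in> lcomb (exps m) ghat"
    by (rule lcomb_subset) (use less in auto)
  from lcomb_diff[OF lcomb_base[OF less.prems, of ghat] this] show ?case by simp
qed

lemma polyfun_ghat: "p \<in> polyfun m \<Longrightarrow> p \<in> lcomb (exps m) ghat"
  using lcomb_subset[OF polyfun_lcomb_mon] mon_ghat by blast

text \<open>In a relation the terms of maximal weight contribute distinct leading monomials;
  everything else has smaller weight and cannot cancel them.\<close>

lemma ghat_independent:
  assumes "finite A" "A \<subseteq> exps m" "\<And>x. (\<Sum>e\<in>A. c e * ghat e x) = 0" "e0 \<in> A"
  shows "c e0 = 0"
proof (rule ccontr)
  assume ne: "c e0 \<noteq> 0"
  define B where "B = {e \<in> A. c e \<noteq> 0}"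
  have B: "finite B" "B \<noteq> {}" "B \<subseteq> exps m" using assms ne by (auto simp: B_def)
  define K where "K = Max (wt m w ` B)"
  define T where "T = {e \<in> B. wt m w e = K}"
  have le: "wt m w e \<le> K" if "e \<in> B" for e using that B by (simp add: K_def)
  have "K \<in> wt m w ` B" unfolding K_def using B by (intro Max_in) auto
  then obtain e1 where e1: "e1 \<in> T" by (auto simp: T_def)
  \<comment> \<open>\<open>L\<close> collects all that has weight below \<open>K\<close>: the tails
    of the \<open>ghat e\<close> and the leading monomials outside \<open>T\<close>.\<close>
  define L where "L = (\<lambda>x. (\<Sum>e\<in>B. c e * (ghat e x - mon m e x)) + (\<Sum>e\<in>B - T. c e * mon m e x))"
  have "L \<in> low m w K" unfolding L_def low_def
  proof (intro lcomb_add lcomb_sum lcomb_scale)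
    fix e assume "e \<in> B"
    then have "(\<lambda>x. ghat e x - mon m e x) \<in> low m w (wt m w e)"
      using leads_ghat B unfolding leads_def by blast
    then show "(\<lambda>x. ghat e x - mon m e x) \<in> lcomb {e \<in> exps m. wt m w e < K} (mon m)"
      using low_mono[OF _ le[OF \<open>e \<in> B\<close>]] unfolding low_def by blast
  next
    fix e assume "e \<in> B - T"
    then have "wt m w e < K" "e \<in> exps m" using le[of e] B by (auto simp: T_def)
    then show "mon m e \<in> lcomb {e \<in> exps m. wt m w e < K} (mon m)" by (intro lcomb_base) simp
  qed
  then obtain A' d where A': "finite A'" "A' \<subseteq> {e \<in> exps m. wt m w e < K}" "L = (\<lambda>x. \<Sum>e\<in>A'. d e * mon m e x)"
    unfolding low_def lcomb_def by blast
  have T: "T \<subseteq> B" "finite T" using B by (auto simp: T_def)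
  have dis: "T \<inter> A' = {}" using A' by (auto simp: T_def)
  have "(\<Sum>e\<in>T \<union> A'. (if e \<in> T then c e else d e) * mon m e x) = 0" for x
  proof -
    have "(\<Sum>e\<in>T \<union> A'. (if e \<in> T then c e else d e) * mon m e x) = (\<Sum>e\<in>T. c e * mon m e x) + (\<Sum>e\<in>A'. d e * mon m e x)"
      using dis by (subst sum.union_disjoint[OF T(2) A'(1) dis]) (auto intro!: arg_cong2[where f="(+)"] sum.cong)
    also have "(\<Sum>e\<in>A'. d e * mon m e x) = L x" unfolding A'(3) ..
    also have "(\<Sum>e\<in>T. c e * mon m e x) + L x = (\<Sum>e\<in>B. c e * mon m e x) + (\<Sum>e\<in>B. c e * (ghat e x - mon m e x))"
      unfolding L_def using sum.subset_diff[OF T(1) B(1), of "\<lambda>e. c e * mon m e x"] by simp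
    also have "\<dots> = (\<Sum>e\<in>B. c e * ghat e x)" by (simp add: sum.distrib[symmetric] algebra_simps)
    also have "\<dots> = (\<Sum>e\<in>A. c e * ghat e x)" unfolding B_def using assms(1) by (intro sum.mono_neutral_left) auto
    finally show ?thesis using assms(3) by simp
  qed
  from mon_independent[OF _ _ this, of e1] e1 T B A' have "c e1 = 0" by auto
  with e1 show False by (auto simp: T_def B_def)
qed

text \<open>In the basis \<open>ghat\<close>, multiplication by \<open>g i\<close> is a shift of
  exponents. The relation has coefficient zero at a basis element reached by the shift from
  \<open>r\<close>, so some other shift reaches it too. Its monomial is then divisible by that of
  \<open>V i\<close>, and a factor \<open>g i\<close> splits off the corresponding term of
  \<open>F r\<close>.\<close>

lemma regular:
  assumes F: "\<And>i. i \<in> I \<Longrightarrow> F i \<in> polyfun m" and z: "\<And>x. (\<Sum>i\<in>I. g i x * F i x) = 0" and r: "r \<in> I"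
  shows "F r \<in> gideal m (I - {r}) g"
proof -
  have "\<forall>i\<in>I. \<exists>A c. finite A \<and> A \<subseteq> exps m \<and> F i = (\<lambda>x. \<Sum>e\<in>A. c e * ghat e x)"
    using polyfun_ghat[OF F] unfolding lcomb_def by blast
  then obtain A' c' where A': "\<And>i. i \<in> I \<Longrightarrow> finite (A' i) \<and> A' i \<subseteq> exps m \<and> F i = (\<lambda>x. \<Sum>e\<in>A' i. c' i e * ghat e x)"
    by metis
  define A where "A = (\<Union>i\<in>I. A' i)"
  define c where "c i e = (if e \<in> A' i then c' i e else 0)" for i e
  have A: "finite A" "A \<subseteq> exps m" using finI A' by (auto simp: A_def)
  have Fi: "F i x = (\<Sum>e\<in>A. c i e * ghat e x)" if "i \<in> I" for i x
  proof -
    have "F i x = (\<Sum>e\<in>A' i. c' i e * ghat e x)" using A'[OF that] by simp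
    also have "\<dots> = (\<Sum>e\<in>A. c i e * ghat e x)"
      using A A' that by (intro sum.mono_neutral_cong_left) (auto simp: A_def c_def)
    finally show ?thesis .
  qed
  define sh where "sh i e = (\<lambda>j. e j + ind (V i) j)" for i and e :: "nat \<Rightarrow> nat"
  have inj: "inj (sh i)" for i by (rule injI) (auto simp: sh_def fun_eq_iff)
  have she: "sh i e \<in> exps m" if "i \<in> I" "e \<in> exps m" for i e
    using that Vsub[of i] unfolding sh_def exps_def ind_def by auto
  define E where "E = (\<Union>i\<in>I. sh i ` A)"
  \<comment> \<open>\<open>C e'\<close> is the coefficient of \<open>ghat e'\<close> in the whole
    relation; shifts are injective, so each \<open>i\<close> contributes at most one term.\<close>
  define C where "C e' = (\<Sum>i\<in>I. if e' \<in> sh i ` A then c i (inv (sh i) e') else 0)" for e'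
  have E: "finite E" "E \<subseteq> exps m" using finI A she by (auto simp: E_def)
  have "(\<Sum>e'\<in>E. C e' * ghat e' x) = 0" for x
  proof -
    have "(\<Sum>e'\<in>E. C e' * ghat e' x) = (\<Sum>e'\<in>E. \<Sum>i\<in>I. (if e' \<in> sh i ` A then c i (inv (sh i) e') * ghat e' x else 0))"
      unfolding C_def sum_distrib_right by (intro sum.cong) auto
    also have "\<dots> = (\<Sum>i\<in>I. \<Sum>e'\<in>E. (if e' \<in> sh i ` A then c i (inv (sh i) e') * ghat e' x else 0))"
      by (rule sum.swap)
    also have "\<dots> = (\<Sum>i\<in>I. g i x * F i x)"
    proof (rule sum.cong[OF refl])
      fix i assume i: "i \<in> I"
      have "(\<Sum>e'\<in>E. (if e' \<in> sh i ` A then c i (inv (sh i) e') * ghat e' x else 0)) =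
          (\<Sum>e'\<in>sh i ` A. c i (inv (sh i) e') * ghat e' x)"
        using E i by (intro sum.mono_neutral_cong_right) (auto simp: E_def)
      also have "\<dots> = (\<Sum>e\<in>A. c i e * ghat (sh i e) x)"
        by (subst sum.reindex) (auto intro: inj_on_subset[OF inj] simp: inv_f_f[OF inj])
      also have "\<dots> = g i x * F i x"
        unfolding Fi[OF i] sh_def ghat_shift[OF i] by (simp add: sum_distrib_left mult.left_commute)
      finally show "(\<Sum>e'\<in>E. (if e' \<in> sh i ` A then c i (inv (sh i) e') * ghat e' x else 0)) = g i x * F i x" .
    qed
    finally show ?thesis using z by simp
  qed
  from ghat_independent[OF E this] have C0: "C e' = 0" if "e' \<in> E" for e' using that by blast
  have key: "(\<lambda>x. c r e * ghat e x) \<in> gideal m (I - {r}) g" if e: "e \<in> A" for e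
  proof (cases "c r e = 0")
    case True
    then show ?thesis using gideal_zero by simp
  next
    case False
    have "\<exists>i\<in>I - {r}. sh r e \<in> sh i ` A"
    proof (rule ccontr)
      assume "\<not> ?thesis"
      then have "C (sh r e) = (\<Sum>i\<in>I. if i = r then c r e else 0)"
        unfolding C_def using e by (intro sum.cong) (auto simp: inv_f_f[OF inj])
      also have "\<dots> = c r e" using finI r by simp
      finally show False using C0[of "sh r e"] e r False by (auto simp: E_def)
    qed
    then obtain i e'' where i: "i \<in> I" "i \<noteq> r" and e'': "e'' \<in> A" "sh r e = sh i e''" by blast
    \<comment> \<open>\<open>V i\<close> and \<open>V r\<close> are disjoint, so the monomial of
      \<open>V i\<close>, which divides the shifted exponent, already divides
      \<open>e\<close>.\<close>
    define d where "d j = e j - ind (V i) j" for j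
    have "ind (V i) j \<le> e j" for j
      using fun_cong[OF e''(2), of j] disj[OF i(1) r i(2)] by (auto simp: sh_def ind_def split: if_splits)
    then have de: "e = (\<lambda>j. d j + ind (V i) j)" by (simp add: d_def fun_eq_iff)
    have dm: "d \<in> exps m" using e A by (auto simp: d_def exps_def)
    have "ghat e = (\<lambda>x. g i x * ghat d x)" by (rule ext, subst de, rule ghat_shift[OF i(1)])
    moreover have "(\<lambda>x. (c r e * ghat d x) * g i x) \<in> gideal m (I - {r}) g"
      using i finI leads_polyfun[OF leads_ghat[OF dm]] by (intro gideal_mult gideal_base polyfun_intros) auto
    ultimately show ?thesis by (simp add: mult_ac)
  qed
  have "F r = (\<lambda>x. \<Sum>e\<in>A. c r e * ghat e x)" using Fi[OF r] by auto
  then show ?thesis using gideal_sum[OF key] by simp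
qed

end

section \<open>The variety of pairs of complementary \<open>N \<times> 2\<close> matrices\<close>

text \<open>A point \<open>z\<close> encodes spinors \<open>\<lambda>\<^sub>l = (z (4l), z (4l+1))\<close> and \<open>\<mu>\<^sub>l = (z (4l+2), z (4l+3))\<close>
  with \<open>k\<^sub>l = \<lambda>\<^sub>l \<mu>\<^sub>l\<^sup>T\<close>.\<close>

definition eqn :: "nat \<Rightarrow> nat \<Rightarrow> nat \<Rightarrow> (nat \<Rightarrow> complex) \<Rightarrow> complex" where
  "eqn N \<alpha> \<beta> z = (\<Sum>l<N. z (4*l+\<alpha>) * z (4*l+(2+\<beta>)))"

text \<open>Coordinates from \<open>4*N\<close> on are left free, since functions in
  \<open>polyfun (4*N)\<close> do not see them.\<close>

definition Xhat :: "nat \<Rightarrow> (nat \<Rightarrow> complex) set" where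
  "Xhat N = {z. \<forall>\<alpha><2. \<forall>\<beta><2. eqn N \<alpha> \<beta> z = 0}"

text \<open>The two binary digits of \<open>i < 4\<close> number the equations, which turns them
  into a family over \<open>{..<4}\<close>.\<close>

definition gJ :: "nat \<Rightarrow> nat \<Rightarrow> (nat \<Rightarrow> complex) \<Rightarrow> complex" where
  "gJ N i = eqn N (i div 2) (i mod 2)"

definition cr :: "nat \<Rightarrow> nat \<Rightarrow> (nat \<Rightarrow> complex) \<Rightarrow> complex" where
  "cr l l' z = z (4*l) * z (4*l'+1) - z (4*l+1) * z (4*l')"

lemma block_divmod: "r < 4 \<Longrightarrow> (4*l+r) div 4 = l" "r < 4 \<Longrightarrow> (4*l+r) mod 4 = (r::nat)"
  by auto

lemma less_2_zero_one: "\<alpha> < 2 \<Longrightarrow> \<alpha> = 0 \<or> \<alpha> = (1::nat)"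
  by auto

lemma block_less: "l < N \<Longrightarrow> r < 4 \<Longrightarrow> 4*l+r < 4*(N::nat)"
  by auto

lemma polyfun_cr: "l < N \<Longrightarrow> l' < N \<Longrightarrow> cr l l' \<in> polyfun (4*N)"
  unfolding cr_def[abs_def] by (intro polyfun_intros) auto

lemma gJ_Xhat: "z \<in> Xhat N \<Longrightarrow> i < 4 \<Longrightarrow> gJ N i z = 0"
proof -
  assume "z \<in> Xhat N" "i < 4"
  moreover have "i div 2 < 2" "i mod 2 < 2" using \<open>i < 4\<close> by auto
  ultimately show ?thesis unfolding gJ_def Xhat_def by blast
qed

abbreviation eqn_ideal :: "nat \<Rightarrow> ((nat \<Rightarrow> complex) \<Rightarrow> complex) set" where
  "eqn_ideal N \<equiv> gideal (4*N) {..<4} (gJ N)"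

lemma eqn_ideal_Xhat: "f \<in> eqn_ideal N \<Longrightarrow> z \<in> Xhat N \<Longrightarrow> f z = 0"
  unfolding gideal_def by (auto simp: gJ_Xhat)

lemma eqn_in_ideal: "\<alpha> < 2 \<Longrightarrow> \<beta> < 2 \<Longrightarrow> eqn N \<alpha> \<beta> \<in> eqn_ideal N"
proof -
  assume *: "\<alpha> < 2" "\<beta> < 2"
  then have "gJ N (2*\<alpha>+\<beta>) = eqn N \<alpha> \<beta>" unfolding gJ_def by (intro arg_cong2[where f="eqn N"]) auto
  moreover have "gJ N (2*\<alpha>+\<beta>) \<in> eqn_ideal N" using * by (intro gideal_base) auto
  ultimately show ?thesis by simp
qed

section \<open>Cramer's rule and a parametrisation by free spinors\<close>

lemma sum_split2:
  assumes "2 \<le> N"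
  shows "(\<Sum>l<N. f l) = f 0 + f 1 + (\<Sum>l\<in>{2..<N}. f (l::nat) :: complex)"
proof -
  have "{..<N} = {0,1} \<union> {2..<N}" using assms by auto
  then show ?thesis by (simp add: sum.union_disjoint)
qed

text \<open>The terms with \<open>eqn\<close> are kept, so that the formula holds at every point and
  yields congruences modulo the equations as well as values on \<open>Xhat N\<close>.\<close>

lemma cramer0:
  assumes "2 \<le> N"
  shows "cr 1 0 z * z (2+\<beta>) = (\<Sum>l\<in>{2..<N}. cr l 1 z * z (4*l+(2+\<beta>))) - eqn N 0 \<beta> z * z 5 + eqn N 1 \<beta> z * z 4"
proof -
  have "(\<Sum>l\<in>{2..<N}. cr l 1 z * z (4*l+(2+\<beta>))) =
     (\<Sum>l\<in>{2..<N}. z (4*l+0) * z (4*l+(2+\<beta>))) * z 5 - (\<Sum>l\<in>{2..<N}. z (4*l+1) * z (4*l+(2+\<beta>))) * z 4"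
    unfolding cr_def sum_distrib_right sum_subtractf[symmetric] by (rule sum.cong) (simp_all add: algebra_simps)
  then show ?thesis
    unfolding eqn_def sum_split2[OF assms] cr_def by (simp add: algebra_simps)
qed

lemma cramer1:
  assumes "2 \<le> N"
  shows "cr 1 0 z * z (4+(2+\<beta>)) = eqn N 0 \<beta> z * z 1 - eqn N 1 \<beta> z * z 0 - (\<Sum>l\<in>{2..<N}. cr l 0 z * z (4*l+(2+\<beta>)))"
proof -
  have "(\<Sum>l\<in>{2..<N}. cr l 0 z * z (4*l+(2+\<beta>))) =
     (\<Sum>l\<in>{2..<N}. z (4*l+0) * z (4*l+(2+\<beta>))) * z 1 - (\<Sum>l\<in>{2..<N}. z (4*l+1) * z (4*l+(2+\<beta>))) * z 0"
    unfolding cr_def sum_distrib_right sum_subtractf[symmetric] by (rule sum.cong) (simp_all add: algebra_simps)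
  then show ?thesis
    unfolding eqn_def sum_split2[OF assms] cr_def by (simp add: algebra_simps)
qed

text \<open>\<open>Psi N\<close> parametrises \<open>Xhat N\<close>: the spinors \<open>\<mu>\<^sub>l\<close> with \<open>l \<ge> 2\<close> are free, and
  \<open>\<mu>\<^sub>0\<close>, \<open>\<mu>\<^sub>1\<close> follow by Cramer's rule, with the denominator \<open>cr 1 0\<close> cleared.\<close>

definition Psi :: "nat \<Rightarrow> (nat \<Rightarrow> complex) \<Rightarrow> nat \<Rightarrow> complex" where
  "Psi N z j = (if j mod 4 < 2 then z j
     else if j div 4 = 0 then (\<Sum>l\<in>{2..<N}. cr l 1 z * z (4*l + j mod 4))
     else if j div 4 = 1 then - (\<Sum>l\<in>{2..<N}. cr l 0 z * z (4*l + j mod 4))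
     else cr 1 0 z * z j)"

lemma Psi_lam: "\<alpha> < 2 \<Longrightarrow> Psi N z (4*l+\<alpha>) = z (4*l+\<alpha>)"
  unfolding Psi_def by simp

lemma Psi_mu:
  assumes "\<beta> < 2"
  shows "Psi N z (2+\<beta>) = (\<Sum>l\<in>{2..<N}. cr l 1 z * z (4*l+(2+\<beta>)))"
    "Psi N z (4+(2+\<beta>)) = - (\<Sum>l\<in>{2..<N}. cr l 0 z * z (4*l+(2+\<beta>)))"
    "2 \<le> l \<Longrightarrow> Psi N z (4*l+(2+\<beta>)) = cr 1 0 z * z (4*l+(2+\<beta>))"
  using assms block_divmod[of "2+\<beta>" 0] block_divmod[of "2+\<beta>" 1] block_divmod[of "2+\<beta>" l]
  unfolding Psi_def by auto

lemma cr_Psi: "cr l l' (Psi N z) = cr l l' z"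
  unfolding cr_def using Psi_lam[of 0 N z l] Psi_lam[of 0 N z l'] Psi_lam[of 1 N z l] Psi_lam[of 1 N z l'] by simp

lemma Psi_Xhat:
  assumes "2 \<le> N"
  shows "Psi N z \<in> Xhat N"
  unfolding Xhat_def
proof (intro CollectI allI impI)
  fix \<alpha> \<beta> :: nat assume ab: "\<alpha> < 2" "\<beta> < 2"
  have a: "Psi N z (4*l+\<alpha>) = z (4*l+\<alpha>)" for l by (rule Psi_lam[OF ab(1)])
  \<comment> \<open>Any three vectors of the plane satisfy this relation with their minors as
    coefficients.\<close>
  have pl: "z \<alpha> * cr l 1 z - z (4+\<alpha>) * cr l 0 z + cr 1 0 z * z (4*l+\<alpha>) = 0" for l
    using less_2_zero_one[OF ab(1)] unfolding cr_def by (auto simp: algebra_simps)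
  have "eqn N \<alpha> \<beta> (Psi N z) = z \<alpha> * Psi N z (2+\<beta>) + z (4+\<alpha>) * Psi N z (4+(2+\<beta>)) +
      (\<Sum>l\<in>{2..<N}. z (4*l+\<alpha>) * Psi N z (4*l+(2+\<beta>)))"
    unfolding eqn_def a sum_split2[OF assms] by simp
  also have "(\<Sum>l\<in>{2..<N}. z (4*l+\<alpha>) * Psi N z (4*l+(2+\<beta>))) = (\<Sum>l\<in>{2..<N}. z (4*l+\<alpha>) * (cr 1 0 z * z (4*l+(2+\<beta>))))"
    by (intro sum.cong refl arg_cong2[where f="(*)"] Psi_mu(3)[OF ab(2)]) simp
  also have "z \<alpha> * Psi N z (2+\<beta>) + z (4+\<alpha>) * Psi N z (4+(2+\<beta>)) + \<dots> =
      (\<Sum>l\<in>{2..<N}. (z \<alpha> * cr l 1 z - z (4+\<alpha>) * cr l 0 z + cr 1 0 z * z (4*l+\<alpha>)) * z (4*l+(2+\<beta>)))"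
    unfolding Psi_mu(1,2)[OF ab(2)]
    by (simp add: sum_distrib_left sum_negf[symmetric] sum.distrib[symmetric] algebra_simps)
  also have "\<dots> = 0" unfolding pl by simp
  finally show "eqn N \<alpha> \<beta> (Psi N z) = 0" .
qed

text \<open>On \<open>Xhat N\<close> Cramer's rule holds without error terms, so the parametrisation
  returns the point with every \<mu> multiplied by \<open>cr 1 0\<close>; where this minor is
  nonzero the scaling can be undone.\<close>

lemma Psi_on_Xhat:
  assumes "2 \<le> N" "z \<in> Xhat N" "\<beta> < 2"
  shows "Psi N z (4*l+(2+\<beta>)) = cr 1 0 z * z (4*l+(2+\<beta>))"
proof -
  have e: "eqn N 0 \<beta> z = 0" "eqn N 1 \<beta> z = 0" using assms unfolding Xhat_def by auto
  consider "l = 0" | "l = 1" | "2 \<le> l" by linarith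
  then show ?thesis
  proof cases
    case 1
    with Psi_mu(1)[OF assms(3), of N z] cramer0[OF assms(1), of z \<beta>] e show ?thesis by simp
  next
    case 2
    with Psi_mu(2)[OF assms(3), of N z] cramer1[OF assms(1), of z \<beta>] e show ?thesis by simp
  next
    case 3
    then show ?thesis by (rule Psi_mu(3)[OF assms(3)])
  qed
qed

text \<open>The indices 2, 3, 6, 7 are the coordinates of the spinors \<mu> of blocks 0 and 1, which
  Cramer's rule expresses by all others.\<close>

definition mu_free :: "((nat \<Rightarrow> complex) \<Rightarrow> complex) \<Rightarrow> bool" where
  "mu_free q \<longleftrightarrow> (\<forall>z z'. (\<forall>j. j \<notin> {2,3,6,7} \<longrightarrow> z j = z' j) \<longrightarrow> q z = q z')"

lemma mu_free_cr: "mu_free (cr l l')"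
  unfolding mu_free_def
proof (intro allI impI)
  fix z z' :: "nat \<Rightarrow> complex" assume *: "\<forall>j. j \<notin> {2,3,6,7} \<longrightarrow> z j = z' j"
  have "z (4*l+r) = z' (4*l+r)" if "r < 2" for l r
  proof -
    have "4*l+r \<noteq> 2" "4*l+r \<noteq> 3" "4*l+r \<noteq> 6" "4*l+r \<noteq> 7" using that by presburger+
    then have "4*l+r \<notin> {2,3,6,7}" by simp
    with * show ?thesis by blast
  qed
  from this[of 0 l] this[of 1 l] this[of 0 l'] this[of 1 l'] show "cr l l' z = cr l l' z'"
    unfolding cr_def by simp
qed

lemma mu_free_extend:
  assumes "2 \<le> N" "cr 1 0 z \<noteq> 0"
  obtains z' where "z' \<in> Xhat N" "\<And>q. mu_free q \<Longrightarrow> q z' = q z"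
proof -
  \<comment> \<open>The free \<mu> are divided by \<open>cr 1 0\<close> beforehand because
    \<open>Psi\<close> multiplies them by it.\<close>
  define z1 where "z1 j = (if j mod 4 < 2 then z j else z j / cr 1 0 z)" for j
  have l1: "z1 (4*l+r) = z (4*l+r)" if "r < 2" for l r using that by (simp add: z1_def)
  have c1: "cr l l' z1 = cr l l' z" for l l'
    unfolding cr_def using l1[of 0 l] l1[of 0 l'] l1[of 1 l] l1[of 1 l'] by simp
  have "Psi N z1 j = z j" if "j \<notin> {2,3,6,7}" for j
  proof (cases "j mod 4 < 2")
    case True
    then show ?thesis by (simp add: Psi_def z1_def)
  next
    case False
    have "j div 4 \<noteq> 0 \<and> j div 4 \<noteq> 1"
    proof (rule ccontr)
      assume "\<not> ?thesis"
      then have "j < 8" by auto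
      moreover have "j \<noteq> 2" "j \<noteq> 3" "j \<noteq> 6" "j \<noteq> 7" using that by auto
      ultimately show False using False by presburger
    qed
    with False assms(2) show ?thesis by (simp add: Psi_def c1) (simp add: z1_def)
  qed
  then have "\<And>q. mu_free q \<Longrightarrow> q (Psi N z1) = q z" unfolding mu_free_def by blast
  with Psi_Xhat[OF assms(1), of z1] show ?thesis by (rule that)
qed

text \<open>Once \<open>cr 1 0\<close> is inverted, the equations are solved for four variables and
  the quotient ring becomes a localised polynomial ring. A congruence modulo
  \<open>eqn_ideal N\<close>, stronger than equality on \<open>Xhat N\<close>, is what later permits
  cancelling the minor.\<close>

lemma eliminate_mu:
  assumes N: "2 \<le> N" and p: "p \<in> polyfun (4*N)"
  shows "\<exists>k q. q \<in> polyfun (4*N) \<and> mu_free q \<and> (\<lambda>z. cr 1 0 z ^ k * p z - q z) \<in> eqn_ideal N"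
  using p
proof (induction)
  case (pf_const c)
  show ?case
    by (intro exI[of _ 0] exI[of _ "\<lambda>_. c"]) (auto simp: mu_free_def gideal_zero intro: polyfun.pf_const)
next
  case (pf_var j)
  have mf: "mu_free (\<lambda>z. \<Sum>l\<in>{2..<N}. cr l l' z * z (4*l+(2+\<beta>)))" for l' \<beta>
    unfolding mu_free_def
  proof (intro allI impI sum.cong refl)
    fix z z' :: "nat \<Rightarrow> complex" and l assume *: "\<forall>j. j \<notin> {2,3,6,7} \<longrightarrow> z j = z' j" "l \<in> {2..<N}"
    then have "z (4*l+(2+\<beta>)) = z' (4*l+(2+\<beta>))" by auto
    with mu_free_cr[of l l'] *(1) show "cr l l' z * z (4*l+(2+\<beta>)) = cr l l' z' * z' (4*l+(2+\<beta>))"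
      unfolding mu_free_def by metis
  qed
  have pf: "(\<lambda>z. \<Sum>l\<in>{2..<N}. cr l l' z * z (4*l+(2+\<beta>))) \<in> polyfun (4*N)" if "\<beta> < 2" "l' < 2" for l' \<beta>
    using that N by (intro polyfun_sum pf_mult polyfun_cr polyfun.pf_var) auto
  have v: "(\<lambda>z. z i) \<in> polyfun (4*N)" if "i < 8" for i using that N by (intro polyfun.pf_var) simp
  have m0: ?case if j: "j = 2 + \<beta>" and b: "\<beta> < 2" for \<beta>
  proof (intro exI[of _ 1] exI[of _ "\<lambda>z. \<Sum>l\<in>{2..<N}. cr l 1 z * z (4*l+(2+\<beta>))"] conjI mf pf b)
    have "(\<lambda>z. z 4 * eqn N 1 \<beta> z - z 5 * eqn N 0 \<beta> z) \<in> eqn_ideal N"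
      using b by (intro gideal_diff gideal_mult eqn_in_ideal v) auto
    also have "(\<lambda>z. z 4 * eqn N 1 \<beta> z - z 5 * eqn N 0 \<beta> z) =
       (\<lambda>z. cr 1 0 z ^ 1 * z j - (\<Sum>l\<in>{2..<N}. cr l 1 z * z (4*l+(2+\<beta>))))"
      unfolding j power_one_right cramer0[OF N] by (simp add: mult.commute)
    finally show "(\<lambda>z. cr 1 0 z ^ 1 * z j - (\<Sum>l\<in>{2..<N}. cr l 1 z * z (4*l+(2+\<beta>)))) \<in> eqn_ideal N" .
  qed simp
  have m1: ?case if j: "j = 4 + (2 + \<beta>)" and b: "\<beta> < 2" for \<beta>
  proof (intro exI[of _ 1] exI[of _ "\<lambda>z. - (\<Sum>l\<in>{2..<N}. cr l 0 z * z (4*l+(2+\<beta>)))"] conjI)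
    show "(\<lambda>z. - (\<Sum>l\<in>{2..<N}. cr l 0 z * z (4*l+(2+\<beta>)))) \<in> polyfun (4*N)"
      by (intro polyfun_uminus pf b) simp
    show "mu_free (\<lambda>z. - (\<Sum>l\<in>{2..<N}. cr l 0 z * z (4*l+(2+\<beta>))))"
      using mf[of 0 \<beta>] unfolding mu_free_def by (metis (mono_tags, lifting))
    have "(\<lambda>z. z 1 * eqn N 0 \<beta> z - z 0 * eqn N 1 \<beta> z) \<in> eqn_ideal N"
      using b by (intro gideal_diff gideal_mult eqn_in_ideal v) auto
    also have "(\<lambda>z. z 1 * eqn N 0 \<beta> z - z 0 * eqn N 1 \<beta> z) =
       (\<lambda>z. cr 1 0 z ^ 1 * z j - - (\<Sum>l\<in>{2..<N}. cr l 0 z * z (4*l+(2+\<beta>))))"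
      unfolding j power_one_right cramer1[OF N] by (simp add: mult.commute)
    finally show "(\<lambda>z. cr 1 0 z ^ 1 * z j - - (\<Sum>l\<in>{2..<N}. cr l 0 z * z (4*l+(2+\<beta>)))) \<in> eqn_ideal N" .
  qed
  have m2: ?case if "j \<notin> {2,3,6,7}"
    using that pf_var
    by (intro exI[of _ 0] exI[of _ "\<lambda>z. z j"]) (auto simp: mu_free_def gideal_zero intro: polyfun.pf_var)
  show ?case using m0[of 0] m0[of 1] m1[of 0] m1[of 1] m2 by auto
next
  case (pf_add p p')
  then obtain k q k' q' where q: "q \<in> polyfun (4*N)" "mu_free q" "(\<lambda>z. cr 1 0 z ^ k * p z - q z) \<in> eqn_ideal N"
    and q': "q' \<in> polyfun (4*N)" "mu_free q'" "(\<lambda>z. cr 1 0 z ^ k' * p' z - q' z) \<in> eqn_ideal N" by blast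
  have c: "cr 1 0 \<in> polyfun (4*N)" using N by (intro polyfun_cr) auto
  let ?q = "\<lambda>z. cr 1 0 z ^ k' * q z + cr 1 0 z ^ k * q' z"
  have "?q \<in> polyfun (4*N)" using q q' c by (intro polyfun_intros)
  moreover have "mu_free ?q" using q(2) q'(2) mu_free_cr[of 1 0] unfolding mu_free_def by metis
  moreover have "(\<lambda>z. cr 1 0 z ^ k' * (cr 1 0 z ^ k * p z - q z) + cr 1 0 z ^ k * (cr 1 0 z ^ k' * p' z - q' z)) \<in> eqn_ideal N"
    using q q' c by (intro gideal_add gideal_mult polyfun_power)
  ultimately show ?case
    by (intro exI[of _ "k+k'"] exI[of _ ?q]) (simp add: power_add algebra_simps)
next
  case (pf_mult p p')
  then obtain k q k' q' where q: "q \<in> polyfun (4*N)" "mu_free q" "(\<lambda>z. cr 1 0 z ^ k * p z - q z) \<in> eqn_ideal N"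
    and q': "q' \<in> polyfun (4*N)" "mu_free q'" "(\<lambda>z. cr 1 0 z ^ k' * p' z - q' z) \<in> eqn_ideal N" by blast
  have c: "cr 1 0 \<in> polyfun (4*N)" using N by (intro polyfun_cr) auto
  let ?q = "\<lambda>z. q z * q' z"
  have "?q \<in> polyfun (4*N)" using q q' by (intro polyfun_intros)
  moreover have "mu_free ?q" using q(2) q'(2) unfolding mu_free_def by metis
  moreover have "(\<lambda>z. (cr 1 0 z ^ k * p z) * (cr 1 0 z ^ k' * p' z - q' z) + q' z * (cr 1 0 z ^ k * p z - q z)) \<in> eqn_ideal N"
    using q q' c pf_mult.hyps by (intro gideal_add gideal_mult polyfun_intros)
  ultimately show ?case
    by (intro exI[of _ "k+k'"] exI[of _ ?q]) (simp add: power_add algebra_simps)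
qed

text \<open>Where \<open>cr 1 0\<close> is nonzero the free coordinates can be prescribed at will,
  so \<open>q\<close> vanishes on a dense subset of the whole space.\<close>

lemma mu_free_zero:
  assumes "2 \<le> N" "q \<in> polyfun (4*N)" "mu_free q" "\<And>z. z \<in> Xhat N \<Longrightarrow> q z = 0"
  shows "q z = 0"
proof -
  have c: "cr 1 0 \<in> polyfun (4*N)" using assms(1) by (intro polyfun_cr) auto
  have "cr 1 0 (\<lambda>j. if j = 1 \<or> j = 4 then 1 else 0) \<noteq> 0" by (simp add: cr_def)
  from polyfun_cancel[OF c assms(2) this] show ?thesis
    using mu_free_extend[OF assms(1)] assms(3,4) by metis
qed

subsection \<open>Leading monomials of the equations\<close>

lemma ind_exps: "V \<subseteq> {..<m} \<Longrightarrow> ind V \<in> exps m"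
  unfolding exps_def ind_def by auto

lemma mon_ind: "V \<subseteq> {..<m} \<Longrightarrow> mon m (ind V) x = (\<Prod>j\<in>V. x j)"
proof -
  assume V: "V \<subseteq> {..<m}"
  have "mon m (ind V) x = (\<Prod>j\<in>{..<m}. if j \<in> V then x j else 1)"
    unfolding mon_def ind_def by (intro prod.cong) auto
  also have "\<dots> = (\<Prod>j\<in>V. x j)" using V by (simp add: prod.inter_restrict[symmetric] Int_absorb1)
  finally show ?thesis .
qed

lemma wt_ind: "V \<subseteq> {..<m} \<Longrightarrow> wt m w (ind V) = (\<Sum>j\<in>V. w j)"
proof -
  assume V: "V \<subseteq> {..<m}"
  have "wt m w (ind V) = (\<Sum>j\<in>{..<m}. if j \<in> V then w j else 0)"
    unfolding wt_def ind_def by (intro sum.cong) auto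
  also have "\<dots> = (\<Sum>j\<in>V. w j)" using V by (simp add: sum.inter_restrict[symmetric] Int_absorb1)
  finally show ?thesis .
qed

lemma low_pair:
  assumes "u < m" "v < m" "u \<noteq> v" "w u + w v < k"
  shows "(\<lambda>z. z u * z v) \<in> low m w k"
proof -
  have "mon m (ind {u,v}) = (\<lambda>z. z u * z v)" using mon_ind[of "{u,v}" m] assms by auto
  then show ?thesis
    using low_mon[of "ind {u,v}" m w k] assms wt_ind[of "{u,v}" m w] by (simp add: ind_exps)
qed

lemma leads_var: "u < m \<Longrightarrow> leads m w (\<lambda>z. z u) (ind {u})"
proof -
  assume u: "u < m"
  then have "mon m (ind {u}) = (\<lambda>z. z u)" using mon_ind[of "{u}" m] by auto
  then show ?thesis using leads_mon[OF ind_exps[of "{u}" m], of w] u by simp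
qed

lemma leads_minor:
  assumes "u < m" "v < m" "u \<noteq> v" "u' < m" "v' < m" "u' \<noteq> v'" "w u' + w v' < w u + w v"
  shows "leads m w (\<lambda>z. z u * z v - z u' * z v') (ind {u,v})"
proof -
  have "(\<lambda>z. -1 * (z u' * z v')) \<in> low m w (w u + w v)"
    using low_pair[OF assms(4-7)] unfolding low_def by (rule lcomb_scale)
  then show ?thesis
    unfolding leads_def using assms(1-3) mon_ind[of "{u,v}" m] wt_ind[of "{u,v}" m w] by (simp add: ind_exps)
qed

lemma leads_eqn:
  fixes w :: "nat \<Rightarrow> nat"
  assumes i: "i < N" and ab: "\<alpha> < 2" "\<beta> < 2"
    and lt: "\<And>l. l < N \<Longrightarrow> l \<noteq> i \<Longrightarrow> w (4*l+\<alpha>) + w (4*l+(2+\<beta>)) < w (4*i+\<alpha>) + w (4*i+(2+\<beta>))"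
  shows "leads (4*N) w (eqn N \<alpha> \<beta>) (ind {4*i+\<alpha>, 4*i+(2+\<beta>)})"
proof -
  let ?k = "w (4*i+\<alpha>) + w (4*i+(2+\<beta>))"
  have "(\<lambda>z. \<Sum>l\<in>{..<N} - {i}. z (4*l+\<alpha>) * z (4*l+(2+\<beta>))) \<in> low (4*N) w ?k"
    unfolding low_def
  proof (rule lcomb_sum)
    fix l assume "l \<in> {..<N} - {i}"
    then show "(\<lambda>z. z (4*l+\<alpha>) * z (4*l+(2+\<beta>))) \<in> lcomb {e \<in> exps (4*N). wt (4*N) w e < ?k} (mon (4*N))"
      using low_pair[of "4*l+\<alpha>" "4*N" "4*l+(2+\<beta>)" w ?k] lt[of l] ab by (auto simp: low_def)
  qed
  also have "(\<lambda>z. \<Sum>l\<in>{..<N} - {i}. z (4*l+\<alpha>) * z (4*l+(2+\<beta>))) =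
      (\<lambda>z. eqn N \<alpha> \<beta> z - z (4*i+\<alpha>) * z (4*i+(2+\<beta>)))"
    unfolding eqn_def using i by (simp add: sum.remove[of "{..<N}" i])
  finally show ?thesis
    unfolding leads_def using i ab mon_ind[of "{4*i+\<alpha>, 4*i+(2+\<beta>)}" "4*N"] wt_ind[of "{4*i+\<alpha>, 4*i+(2+\<beta>)}" "4*N" w]
    by (simp add: ind_exps)
qed

lemma gideal_cong: "(\<And>i. i \<in> I \<Longrightarrow> g i = g' i) \<Longrightarrow> gideal m I g = gideal m I g'"
  unfolding gideal_def by (simp cong: sum.cong)

text \<open>Positions 4 and 5 hold the pair that is to be regular on \<open>Xhat N\<close>.\<close>

definition gext :: "nat \<Rightarrow> ((nat \<Rightarrow> complex) \<Rightarrow> complex) \<Rightarrow> ((nat \<Rightarrow> complex) \<Rightarrow> complex) \<Rightarrow> nat \<Rightarrow> (nat \<Rightarrow> complex) \<Rightarrow> complex" where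
  "gext N f f' i = (if i < 4 then gJ N i else if i = 4 then f else f')"

text \<open>The membership is read as a syzygy of the five functions with index below 5, to which
  \<open>regular\<close> applies at index 4.\<close>

lemma eqn_ideal_mult_cancel:
  assumes cl: "coprime_leads (4*N) w {..<6} V (gext N f f')" and F: "F \<in> polyfun (4*N)"
    and fF: "(\<lambda>z. f z * F z) \<in> eqn_ideal N"
  shows "F \<in> eqn_ideal N"
proof -
  have sub: "{..<5} \<subseteq> {..<6::nat}" by auto
  have "coprime_leads (4*N) w {..<5} V (gext N f f')"
    using cl sub unfolding coprime_leads_def by (meson finite_lessThan subsetD)
  then interpret coprime_leads "4*N" w "{..<5}" V "gext N f f'" .
  obtain H where H: "\<forall>i\<in>{..<4}. H i \<in> polyfun (4*N)" "(\<lambda>z. f z * F z) = (\<lambda>x. \<Sum>i<4. gJ N i x * H i x)"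
    using fF unfolding gideal_def by blast
  define G where "G i = (if i < 4 then (\<lambda>x. - H i x) else F)" for i :: nat
  have "F \<in> gideal (4*N) ({..<5} - {4}) (gext N f f')"
  proof -
    have "G 4 \<in> gideal (4*N) ({..<5} - {4}) (gext N f f')"
    proof (rule regular)
      show "G i \<in> polyfun (4*N)" if "i \<in> {..<5}" for i
        using H(1) F that by (auto simp: G_def intro: polyfun_uminus)
      fix x
      have "{..<5} = insert 4 {..<4::nat}" by auto
      then have "(\<Sum>i<5. gext N f f' i x * G i x) = f x * F x + (\<Sum>i<4. gext N f f' i x * G i x)"
        by (simp add: gext_def G_def)
      also have "(\<Sum>i<4. gext N f f' i x * G i x) = (\<Sum>i<4. - (gJ N i x * H i x))"
        by (intro sum.cong) (auto simp: gext_def G_def)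
      finally show "(\<Sum>i<5. gext N f f' i x * G i x) = 0" using fun_cong[OF H(2), of x] by (simp add: sum_negf)
    qed simp
    then show ?thesis by (simp add: G_def)
  qed
  moreover have "{..<5} - {4} = {..<4::nat}" by auto
  moreover have "gideal (4*N) {..<4} (gext N f f') = eqn_ideal N" by (rule gideal_cong) (simp add: gext_def)
  ultimately show ?thesis by simp
qed

lemma gext_leads:
  fixes w :: "nat \<Rightarrow> nat"
  assumes idx: "i00 < N" "i01 < N" "i10 < N" "i11 < N"
    and lt: "\<And>l. l < N \<Longrightarrow> l \<noteq> i00 \<Longrightarrow> w (4*l) + w (4*l+2) < w (4*i00) + w (4*i00+2)"
      "\<And>l. l < N \<Longrightarrow> l \<noteq> i01 \<Longrightarrow> w (4*l) + w (4*l+3) < w (4*i01) + w (4*i01+3)"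
      "\<And>l. l < N \<Longrightarrow> l \<noteq> i10 \<Longrightarrow> w (4*l+1) + w (4*l+2) < w (4*i10+1) + w (4*i10+2)"
      "\<And>l. l < N \<Longrightarrow> l \<noteq> i11 \<Longrightarrow> w (4*l+1) + w (4*l+3) < w (4*i11+1) + w (4*i11+3)"
    and f: "leads (4*N) w f (ind U)" "leads (4*N) w f' (ind U')"
    and V: "V = (\<lambda>i. [{4*i00, 4*i00+2}, {4*i01, 4*i01+3}, {4*i10+1, 4*i10+2}, {4*i11+1, 4*i11+3}, U, U'] ! i)"
    and ne: "U \<noteq> {}" "U' \<noteq> {}" and sub: "U \<subseteq> {..<4*N}" "U' \<subseteq> {..<4*N}"
    and dj: "\<And>i i'. i < i' \<Longrightarrow> i' < 6 \<Longrightarrow> V i \<inter> V i' = {}"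
  shows "coprime_leads (4*N) w {..<6} V (gext N f f')"
proof
  have six: "i = 0 \<or> i = 1 \<or> i = 2 \<or> i = 3 \<or> i = 4 \<or> i = 5" if "i < 6" for i :: nat using that by linarith
  show "finite {..<6::nat}" by simp
  fix i :: nat assume i: "i \<in> {..<6}"
  show "V i \<noteq> {}" using six[of i] i ne unfolding V by auto
  show "V i \<subseteq> {..<4*N}" using six[of i] i sub idx unfolding V by auto
  show "V i \<inter> V i' = {}" if "i' \<in> {..<6}" "i \<noteq> i'" for i'
    using dj[of i i'] dj[of i' i] that i by (cases "i < i'") (auto simp: Int_commute)
  have "leads (4*N) w (eqn N 0 0) (ind {4*i00, 4*i00+2})"
    using leads_eqn[OF idx(1), of 0 0 w] lt(1) by simp
  moreover have "leads (4*N) w (eqn N 0 1) (ind {4*i01, 4*i01+3})"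
    using leads_eqn[OF idx(2), of 0 1 w] lt(2) by simp
  moreover have "leads (4*N) w (eqn N 1 0) (ind {4*i10+1, 4*i10+2})"
    using leads_eqn[OF idx(3), of 1 0 w] lt(3) by simp
  moreover have "leads (4*N) w (eqn N 1 1) (ind {4*i11+1, 4*i11+3})"
    using leads_eqn[OF idx(4), of 1 1 w] lt(4) by simp
  ultimately show "leads (4*N) w (gext N f f' i) (ind (V i))"
    using six[of i] i f unfolding V gext_def gJ_def by auto
qed

lemma index6: "i < i' \<Longrightarrow> i' < 6 \<Longrightarrow>
   (i,i') \<in> {(0,1),(0,2),(0,3),(0,4),(0,5),(1,2),(1,3),(1,4),(1,5),(2,3),(2,4),(2,5),(3,4),(3,5),(4,5::nat)}"
proof -
  assume "i < i'" "i' < 6"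
  moreover from this have "i = 0 \<or> i = 1 \<or> i = 2 \<or> i = 3 \<or> i = 4"
    "i' = 1 \<or> i' = 2 \<or> i' = 3 \<or> i' = 4 \<or> i' = 5" by linarith+
  ultimately show ?thesis by (elim disjE) simp_all
qed

definition minor_mu :: "(nat \<Rightarrow> complex) \<Rightarrow> complex" where
  "minor_mu z = z 2 * z 7 - z 3 * z 6"

text \<open>The weights are chosen such that the six leading monomials are pairwise coprime.\<close>

lemma minors_coprime_leads:
  assumes "4 \<le> N"
  shows "\<exists>w V. coprime_leads (4*N) w {..<6} V (gext N (cr 1 0) minor_mu)"
proof -
  \<comment> \<open>Each group of four lists the weights of one block 0 to 3, \<lambda> before
    \<mu>. The four equations attain their maxima 11, 10, 20, 11 in blocks 2, 0, 3, 2. This leaves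
    the variables 1, 4 and 2, 7 for the minors, whose two terms have weights 6 and 5.\<close>
  define w where "w j = (if j < 16 then [5,2,2,5, 4,0,0,4, 2,9,9,2, 0,10,10,0] ! j else (0::nat))" for j :: nat
  define V where "V = (\<lambda>i. [{4*2, 4*2+2}, {4*0, 4*0+3}, {4*3+1, 4*3+2}, {4*2+1, 4*2+3}, {1,4}, {2,7::nat}] ! i)"
  have l: "l = 0 \<or> l = 1 \<or> l = 2 \<or> l = 3 \<or> 4 \<le> l" for l :: nat by linarith
  have big: "w (4*l+r) = 0" "w (4*l) = 0" if "4 \<le> l" for l r using that by (auto simp: w_def)
  have "cr 1 0 = (\<lambda>z. z 4 * z 1 - z 5 * z 0)" by (simp add: cr_def fun_eq_iff)
  moreover have "leads (4*N) w (\<lambda>z. z 4 * z 1 - z 5 * z 0) (ind {1,4})"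
    using leads_minor[of 4 "4*N" 1 5 0 w] assms by (simp add: w_def insert_commute)
  ultimately have 1: "leads (4*N) w (cr 1 0) (ind {1,4})" by simp
  have 2: "leads (4*N) w minor_mu (ind {2,7})"
    unfolding minor_mu_def[abs_def] using assms by (intro leads_minor) (auto simp: w_def)
  have "coprime_leads (4*N) w {..<6} V (gext N (cr 1 0) minor_mu)"
  proof (rule gext_leads[OF _ _ _ _ _ _ _ _ 1 2 V_def])
    fix i i' :: nat assume "i < i'" "i' < 6"
    from index6[OF this] show "V i \<inter> V i' = {}" unfolding V_def by auto
  next
    fix l :: nat
    show "l \<noteq> 2 \<Longrightarrow> w (4*l) + w (4*l+2) < w (4*2) + w (4*2+2)"
      using l[of l] big[of l] by (elim disjE) (simp_all add: w_def)
    show "l \<noteq> 0 \<Longrightarrow> w (4*l) + w (4*l+3) < w (4*0) + w (4*0+3)"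
      using l[of l] big[of l] by (elim disjE) (simp_all add: w_def)
    show "l \<noteq> 3 \<Longrightarrow> w (4*l+1) + w (4*l+2) < w (4*3+1) + w (4*3+2)"
      using l[of l] big[of l] by (elim disjE) (simp_all add: w_def)
    show "l \<noteq> 2 \<Longrightarrow> w (4*l+1) + w (4*l+3) < w (4*2+1) + w (4*2+3)"
      using l[of l] big[of l] by (elim disjE) (simp_all add: w_def)
  qed (use assms in auto)
  then show ?thesis by blast
qed

text \<open>Three blocks carry the leading monomials of all four equations: \<open>i\<close> serves
  the equations 00 and 11, \<open>j\<close> serves 01 and \<open>k\<close> serves 10. Block
  \<open>l\<close> has weight zero and stays free for the two coordinates of a spinor, \<lambda> or
  \<mu> according to \<open>s\<close>; hence four different blocks.\<close>

lemma coords_coprime_leads: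
  assumes ijkl: "i < N" "j < N" "k < N" "l < N" "i \<noteq> j" "i \<noteq> k" "j \<noteq> k" "l \<noteq> i" "l \<noteq> j" "l \<noteq> k"
    and s: "s = 0 \<or> s = 2"
  shows "\<exists>w V. coprime_leads (4*N) w {..<6} V (gext N (\<lambda>z. z (4*l+s)) (\<lambda>z. z (4*l+(s+1))))"
proof -
  define w where "w n = (if n div 4 = i then 2 else if n div 4 = j then (if n mod 4 \<in> {0,3} then 3 else 0)
     else if n div 4 = k then (if n mod 4 \<in> {1,2} then 3 else 0) else (0::nat))" for n :: nat
  define V where "V = (\<lambda>t. [{4*i, 4*i+2}, {4*j, 4*j+3}, {4*k+1, 4*k+2}, {4*i+1, 4*i+3}, {4*l+s}, {4*l+(s+1)}] ! t)"
  have w0: "w (4*b+r) = (if b = i then 2 else if b = j then (if r \<in> {0,3} then 3 else 0)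
     else if b = k then (if r \<in> {1,2} then 3 else 0) else 0)" if "r < 4" for b r
    by (simp only: w_def block_divmod[OF that])
  have w: "w (4*b) = (if b = i then 2 else if b = j then 3 else 0)"
    "w (4*b+1) = (if b = i then 2 else if b = k then 3 else 0)"
    "w (4*b+2) = (if b = i then 2 else if b = k then 3 else 0)"
    "w (4*b+3) = (if b = i then 2 else if b = j then 3 else 0)" for b
    using w0[of 0 b] w0[of 1 b] w0[of 2 b] w0[of 3 b] ijkl(7) by (simp_all only: split: if_split) auto
  have lN: "4*l+s < 4*N" "4*l+(s+1) < 4*N" using ijkl(4) s by auto
  have "coprime_leads (4*N) w {..<6} V (gext N (\<lambda>z. z (4*l+s)) (\<lambda>z. z (4*l+(s+1))))"
  proof (rule gext_leads[OF _ _ _ _ _ _ _ _ leads_var[OF lN(1)] leads_var[OF lN(2)] V_def])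
    fix t t' :: nat assume "t < t'" "t' < 6"
    define bl where "bl b r = 4*b+r" for b r :: nat
    have bl: "bl a r = bl b r' \<longleftrightarrow> a = b \<and> r = r'" if "r < 4" "r' < 4" for a b r r'
      using block_divmod[OF that(1), of a] block_divmod[OF that(2), of b] unfolding bl_def by metis
    have V: "V = (\<lambda>t. [{bl i 0, bl i 2}, {bl j 0, bl j 3}, {bl k 1, bl k 2}, {bl i 1, bl i 3}, {bl l s}, {bl l (s+1)}] ! t)"
      unfolding V_def bl_def by simp
    from index6[OF \<open>t < t'\<close> \<open>t' < 6\<close>] s show "V t \<inter> V t' = {}"
      unfolding V by (elim insertE emptyE disjE) (simp_all add: bl ijkl(5-10) ijkl(5-10)[symmetric])
  qed (use ijkl lN w in auto)
  then show ?thesis by blast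
qed

subsection \<open>Vanishing ideal, irreducibility and regular pairs\<close>

text \<open>Elimination turns a power of \<open>cr 1 0\<close> times \<open>p\<close> into a
  function of the free coordinates, which must be zero. The minor is then cancelled modulo the
  equations.\<close>

lemma vanishing_ideal:
  assumes N: "4 \<le> N" and p: "p \<in> polyfun (4*N)" and van: "\<And>z. z \<in> Xhat N \<Longrightarrow> p z = 0"
  shows "p \<in> eqn_ideal N"
proof -
  have N2: "2 \<le> N" using N by simp
  have c: "cr 1 0 \<in> polyfun (4*N)" using N by (intro polyfun_cr) auto
  obtain k q where q: "q \<in> polyfun (4*N)" "mu_free q" "(\<lambda>z. cr 1 0 z ^ k * p z - q z) \<in> eqn_ideal N"
    using eliminate_mu[OF N2 p] by blast
  have "q z = 0" if "z \<in> Xhat N" for z using eqn_ideal_Xhat[OF q(3) that] van[OF that] by simp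
  from mu_free_zero[OF N2 q(1,2) this] have "q = (\<lambda>z. 0)" by auto
  with q(3) have "(\<lambda>z. cr 1 0 z ^ k * p z) \<in> eqn_ideal N" by simp
  then show ?thesis
  proof (induction k)
    case (Suc k)
    obtain w V where cl: "coprime_leads (4*N) w {..<6} V (gext N (cr 1 0) minor_mu)"
      using minors_coprime_leads[OF N] by blast
    have "(\<lambda>z. cr 1 0 z ^ k * p z) \<in> eqn_ideal N"
      by (rule eqn_ideal_mult_cancel[OF cl]) (use Suc.prems c p in \<open>auto simp: mult.assoc intro: polyfun_intros\<close>)
    then show ?case by (rule Suc.IH)
  qed simp
qed

text \<open>After elimination the assertion is the domain property for functions of the free
  coordinates; powers of \<open>cr 1 0\<close> are cancelled afterwards.\<close>

lemma Xhat_irreducible: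
  assumes N: "4 \<le> N" and p: "p \<in> polyfun (4*N)" "p' \<in> polyfun (4*N)"
    and z0: "z0 \<in> Xhat N" "p z0 \<noteq> 0" and pp': "\<And>z. z \<in> Xhat N \<Longrightarrow> p z * p' z = 0"
    and z: "z \<in> Xhat N"
  shows "p' z = 0"
proof -
  have N2: "2 \<le> N" using N by simp
  have c: "cr 1 0 \<in> polyfun (4*N)" using N by (intro polyfun_cr) auto
  have nz: "f z = 0" if "f \<in> polyfun (4*N)" "(\<lambda>z. cr 1 0 z ^ k * f z) \<in> eqn_ideal N" "z \<in> Xhat N" for f k z
    using that(2)
  proof (induction k)
    case 0
    then show ?case using eqn_ideal_Xhat[of f N z] that by simp
  next
    case (Suc k)
    obtain w V where cl: "coprime_leads (4*N) w {..<6} V (gext N (cr 1 0) minor_mu)"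
      using minors_coprime_leads[OF N] by blast
    have "(\<lambda>z. cr 1 0 z ^ k * f z) \<in> eqn_ideal N"
      by (rule eqn_ideal_mult_cancel[OF cl]) (use Suc.prems c that in \<open>auto simp: mult.assoc intro: polyfun_intros\<close>)
    then show ?case by (rule Suc.IH)
  qed
  obtain k q where q: "q \<in> polyfun (4*N)" "mu_free q" "(\<lambda>z. cr 1 0 z ^ k * p z - q z) \<in> eqn_ideal N"
    using eliminate_mu[OF N2 p(1)] by blast
  obtain k' q' where q': "q' \<in> polyfun (4*N)" "mu_free q'" "(\<lambda>z. cr 1 0 z ^ k' * p' z - q' z) \<in> eqn_ideal N"
    using eliminate_mu[OF N2 p(2)] by blast
  have qq: "q z * q' z = 0" for z
  proof (rule mu_free_zero[OF N2, of "\<lambda>z. q z * q' z"])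
    show "(\<lambda>z. q z * q' z) \<in> polyfun (4*N)" using q q' by (intro polyfun_intros)
    show "mu_free (\<lambda>z. q z * q' z)" using q(2) q'(2) unfolding mu_free_def by metis
    fix z assume z: "z \<in> Xhat N"
    have "q z = cr 1 0 z ^ k * p z" "q' z = cr 1 0 z ^ k' * p' z"
      using eqn_ideal_Xhat[OF q(3) z] eqn_ideal_Xhat[OF q'(3) z] by auto
    then have "q z * q' z = cr 1 0 z ^ k * cr 1 0 z ^ k' * (p z * p' z)" by simp
    then show "q z * q' z = 0" using pp'[OF z] by simp
  qed
  have "\<exists>z1. q z1 \<noteq> 0"
  proof (rule ccontr)
    assume "\<nexists>z1. q z1 \<noteq> 0"
    then have "q = (\<lambda>z. 0)" by auto
    with q(3) nz[OF p(1) _ z0(1)] z0(2) show False by simp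
  qed
  then obtain z1 where "q z1 \<noteq> 0" by blast
  with qq have "q' z = 0" for z using polyfun_cancel[OF q(1) q'(1)] by (metis mult_eq_0_iff)
  then have "q' = (\<lambda>z. 0)" by auto
  with q'(3) nz[OF p(2) _ z] show ?thesis by simp
qed

text \<open>The hypothesis says that the fractions \<open>F / f\<close> and \<open>F' / f'\<close>
  agree; the conclusion is that they are polynomial on \<open>Xhat N\<close>. In this form a pair
  cancels denominators directly.\<close>

definition regular_pair :: "nat \<Rightarrow> ((nat \<Rightarrow> complex) \<Rightarrow> complex) \<Rightarrow> ((nat \<Rightarrow> complex) \<Rightarrow> complex) \<Rightarrow> bool" where
  "regular_pair N f f' \<longleftrightarrow> (\<forall>F\<in>polyfun (4*N). \<forall>F'\<in>polyfun (4*N).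
     (\<forall>z\<in>Xhat N. f' z * F z = f z * F' z) \<longrightarrow> (\<exists>H\<in>polyfun (4*N). \<forall>z\<in>Xhat N. F z = f z * H z))"

text \<open>\<open>vanishing_ideal\<close> turns the identity on points into a relation with the
  four equations, and \<open>regular\<close> is applied to it at index 5.\<close>

lemma regular_pairI:
  assumes N: "4 \<le> N" and cl: "coprime_leads (4*N) w {..<6} V (gext N f f')"
  shows "regular_pair N f f'"
  unfolding regular_pair_def
proof (intro ballI impI)
  interpret coprime_leads "4*N" w "{..<6}" V "gext N f f'" by (rule cl)
  fix F F' assume F: "F \<in> polyfun (4*N)" "F' \<in> polyfun (4*N)" and eq: "\<forall>z\<in>Xhat N. f' z * F z = f z * F' z"
  have f: "f \<in> polyfun (4*N)" "f' \<in> polyfun (4*N)"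
    using leads_polyfun[OF lead[of 4]] leads_polyfun[OF lead[of 5]] by (auto simp: gext_def)
  have "(\<lambda>z. f' z * F z - f z * F' z) \<in> eqn_ideal N"
    by (rule vanishing_ideal[OF N]) (use f F eq in \<open>auto intro: polyfun_intros\<close>)
  then obtain H where H: "\<forall>i\<in>{..<4}. H i \<in> polyfun (4*N)"
      "(\<lambda>z. f' z * F z - f z * F' z) = (\<lambda>x. \<Sum>i<4. gJ N i x * H i x)"
    unfolding gideal_def by blast
  define G where "G i = (if i < 4 then (\<lambda>x. - H i x) else if i = 4 then (\<lambda>x. - F' x) else F)" for i :: nat
  have "G 5 \<in> gideal (4*N) ({..<6} - {5}) (gext N f f')"
  proof (rule regular)
    show "G i \<in> polyfun (4*N)" if "i \<in> {..<6}" for i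
      using H(1) F that by (auto simp: G_def intro: polyfun_uminus)
    fix x
    have "{..<6} = insert 5 (insert 4 {..<4::nat})" by auto
    then have "(\<Sum>i<6. gext N f f' i x * G i x) = f' x * F x - f x * F' x + (\<Sum>i<4. gext N f f' i x * G i x)"
      by (simp add: gext_def G_def)
    also have "(\<Sum>i<4. gext N f f' i x * G i x) = (\<Sum>i<4. - (gJ N i x * H i x))"
      by (intro sum.cong) (auto simp: gext_def G_def)
    finally show "(\<Sum>i<6. gext N f f' i x * G i x) = 0" using fun_cong[OF H(2), of x] by (simp add: sum_negf)
  qed simp
  then obtain K where K: "\<forall>i\<in>{..<6} - {5}. K i \<in> polyfun (4*N)" "F = (\<lambda>x. \<Sum>i\<in>{..<6} - {5}. gext N f f' i x * K i x)"
    unfolding gideal_def by (auto simp: G_def)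
  have "F z = f z * K 4 z" if z: "z \<in> Xhat N" for z
  proof -
    have "{..<6} - {5} = insert 4 {..<4::nat}" by auto
    then have "F z = f z * K 4 z + (\<Sum>i<4. gext N f f' i z * K i z)" unfolding K(2) by (simp add: gext_def)
    also have "(\<Sum>i<4. gext N f f' i z * K i z) = 0" by (intro sum.neutral) (auto simp: gext_def gJ_Xhat[OF z])
    finally show ?thesis by simp
  qed
  then show "\<exists>H\<in>polyfun (4*N). \<forall>z\<in>Xhat N. F z = f z * H z" using K(1) by auto
qed

lemma regular_pair_minors: "4 \<le> N \<Longrightarrow> regular_pair N (cr 1 0) minor_mu"
  using minors_coprime_leads regular_pairI by blast

lemma regular_pair_coords:
  assumes "4 \<le> N" "l < N" "s = 0 \<or> s = 2"
  shows "regular_pair N (\<lambda>z. z (4*l+s)) (\<lambda>z. z (4*l+(s+1)))"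
proof -
  \<comment> \<open>At least three of the blocks 0 to 3 differ from \<open>l\<close>, whether or not
    \<open>l\<close> is among them.\<close>
  have "card ({..<4} - {l}) \<ge> 3" using card_Diff_singleton_if[of "{..<4}" l] by auto
  then obtain S where S: "S \<subseteq> {..<4} - {l}" "card S = 3" by (meson obtain_subset_with_card_n)
  then obtain i j k where "S = {i,j,k}" "i \<noteq> j" "i \<noteq> k" "j \<noteq> k" by (auto simp: card_3_iff)
  with S(1) assms have "i < N" "j < N" "k < N" "l \<noteq> i" "l \<noteq> j" "l \<noteq> k" by auto
  with \<open>i \<noteq> j\<close> \<open>i \<noteq> k\<close> \<open>j \<noteq> k\<close> coords_coprime_leads[of i N j k l s] assms show ?thesis
    using regular_pairI by blast
qed

section \<open>Polynomials in one distinguished variable\<close>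

text \<open>Polynomials in \<open>d\<close> variables are viewed as polynomials in \<open>y j\<close> over the fraction field of the
  ring \<open>Co\<close> of polynomials in the other variables; \<open>kdvd\<close> is divisibility over that field.\<close>

locale one_var =
  fixes d j :: nat
  assumes jd: "j < d"
begin

definition Co :: "((nat \<Rightarrow> complex) \<Rightarrow> complex) set" where
  "Co = {c \<in> polyfun d. \<forall>y v. c (y(j := v)) = c y}"

definition Co0 :: "((nat \<Rightarrow> complex) \<Rightarrow> complex) set" where
  "Co0 = {c \<in> Co. \<exists>y. c y \<noteq> 0}"

text \<open>Degree in \<open>y j\<close> strictly below \<open>n\<close>. With the strict bound the
  zero function is the case \<open>n = 0\<close>.\<close>

definition dgl :: "nat \<Rightarrow> ((nat \<Rightarrow> complex) \<Rightarrow> complex) \<Rightarrow> bool" where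
  "dgl n f \<longleftrightarrow> (\<exists>c. (\<forall>i. c i \<in> Co) \<and> f = (\<lambda>y. \<Sum>i<n. c i y * y j ^ i))"

lemma Co_const: "(\<lambda>y. a) \<in> Co"
  unfolding Co_def by (auto intro: pf_const)

lemma Co_add: "a \<in> Co \<Longrightarrow> b \<in> Co \<Longrightarrow> (\<lambda>y. a y + b y) \<in> Co"
  unfolding Co_def by (auto intro: pf_add)

lemma Co_mult: "a \<in> Co \<Longrightarrow> b \<in> Co \<Longrightarrow> (\<lambda>y. a y * b y) \<in> Co"
  unfolding Co_def by (auto intro: pf_mult)

lemma Co_polyfun: "a \<in> Co \<Longrightarrow> a \<in> polyfun d"
  unfolding Co_def by auto

lemma Co0_mult: "a \<in> Co0 \<Longrightarrow> b \<in> Co0 \<Longrightarrow> (\<lambda>y. a y * b y) \<in> Co0"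
  unfolding Co0_def using polyfun_common_nonzero[of a d b] Co_polyfun Co_mult by fastforce

lemma Co0_Co: "a \<in> Co0 \<Longrightarrow> a \<in> Co"
  unfolding Co0_def by auto

lemma Co0_polyfun: "a \<in> Co0 \<Longrightarrow> a \<in> polyfun d"
  using Co0_Co Co_polyfun by blast

lemma Co0_one: "(\<lambda>y. 1) \<in> Co0"
  unfolding Co0_def using Co_const by auto

lemma dgl_polyfun: "dgl n f \<Longrightarrow> f \<in> polyfun d"
  unfolding dgl_def using jd Co_polyfun by (auto intro!: polyfun_intros)

lemma dgl_mono: "dgl n f \<Longrightarrow> n \<le> n' \<Longrightarrow> dgl n' f"
proof -
  assume "dgl n f" "n \<le> n'"
  then obtain c where c: "\<forall>i. c i \<in> Co" "f = (\<lambda>y. \<Sum>i<n. c i y * y j ^ i)" unfolding dgl_def by blast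
  have "f y = (\<Sum>i<n'. (if i < n then c i else (\<lambda>_. 0)) y * y j ^ i)" for y
    unfolding c(2) using \<open>n \<le> n'\<close> by (intro sum.mono_neutral_cong_left) auto
  then show ?thesis unfolding dgl_def
    using c(1) Co_const by (intro exI[of _ "\<lambda>i. if i < n then c i else (\<lambda>_. 0)"]) auto
qed

lemma dgl_add: "dgl n f \<Longrightarrow> dgl n g \<Longrightarrow> dgl n (\<lambda>y. f y + g y)"
proof -
  assume "dgl n f" "dgl n g"
  then obtain c b where c: "\<forall>i. c i \<in> Co" "f = (\<lambda>y. \<Sum>i<n. c i y * y j ^ i)"
    and b: "\<forall>i. b i \<in> Co" "g = (\<lambda>y. \<Sum>i<n. b i y * y j ^ i)" unfolding dgl_def by blast
  then show ?thesis unfolding dgl_def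
    by (intro exI[of _ "\<lambda>i y. c i y + b i y"]) (auto simp: Co_add distrib_right sum.distrib)
qed

lemma dgl_mult: "a \<in> Co \<Longrightarrow> dgl n f \<Longrightarrow> dgl n (\<lambda>y. a y * f y)"
proof -
  assume a: "a \<in> Co" and "dgl n f"
  then obtain c where c: "\<forall>i. c i \<in> Co" "f = (\<lambda>y. \<Sum>i<n. c i y * y j ^ i)" unfolding dgl_def by blast
  then show ?thesis unfolding dgl_def using a
    by (intro exI[of _ "\<lambda>i y. a y * c i y"]) (auto simp: Co_mult sum_distrib_left mult.assoc)
qed

lemma dgl_diff: "dgl n f \<Longrightarrow> dgl n g \<Longrightarrow> dgl n (\<lambda>y. f y - g y)"
  using dgl_add[OF _ dgl_mult[OF Co_const[of "-1"]], of n f g] by simp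

lemma dgl_0: "dgl 0 f \<longleftrightarrow> f = (\<lambda>y. 0)"
  unfolding dgl_def using Co_const by (auto intro: exI[of _ "\<lambda>_ y. 0"])

lemma dgl_1: "dgl (Suc 0) f \<longleftrightarrow> f \<in> Co"
proof
  assume "f \<in> Co"
  then show "dgl (Suc 0) f" unfolding dgl_def by (intro exI[of _ "\<lambda>_. f"]) auto
qed (auto simp: dgl_def)

lemma dgl_shift: "dgl n f \<Longrightarrow> dgl (Suc n) (\<lambda>y. y j * f y)"
proof -
  assume "dgl n f"
  then obtain c where c: "\<forall>i. c i \<in> Co" "f = (\<lambda>y. \<Sum>i<n. c i y * y j ^ i)" unfolding dgl_def by blast
  have "y j * f y = (\<Sum>i<Suc n. (case i of 0 \<Rightarrow> (\<lambda>_. 0) | Suc i \<Rightarrow> c i) y * y j ^ i)" for y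
    unfolding c(2) sum.lessThan_Suc_shift by (simp add: sum_distrib_left mult.left_commute)
  moreover have "(case i of 0 \<Rightarrow> (\<lambda>_. 0) | Suc i \<Rightarrow> c i) \<in> Co" for i using c(1) Co_const by (cases i) auto
  ultimately show ?thesis unfolding dgl_def
    by (intro exI[of _ "\<lambda>i. case i of 0 \<Rightarrow> (\<lambda>_. 0) | Suc i \<Rightarrow> c i"]) auto
qed

lemma dgl_shift_power: "dgl n f \<Longrightarrow> dgl (k + n) (\<lambda>y. y j ^ k * f y)"
proof (induction k)
  case (Suc k)
  then show ?case using dgl_shift[of "k+n" "\<lambda>y. y j ^ k * f y"] by (simp add: mult.assoc)
qed simp

lemma dgl_sum: "finite A \<Longrightarrow> (\<And>i. i \<in> A \<Longrightarrow> dgl n (f i)) \<Longrightarrow> dgl n (\<lambda>y. \<Sum>i\<in>A. f i y)"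
proof (induction A rule: finite_induct)
  case empty
  show ?case using dgl_mono[of 0 "\<lambda>y. 0" n] dgl_0 by simp
next
  case (insert a A)
  then show ?case using dgl_add[of n "f a" "\<lambda>y. \<Sum>i\<in>A. f i y"] by simp
qed

lemma polyfun_dgl: "f \<in> polyfun d \<Longrightarrow> \<exists>n. dgl n f"
proof (induction rule: polyfun.induct)
  case (pf_const c)
  show ?case using dgl_1 Co_const by blast
next
  case (pf_var i)
  show ?case
  proof (cases "i = j")
    case True
    have "dgl (Suc (Suc 0)) (\<lambda>y. y j * 1)" using dgl_shift dgl_1 Co_const by blast
    then show ?thesis using True by auto
  next
    case False
    then have "(\<lambda>x. x i) \<in> Co" using pf_var unfolding Co_def by (auto intro: polyfun.pf_var)
    then show ?thesis using dgl_1 by blast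
  qed
next
  case (pf_add p q)
  then obtain n n' where "dgl n p" "dgl n' q" by blast
  then have "dgl (max n n') p" "dgl (max n n') q" using dgl_mono by auto
  then show ?case using dgl_add by blast
next
  case (pf_mult p q)
  then obtain n n' where n: "dgl n p" "dgl n' q" by blast
  then obtain c where c: "\<forall>i. c i \<in> Co" "p = (\<lambda>y. \<Sum>i<n. c i y * y j ^ i)" unfolding dgl_def by blast
  have "dgl (n + n') (\<lambda>y. \<Sum>i<n. c i y * (y j ^ i * q y))"
  proof (rule dgl_sum)
    fix i assume "i \<in> {..<n}"
    then have "dgl (n + n') (\<lambda>y. y j ^ i * q y)"
      using dgl_mono[OF dgl_shift_power[OF n(2), of i]] by simp
    then show "dgl (n + n') (\<lambda>y. c i y * (y j ^ i * q y))" by (rule dgl_mult[OF c(1)[rule_format]])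
  qed simp
  then have "dgl (n + n') (\<lambda>y. p y * q y)" unfolding c(2) by (simp add: sum_distrib_right mult.assoc)
  then show ?case by blast
qed

text \<open>One more than the degree in \<open>y j\<close>, and 0 for the zero function.\<close>

definition sz :: "((nat \<Rightarrow> complex) \<Rightarrow> complex) \<Rightarrow> nat" where
  "sz f = (LEAST n. dgl n f)"

lemma dgl_sz: "f \<in> polyfun d \<Longrightarrow> dgl (sz f) f"
  unfolding sz_def by (rule LeastI_ex[OF polyfun_dgl])

lemma sz_le: "dgl n f \<Longrightarrow> sz f \<le> n"
  unfolding sz_def by (rule Least_le)

lemma lead_coeff_ex:
  assumes "w \<in> polyfun d" "w y0 \<noteq> 0"
  obtains k c where "sz w = Suc k" "\<forall>i. c i \<in> Co" "w = (\<lambda>y. \<Sum>i<Suc k. c i y * y j ^ i)" "c k \<in> Co0"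
proof -
  have "sz w \<noteq> 0"
  proof
    assume "sz w = 0"
    then have "w = (\<lambda>y. 0)" using dgl_sz[OF assms(1)] dgl_0 by simp
    then show False using assms(2) by simp
  qed
  then obtain k where k: "sz w = Suc k" by (cases "sz w") auto
  then obtain c where c: "\<forall>i. c i \<in> Co" "w = (\<lambda>y. \<Sum>i<Suc k. c i y * y j ^ i)"
    using dgl_sz[OF assms(1)] unfolding dgl_def by auto
  have "c k \<in> Co0"
  proof (rule ccontr)
    assume "c k \<notin> Co0"
    then have "c k y = 0" for y using c(1) unfolding Co0_def by auto
    then have "dgl k w" unfolding dgl_def using c by (intro exI[of _ c]) simp
    then show False using sz_le[of k w] k by simp
  qed
  with k c that show ?thesis by blast
qed

text \<open>Euclidean division after multiplication by a power of the leading coefficient. Of the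
  multiplier \<open>a\<close> only its nonvanishing where \<open>c k\<close> does not vanish is
  recorded; \<open>kprime_point\<close> uses exactly this pointwise form.\<close>

lemma pseudo_division:
  assumes c: "\<forall>i. c i \<in> Co" and w: "w = (\<lambda>y. \<Sum>i<Suc k. c i y * y j ^ i)" and f: "dgl n f"
  shows "\<exists>a q r. a \<in> Co \<and> (\<forall>y. c k y \<noteq> 0 \<longrightarrow> a y \<noteq> 0) \<and> q \<in> polyfun d \<and> dgl k r \<and>
    (\<forall>y. a y * f y = q y * w y + r y)"
  using f
proof (induction n arbitrary: f)
  case 0
  show ?case
    by (intro exI[of _ "\<lambda>_. 1"] exI[of _ "\<lambda>_. 0"] exI[of _ f])
      (use 0 dgl_mono in \<open>auto intro: Co_const pf_const\<close>)
next
  case (Suc n)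
  show ?case
  proof (cases "Suc n \<le> k")
    case True
    then show ?thesis
      by (intro exI[of _ "\<lambda>_. 1"] exI[of _ "\<lambda>_. 0"] exI[of _ f])
        (use Suc.prems dgl_mono in \<open>auto intro: Co_const pf_const\<close>)
  next
    case False
    then have kn: "k \<le> n" by simp
    from Suc.prems obtain b where b: "\<forall>i. b i \<in> Co" "f = (\<lambda>y. \<Sum>i<Suc n. b i y * y j ^ i)"
      unfolding dgl_def by blast
    have w': "dgl k (\<lambda>y. \<Sum>i<k. c i y * y j ^ i)" "dgl n (\<lambda>y. \<Sum>i<n. b i y * y j ^ i)"
      unfolding dgl_def using c b by blast+
    define f' where "f' y = c k y * f y - b n y * (y j ^ (n - k) * w y)" for y
    have "f' = (\<lambda>y. c k y * (\<Sum>i<n. b i y * y j ^ i) - b n y * (y j ^ (n - k) * (\<Sum>i<k. c i y * y j ^ i)))"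
    proof
      fix y :: "nat \<Rightarrow> complex"
      have "y j ^ n = y j ^ (n - k) * y j ^ k" using kn power_add[of "y j" "n - k" k] by simp
      then show "f' y = c k y * (\<Sum>i<n. b i y * y j ^ i) - b n y * (y j ^ (n - k) * (\<Sum>i<k. c i y * y j ^ i))"
        unfolding f'_def b(2) w sum.lessThan_Suc by (simp add: algebra_simps)
    qed
    moreover have "dgl n (\<lambda>y. y j ^ (n - k) * (\<Sum>i<k. c i y * y j ^ i))"
      using dgl_shift_power[OF w'(1), of "n - k"] kn by simp
    then have "dgl n (\<lambda>y. c k y * (\<Sum>i<n. b i y * y j ^ i) - b n y * (y j ^ (n - k) * (\<Sum>i<k. c i y * y j ^ i)))"
      by (rule dgl_diff[OF dgl_mult[OF c[rule_format] w'(2)] dgl_mult[OF b(1)[rule_format]]])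
    ultimately have "dgl n f'" by simp
    from Suc.IH[OF this] obtain a q r where aqr: "a \<in> Co" "\<forall>y. c k y \<noteq> 0 \<longrightarrow> a y \<noteq> 0"
      "q \<in> polyfun d" "dgl k r" "\<forall>y. a y * f' y = q y * w y + r y" by blast
    have "(\<lambda>y. q y + a y * b n y * y j ^ (n - k)) \<in> polyfun d"
      using aqr b jd Co_polyfun by (intro polyfun_intros) auto
    moreover have "(a y * c k y) * f y = (q y + a y * b n y * y j ^ (n - k)) * w y + r y" for y
      using aqr(5)[rule_format, of y] unfolding f'_def by (simp add: algebra_simps)
    ultimately show ?thesis
      using aqr c Co_mult by (intro exI[of _ "\<lambda>y. a y * c k y"] exI[of _ "\<lambda>y. q y + a y * b n y * y j ^ (n - k)"] exI[of _ r]) auto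
  qed
qed

text \<open>Degrees in \<open>y j\<close> add under multiplication, so a factor of a nonzero
  function of degree zero has degree zero. Slices with \<open>a y = 0\<close> are covered by
  density.\<close>

lemma Co0_factor:
  assumes p: "p \<in> polyfun d" "g \<in> polyfun d" and a: "a \<in> Co0" and pg: "\<And>y. p y * g y = a y"
  shows "p \<in> Co"
proof -
  obtain y0 where y0: "a y0 \<noteq> 0" using a unfolding Co0_def by auto
  have "p (y(j := v)) - p y = 0" for y v
  proof (rule polyfun_cancel[of a d "\<lambda>y. p (y(j := v)) - p y" y0 y, OF Co0_polyfun[OF a] _ y0])
    show "(\<lambda>y. p (y(j := v)) - p y) \<in> polyfun d"
    proof (intro polyfun_diff p polyfun_compose[OF p(1)])
      fix i assume "i < d"
      then show "(\<lambda>x. (x(j := v)) i) \<in> polyfun d" by (cases "i = j") (simp_all add: pf_const pf_var)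
    qed
    fix y assume y: "a y \<noteq> 0"
    obtain P G where P: "\<forall>v. p (y(j := v)) = poly P v" and G: "\<forall>v. g (y(j := v)) = poly G v"
      using polyfun_slice p by meson
    have "poly (P * G) v = poly [:a y:] v" for v
      using pg[of "y(j := v)"] a P G unfolding Co0_def Co_def by simp
    then have "P * G = [:a y:]" by (intro poly_ext)
    then have PG: "degree (P * G) = 0" "P \<noteq> 0" "G \<noteq> 0" using y by auto
    then have "degree P = 0" by (simp add: degree_mult_eq)
    then obtain b where b: "P = [:b:]" by (rule degree_eq_zeroE)
    then have "p (y(j := v)) = b" for v using P by simp
    from this[of v] this[of "y j"] show "p (y(j := v)) - p y = 0" by simp
  qed
  then show ?thesis using p unfolding Co_def by auto
qed

section \<open>Ideals, divisibility and primes over the fraction field\<close>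

definition pideal :: "((nat \<Rightarrow> complex) \<Rightarrow> complex) set \<Rightarrow> bool" where
  "pideal S \<longleftrightarrow> S \<subseteq> polyfun d \<and> (\<forall>f\<in>S. \<forall>g\<in>S. (\<lambda>y. f y + g y) \<in> S) \<and> (\<forall>p\<in>polyfun d. \<forall>f\<in>S. (\<lambda>y. p y * f y) \<in> S)"

definition kdvd :: "((nat \<Rightarrow> complex) \<Rightarrow> complex) \<Rightarrow> ((nat \<Rightarrow> complex) \<Rightarrow> complex) \<Rightarrow> bool" where
  "kdvd p q \<longleftrightarrow> (\<exists>a\<in>Co0. \<exists>r\<in>polyfun d. \<forall>y. a y * q y = p y * r y)"

lemma kdvdI: "a \<in> Co0 \<Longrightarrow> r \<in> polyfun d \<Longrightarrow> (\<And>y. a y * q y = p y * r y) \<Longrightarrow> kdvd p q"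
  unfolding kdvd_def by blast

lemma kdvd_trans: "kdvd p q \<Longrightarrow> kdvd q r \<Longrightarrow> kdvd p r"
proof -
  assume "kdvd p q" "kdvd q r"
  then obtain a s b t where *: "a \<in> Co0" "s \<in> polyfun d" "\<forall>y. a y * q y = p y * s y"
    "b \<in> Co0" "t \<in> polyfun d" "\<forall>y. b y * r y = q y * t y" unfolding kdvd_def by blast
  have "(a y * b y) * r y = p y * (s y * t y)" for y
  proof -
    have "(a y * b y) * r y = a y * (b y * r y)" by simp
    also have "\<dots> = (a y * q y) * t y" using * by simp
    also have "\<dots> = p y * (s y * t y)" using * by simp
    finally show ?thesis .
  qed
  then show ?thesis by (rule kdvdI[OF Co0_mult[OF *(1,4)] pf_mult[OF *(2,5)]])
qed

lemma kdvd_refl_mult: "q \<in> polyfun d \<Longrightarrow> kdvd p (\<lambda>y. p y * q y)"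
  by (rule kdvdI[OF Co0_one, of q]) simp_all

lemma kdvd_mult: "kdvd p q \<Longrightarrow> s \<in> polyfun d \<Longrightarrow> kdvd p (\<lambda>y. s y * q y)"
  using kdvd_trans[OF _ kdvd_refl_mult[of s q]] by (simp add: mult.commute)

text \<open>The pseudo-remainder of \<open>f\<close> lies in the ideal and is smaller than
  \<open>w\<close>, hence zero: ideals become principal over the fraction field.\<close>

lemma ideal_min:
  assumes S: "pideal S" and w: "w \<in> S" "w y0 \<noteq> 0" and min: "\<And>g y. g \<in> S \<Longrightarrow> g y \<noteq> 0 \<Longrightarrow> sz w \<le> sz g"
    and f: "f \<in> S"
  shows "kdvd w f"
proof -
  have P: "w \<in> polyfun d" "f \<in> polyfun d" using S w f unfolding pideal_def by auto
  obtain k c where k: "sz w = Suc k" and c: "\<forall>i. c i \<in> Co" "w = (\<lambda>y. \<Sum>i<Suc k. c i y * y j ^ i)" "c k \<in> Co0"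
    by (rule lead_coeff_ex[OF P(1) w(2)])
  obtain a q r where aqr: "a \<in> Co" "\<forall>y. c k y \<noteq> 0 \<longrightarrow> a y \<noteq> 0" "q \<in> polyfun d" "dgl k r"
    "\<forall>y. a y * f y = q y * w y + r y"
    using pseudo_division[OF c(1,2) dgl_sz[OF P(2)]] by blast
  have "r = (\<lambda>y. a y * f y + (- q y) * w y)" using aqr(5) by (auto simp: fun_eq_iff)
  also have "\<dots> \<in> S"
  proof -
    have mult: "(\<lambda>y. p y * g y) \<in> S" if "p \<in> polyfun d" "g \<in> S" for p g
      using S that unfolding pideal_def by simp
    have add: "(\<lambda>y. g y + g' y) \<in> S" if "g \<in> S" "g' \<in> S" for g g'
      using S that unfolding pideal_def by simp
    show ?thesis by (rule add[OF mult[OF Co_polyfun[OF aqr(1)] f] mult[OF polyfun_uminus[OF aqr(3)] w(1)]])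
  qed
  finally have "r \<in> S" .
  then have "r y = 0" for y using min[of r y] sz_le[OF aqr(4)] k by fastforce
  with aqr(5) have "\<forall>y. a y * f y = w y * q y" by (simp add: mult.commute)
  moreover have "a \<in> Co0" using aqr(1,2) c(3) unfolding Co0_def by auto
  ultimately show ?thesis using aqr(3) unfolding kdvd_def by blast
qed

text \<open>Primality in Bezout form: an element not divisible by \<open>p\<close> generates,
  together with \<open>p\<close>, the unit ideal over the fraction field. Excluding
  \<open>Co\<close> excludes zero and units.\<close>

definition kprime :: "((nat \<Rightarrow> complex) \<Rightarrow> complex) \<Rightarrow> bool" where
  "kprime p \<longleftrightarrow> p \<in> polyfun d \<and> p \<notin> Co \<and> (\<forall>q\<in>polyfun d. kdvd p q \<or>
     (\<exists>\<alpha>\<in>polyfun d. \<exists>\<beta>\<in>polyfun d. \<exists>c\<in>Co0. \<forall>y. \<alpha> y * p y + \<beta> y * q y = c y))"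

lemma nonzero_ex: "f \<notin> Co \<Longrightarrow> \<exists>y. f y \<noteq> 0"
proof (rule ccontr)
  assume "f \<notin> Co" "\<nexists>y. f y \<noteq> 0"
  moreover from this have "f = (\<lambda>y. 0)" by auto
  ultimately show False using Co_const by simp
qed

text \<open>A divisor \<open>p\<close> of \<open>F\<close> of least positive degree is prime: a
  generator of the ideal of \<open>p\<close> and \<open>q\<close> divides \<open>F\<close>, so
  either \<open>p\<close> itself is minimal in that ideal or the generator lies in
  \<open>Co\<close>.\<close>

lemma kprime_ex:
  assumes F: "F \<in> polyfun d" "F \<notin> Co"
  shows "\<exists>p. kprime p \<and> kdvd p F"
proof -
  let ?Q = "\<lambda>p. p \<in> polyfun d \<and> p \<notin> Co \<and> kdvd p F"
  have "?Q F" using F kdvd_refl_mult[of "\<lambda>_. 1" F] by (auto intro: pf_const)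
  then obtain p where p: "?Q p" and pmin: "\<And>q. ?Q q \<Longrightarrow> sz p \<le> sz q"
    using ex_has_least_nat[of ?Q F sz] by blast
  have "kdvd p q \<or> (\<exists>\<alpha>\<in>polyfun d. \<exists>\<beta>\<in>polyfun d. \<exists>c\<in>Co0. \<forall>y. \<alpha> y * p y + \<beta> y * q y = c y)"
    if q: "q \<in> polyfun d" for q
  proof -
    define S where "S = {f. \<exists>\<alpha>\<in>polyfun d. \<exists>\<beta>\<in>polyfun d. f = (\<lambda>y. \<alpha> y * p y + \<beta> y * q y)}"
    have SI: "(\<lambda>y. \<alpha> y * p y + \<beta> y * q y) \<in> S" if "\<alpha> \<in> polyfun d" "\<beta> \<in> polyfun d" for \<alpha> \<beta>
      using that unfolding S_def by blast
    have S: "pideal S"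
      unfolding pideal_def
    proof (intro conjI ballI subsetI)
      fix f assume "f \<in> S" then show "f \<in> polyfun d" using p q unfolding S_def by (auto intro!: polyfun_intros)
    next
      fix f g assume "f \<in> S" "g \<in> S"
      then obtain \<alpha> \<beta> \<alpha>' \<beta>' where *: "\<alpha> \<in> polyfun d" "\<beta> \<in> polyfun d" "f = (\<lambda>y. \<alpha> y * p y + \<beta> y * q y)"
        "\<alpha>' \<in> polyfun d" "\<beta>' \<in> polyfun d" "g = (\<lambda>y. \<alpha>' y * p y + \<beta>' y * q y)" unfolding S_def by blast
      from SI[OF pf_add[OF *(1,4)] pf_add[OF *(2,5)]] show "(\<lambda>y. f y + g y) \<in> S"
        unfolding *(3,6) by (simp add: algebra_simps)
    next
      fix g f assume g: "g \<in> polyfun d" and "f \<in> S"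
      then obtain \<alpha> \<beta> where *: "\<alpha> \<in> polyfun d" "\<beta> \<in> polyfun d" "f = (\<lambda>y. \<alpha> y * p y + \<beta> y * q y)"
        unfolding S_def by blast
      from SI[OF pf_mult[OF g *(1)] pf_mult[OF g *(2)]] show "(\<lambda>y. g y * f y) \<in> S"
        unfolding *(3) by (simp add: algebra_simps)
    qed
    have pS: "p \<in> S" "q \<in> S" using SI[OF pf_const[of 1] pf_const[of 0]] SI[OF pf_const[of 0] pf_const[of 1]] by auto
    obtain y0 where y0: "p y0 \<noteq> 0" using nonzero_ex p by blast
    obtain w where w: "w \<in> S \<and> (\<exists>y. w y \<noteq> 0)" and wmin: "\<And>g. g \<in> S \<and> (\<exists>y. g y \<noteq> 0) \<Longrightarrow> sz w \<le> sz g"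
      using ex_has_least_nat[of "\<lambda>g. g \<in> S \<and> (\<exists>y. g y \<noteq> 0)" p sz] pS y0 by blast
    then obtain y1 where y1: "w y1 \<noteq> 0" by blast
    show ?thesis
    proof (cases "sz p \<le> sz w")
      case True
      have "kdvd p q"
        by (rule ideal_min[OF S pS(1) y0 _ pS(2)]) (use wmin True order_trans in blast)
      then show ?thesis ..
    next
      case False
      have "kdvd w p"
        by (rule ideal_min[OF S conjunct1[OF w] y1 wmin pS(1)]) blast
      then have "kdvd w F" using p kdvd_trans by blast
      with False pmin[of w] w S have "w \<in> Co" unfolding pideal_def by auto
      with y1 have "w \<in> Co0" unfolding Co0_def by blast
      moreover obtain \<alpha> \<beta> where ab: "\<alpha> \<in> polyfun d" "\<beta> \<in> polyfun d" and weq: "w = (\<lambda>y. \<alpha> y * p y + \<beta> y * q y)"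
        using w unfolding S_def by blast
      moreover from weq have "\<forall>y. \<alpha> y * p y + \<beta> y * q y = w y" by simp
      ultimately show ?thesis by (intro disjI2 bexI[OF _ ab(1)] bexI[OF _ ab(2)] bexI[of _ w])
    qed
  qed
  then show ?thesis using p unfolding kprime_def by blast
qed

lemma kdvd_lincomb:
  assumes "kdvd p f" "kdvd p g" "s \<in> polyfun d" "t \<in> polyfun d"
  shows "kdvd p (\<lambda>y. s y * f y + t y * g y)"
proof -
  obtain a r b r' where *: "a \<in> Co0" "r \<in> polyfun d" "\<forall>y. a y * f y = p y * r y"
    "b \<in> Co0" "r' \<in> polyfun d" "\<forall>y. b y * g y = p y * r' y" using assms(1,2) unfolding kdvd_def by blast
  have "(a y * b y) * (s y * f y + t y * g y) = p y * (s y * b y * r y + t y * a y * r' y)" for y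
  proof -
    have "(a y * b y) * (s y * f y + t y * g y) = s y * b y * (a y * f y) + t y * a y * (b y * g y)"
      by (simp add: algebra_simps)
    also have "\<dots> = p y * (s y * b y * r y + t y * a y * r' y)" using * by (simp add: algebra_simps)
    finally show ?thesis .
  qed
  moreover have "(\<lambda>y. s y * b y * r y + t y * a y * r' y) \<in> polyfun d"
    using * assms Co0_polyfun by (intro polyfun_intros) auto
  ultimately show ?thesis by (intro kdvdI[OF Co0_mult[OF *(1,4)]])
qed

lemma kdvd_cancel: "kdvd p (\<lambda>y. c y * b y) \<Longrightarrow> c \<in> Co0 \<Longrightarrow> kdvd p b"
proof -
  assume "kdvd p (\<lambda>y. c y * b y)" and c: "c \<in> Co0"
  then obtain a r where *: "a \<in> Co0" "r \<in> polyfun d" "\<forall>y. a y * (c y * b y) = p y * r y"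
    unfolding kdvd_def by blast
  then have "(a y * c y) * b y = p y * r y" for y by (simp add: mult.assoc)
  then show ?thesis by (rule kdvdI[OF Co0_mult[OF *(1) c] *(2)])
qed

lemma kprime_mult:
  assumes p: "kprime p" and ab: "a \<in> polyfun d" "b \<in> polyfun d" and dv: "kdvd p (\<lambda>y. a y * b y)"
  shows "kdvd p a \<or> kdvd p b"
proof (rule disjCI)
  assume "\<not> kdvd p b"
  then obtain \<alpha> \<beta> c where *: "\<alpha> \<in> polyfun d" "\<beta> \<in> polyfun d" "c \<in> Co0" "\<forall>y. \<alpha> y * p y + \<beta> y * b y = c y"
    using p ab unfolding kprime_def by blast
  have "kdvd p (\<lambda>y. \<alpha> y * (p y * a y) + \<beta> y * (a y * b y))"
    by (intro kdvd_lincomb kdvd_refl_mult ab dv *)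
  also have "(\<lambda>y. \<alpha> y * (p y * a y) + \<beta> y * (a y * b y)) = (\<lambda>y. c y * a y)"
  proof
    fix y
    have "\<alpha> y * (p y * a y) + \<beta> y * (a y * b y) = (\<alpha> y * p y + \<beta> y * b y) * a y" by (simp add: algebra_simps)
    then show "\<alpha> y * (p y * a y) + \<beta> y * (a y * b y) = c y * a y" using *(4) by simp
  qed
  finally show "kdvd p a" using kdvd_cancel *(3) by blast
qed

lemma kprime_Co0:
  assumes p: "kprime p" and c: "c \<in> Co0"
  shows "\<not> kdvd p c"
proof
  assume "kdvd p c"
  then obtain a r where *: "a \<in> Co0" "r \<in> polyfun d" "\<forall>y. a y * c y = p y * r y" unfolding kdvd_def by blast
  have "p \<in> Co" by (rule Co0_factor[OF _ *(2) Co0_mult[OF *(1) c]]) (use p * in \<open>auto simp: kprime_def\<close>)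
  then show False using p unfolding kprime_def by blast
qed

lemma kprime_power:
  assumes p: "kprime p" and f: "f \<in> polyfun d" and dv: "kdvd p (\<lambda>y. f y ^ k)"
  shows "kdvd p f"
  using dv
proof (induction k)
  case 0
  then show ?case using kprime_Co0[OF p Co0_one] by simp
next
  case (Suc k)
  then show ?case using kprime_mult[OF p f polyfun_power[OF f, of k]] by auto
qed

text \<open>A Nullstellensatz in one variable. The other variables are specialised so that the
  leading coefficient of \<open>p\<close> and the Bezout constant stay nonzero; \<open>y j\<close>
  is then chosen as a root of the specialised \<open>p\<close>.\<close>

lemma kprime_point:
  assumes p: "kprime p" and q: "q \<in> polyfun d" "\<not> kdvd p q"
  shows "\<exists>y. q y \<noteq> 0 \<and> (\<forall>q'\<in>polyfun d. kdvd p q' \<longrightarrow> q' y = 0)"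
proof -
  have pP: "p \<in> polyfun d" "p \<notin> Co" using p unfolding kprime_def by auto
  obtain y0 where y0: "p y0 \<noteq> 0" using nonzero_ex pP by blast
  obtain k c where k: "sz p = Suc k" and c: "\<forall>i. c i \<in> Co" "p = (\<lambda>y. \<Sum>i<Suc k. c i y * y j ^ i)" "c k \<in> Co0"
    by (rule lead_coeff_ex[OF pP(1) y0])
  have k0: "k \<noteq> 0"
  proof
    assume "k = 0"
    then have "dgl (Suc 0) p" using dgl_sz[OF pP(1)] k by simp
    then show False using dgl_1 pP(2) by simp
  qed
  obtain \<alpha> \<beta> b where b: "\<alpha> \<in> polyfun d" "\<beta> \<in> polyfun d" "b \<in> Co0" "\<forall>y. \<alpha> y * p y + \<beta> y * q y = b y"
    using p q unfolding kprime_def by blast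
  define sl where "sl y = (\<Sum>i<Suc k. monom (c i y) i)" for y
  have slv: "poly (sl y) v = p (y(j := v))" for y v
    using c(1) unfolding sl_def c(2) Co_def by (simp add: poly_sum poly_monom)
  have "coeff (sl y) k = c k y" for y unfolding sl_def coeff_sum by (simp add: sum.delta)
  then have deg: "k \<le> degree (sl y)" if "c k y \<noteq> 0" for y using that le_degree by metis
  obtain y where y: "b y \<noteq> 0" "c k y \<noteq> 0"
    using polyfun_common_nonzero[of b d "c k"] b(3) c(3) Co0_polyfun unfolding Co0_def by blast
  have "0 < degree (sl y)" using deg[OF y(2)] k0 by simp
  then obtain v where v: "poly (sl y) v = 0"
    using alg_closed_imp_poly_has_root[of "sl y"] by auto
  let ?y = "y(j := v)"
  have py: "p ?y = 0" using slv v by simp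
  have by0: "b ?y \<noteq> 0" "c k ?y \<noteq> 0" using y b(3) c(3) unfolding Co0_def Co_def by auto
  have "q ?y \<noteq> 0" using b(4)[rule_format, of ?y] py by0 by auto
  \<comment> \<open>The point is fixed before \<open>q'\<close>, so the denominator \<open>e\<close>
    in the divisibility of \<open>q'\<close> may vanish there. Pseudo-division avoids this: its
    multiplier is nonzero at the point, and its remainder vanishes identically for reasons of
    degree.\<close>
  moreover have "q' ?y = 0" if q': "q' \<in> polyfun d" "kdvd p q'" for q'
  proof -
    obtain a g r where agr: "a \<in> Co" "\<forall>y. c k y \<noteq> 0 \<longrightarrow> a y \<noteq> 0" "g \<in> polyfun d" "dgl k r"
      "\<forall>y. a y * q' y = g y * p y + r y"
      using pseudo_division[OF c(1,2) dgl_sz[OF q'(1)]] by blast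
    obtain e s where es: "e \<in> Co0" "s \<in> polyfun d" "\<forall>y. e y * q' y = p y * s y"
      using q'(2) unfolding kdvd_def by blast
    have er: "e y * r y = p y * (s y * a y - e y * g y)" for y
    proof -
      have "e y * r y = e y * (a y * q' y - g y * p y)" using agr(5) by simp
      also have "\<dots> = a y * (e y * q' y) - e y * g y * p y" by (simp add: algebra_simps)
      also have "\<dots> = p y * (s y * a y - e y * g y)" using es(3) by (simp add: algebra_simps)
      finally show ?thesis .
    qed
    have tP: "(\<lambda>y. s y * a y - e y * g y) \<in> polyfun d"
      using es agr Co_polyfun Co0_polyfun by (intro polyfun_intros) auto
    obtain rc where rc: "\<forall>i. rc i \<in> Co" "r = (\<lambda>y. \<Sum>i<k. rc i y * y j ^ i)" using agr(4) unfolding dgl_def by blast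
    have "r y = 0" for y
    proof (rule ccontr)
      assume "r y \<noteq> 0"
      then obtain y1 where y1: "e y1 \<noteq> 0 \<and> r y1 \<noteq> 0"
        using polyfun_common_nonzero[of e d r] es(1) Co0_polyfun dgl_polyfun[OF agr(4)] unfolding Co0_def by blast
      then have "(\<lambda>y. e y * r y) y1 \<noteq> 0" by simp
      moreover have "(\<lambda>y. e y * r y) \<in> polyfun d"
        using es(1) Co0_polyfun dgl_polyfun[OF agr(4)] by (intro polyfun_intros) auto
      moreover obtain y' where "c k y' \<noteq> 0" using c(3) unfolding Co0_def by blast
      ultimately obtain y2 where y2: "e y2 * r y2 \<noteq> 0" "c k y2 \<noteq> 0"
        using polyfun_common_nonzero[of "\<lambda>y. e y * r y" d "c k" y1 y'] c(3) Co0_polyfun by blast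
      define R where "R = (\<Sum>i<k. monom (e y2 * rc i y2) i)"
      obtain T where T: "\<forall>v. s (y2(j := v)) * a (y2(j := v)) - e (y2(j := v)) * g (y2(j := v)) = poly T v"
        using polyfun_slice[OF tP] by meson
      have "poly R v = poly (sl y2 * T) v" for v
      proof -
        have "poly R v = e (y2(j := v)) * r (y2(j := v))"
          unfolding R_def rc(2) using rc(1) es(1) unfolding Co0_def Co_def
          by (simp add: poly_sum poly_monom sum_distrib_left mult.assoc)
        also have "\<dots> = poly (sl y2 * T) v" unfolding er poly_mult slv using T by simp
        finally show ?thesis .
      qed
      then have RT: "R = sl y2 * T" by (intro poly_ext)
      have "poly R (y2 j) = e y2 * r y2"
        unfolding R_def rc(2) by (simp add: poly_sum poly_monom sum_distrib_left mult.assoc)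
      with y2 have "R \<noteq> 0" by auto
      with RT have "degree R = degree (sl y2) + degree T" by (auto simp: degree_mult_eq)
      moreover have "degree R \<le> k - 1" unfolding R_def
        by (rule degree_sum_le) (auto intro!: order_trans[OF degree_monom_le])
      ultimately show False using deg[OF y2(2)] k0 by simp
    qed
    then have "a ?y * q' ?y = 0" using agr(5) py by simp
    then show ?thesis using agr(2) by0 by auto
  qed
  ultimately show ?thesis by blast
qed

end

text \<open>Otherwise \<open>p\<close> would divide a nonzero element of \<open>Co\<close>. This
  drives descent: removing a prime factor from \<open>g\<close> leaves an element that is no
  multiple of \<open>g\<close>.\<close>

lemma (in one_var) kprime_proper_quotient:
  assumes p: "kprime p" and a: "a \<in> Co0" and g: "g \<in> polyfun d" "g y0 \<noteq> 0" and r: "r \<in> polyfun d"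
    and eq: "\<And>y. a y * g y = p y * r y"
  shows "\<not> kdvd g r"
proof
  assume "kdvd g r"
  then obtain b s where b: "b \<in> Co0" "s \<in> polyfun d" "\<forall>y. b y * r y = g y * s y" unfolding kdvd_def by blast
  have pP: "p \<in> polyfun d" "p \<notin> Co" using p unfolding kprime_def by auto
  have "g y * (p y * s y - b y * a y) = 0" for y
  proof -
    have "b y * (a y * g y) = p y * (b y * r y)" unfolding eq by (simp add: mult_ac)
    then have "g y * (p y * s y) = g y * (b y * a y)" using b(3) by (auto simp: mult_ac)
    then show ?thesis by (simp add: right_diff_distrib)
  qed
  moreover have "(\<lambda>y. p y * s y - b y * a y) \<in> polyfun d"
    by (intro polyfun_intros pP b Co0_polyfun a)
  ultimately have "p y * s y - b y * a y = 0" for y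
    using polyfun_cancel[of g d "\<lambda>y. p y * s y - b y * a y" y0 y] g by auto
  then have "p y * s y = b y * a y" for y by simp
  from Co0_factor[OF pP(1) b(2) Co0_mult[OF b(1) a] this] pP(2) show False by simp
qed

section \<open>Rational functions that are polynomial in each variable\<close>

lemma finite_zero_slices:
  assumes "f \<in> polyfun m" "f y \<noteq> 0"
  shows "finite {c. \<forall>y. f (y(j := c)) = 0}"
proof -
  obtain P where P: "\<forall>v. f (y(j := v)) = poly P v" using polyfun_slice[OF assms(1)] by meson
  then have "poly P (y j) \<noteq> 0" using assms(2) by (metis fun_upd_triv)
  then have "P \<noteq> 0" by auto
  then have "finite {c. poly P c = 0}" by (rule poly_roots_finite)
  then show ?thesis by (rule rev_finite_subset) (use P in \<open>auto, metis\<close>)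
qed

lemma polyfun_fix_last:
  assumes "f \<in> polyfun (Suc d)"
  shows "(\<lambda>y. f (y(d := c))) \<in> polyfun d"
proof (rule polyfun_compose[OF assms])
  fix i assume "i < Suc d"
  then show "(\<lambda>x. (x(d := c)) i) \<in> polyfun d" by (cases "i = d") (simp_all add: pf_const pf_var)
qed

text \<open>Lagrange interpolation in the last variable, at constants where nothing degenerates,
  reduces the number of variables.\<close>

lemma separately_polynomial:
  assumes "F \<in> polyfun d" "B \<in> polyfun d" "F y0 \<noteq> 0"
    and "\<And>j. j < d \<Longrightarrow> \<exists>D\<in>polyfun d. \<exists>Q\<in>polyfun d. (\<forall>y v. D (y(j := v)) = D y) \<and> (\<exists>y. D y \<noteq> 0) \<and>
      (\<forall>y. D y * B y = F y * Q y)"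
  shows "\<exists>Q\<in>polyfun d. \<forall>y. B y = F y * Q y"
  using assms
proof (induction d arbitrary: F B y0)
  case 0
  have "B y = F y * (B y0 / F y0)" for y
    using polyfun_cong[OF 0(1), of y y0] polyfun_cong[OF 0(2), of y y0] 0(3) by simp
  then show ?case by (intro bexI[of _ "\<lambda>_. B y0 / F y0"] allI pf_const)
next
  case (Suc d)
  interpret one_var "Suc d" d by unfold_locales simp
  obtain n where "dgl n B" using polyfun_dgl[OF Suc.prems(2)] by blast
  then obtain b where b: "\<forall>i. b i \<in> Co" "B = (\<lambda>y. \<Sum>i<n. b i y * y d ^ i)" unfolding dgl_def by blast
  show ?case
  proof (cases "n = 0")
    case True
    then have "\<forall>y. B y = F y * 0" by (simp add: b(2))
    then show ?thesis by (intro bexI[of _ "\<lambda>_. 0"] pf_const)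
  next
    case False
    obtain D Q where DQ: "\<And>j. j < Suc d \<Longrightarrow> D j \<in> polyfun (Suc d) \<and> Q j \<in> polyfun (Suc d) \<and>
        (\<forall>y v. D j (y(j := v)) = D j y) \<and> (\<exists>y. D j y \<noteq> 0) \<and> (\<forall>y. D j y * B y = F y * Q j y)"
      using Suc.prems(4) by metis
    \<comment> \<open>The constants at which \<open>F\<close> or a denominator restricts to zero.
      They are finitely many, so \<open>n\<close> good ones exist.\<close>
    define bad where "bad = {c. \<forall>y. F (y(d := c)) = 0} \<union> (\<Union>j<d. {c. \<forall>y. D j (y(d := c)) = 0})"
    have "finite {c. \<forall>y. D j (y(d := c)) = 0}" if j: "j < d" for j
    proof -
      obtain y where "D j y \<noteq> 0" using DQ[of j] j by auto
      then show ?thesis using finite_zero_slices[of "D j" "Suc d" y d] DQ[of j] j by simp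
    qed
    then have "finite bad"
      unfolding bad_def using finite_zero_slices[OF Suc.prems(1,3), of d] by (simp del: fun_upd_apply)
    then have "infinite (- bad)" by (metis finite_compl infinite_UNIV_char_0)
    then obtain T where T: "finite T" "card T = n" "T \<subseteq> - bad"
      using infinite_arbitrarily_large by blast
    have "\<exists>R\<in>polyfun d. \<forall>y. B (y(d := c)) = F (y(d := c)) * R y" if c: "c \<in> T" for c
    proof -
      have good: "\<exists>y. F (y(d := c)) \<noteq> 0" "\<And>j. j < d \<Longrightarrow> \<exists>y. D j (y(d := c)) \<noteq> 0"
        using T c unfolding bad_def by auto
      then obtain y1 where y1: "F (y1(d := c)) \<noteq> 0" by blast
      show ?thesis
      proof (rule Suc.IH[of "\<lambda>y. F (y(d := c))" "\<lambda>y. B (y(d := c))" y1])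
        fix j assume j: "j < d"
        then have j': "j < Suc d" by simp
        show "\<exists>D\<in>polyfun d. \<exists>Q\<in>polyfun d. (\<forall>y v. D (y(j := v)) = D y) \<and> (\<exists>y. D y \<noteq> 0) \<and>
            (\<forall>y. D y * B (y(d := c)) = F (y(d := c)) * Q y)"
        proof (rule bexI[of _ "\<lambda>y. D j (y(d := c))"], rule bexI[of _ "\<lambda>y. Q j (y(d := c))"], intro conjI allI)
          fix y v
          have "D j ((y(j := v))(d := c)) = D j ((y(d := c))(j := v))"
            using j by (simp add: fun_upd_twist)
          then show "D j ((y(j := v))(d := c)) = D j (y(d := c))" using DQ[OF j'] by simp
        qed (use DQ[OF j'] good(2)[OF j] polyfun_fix_last in auto)
      qed (use y1 Suc.prems polyfun_fix_last in auto)
    qed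
    then obtain R where R: "\<And>c. c \<in> T \<Longrightarrow> R c \<in> polyfun d \<and> (\<forall>y. B (y(d := c)) = F (y(d := c)) * R c y)"
      by metis
    define G where "G y = (\<Sum>c\<in>T. R c y * (\<Prod>c'\<in>T - {c}. (y d - c') * (1 / (c - c'))))" for y
    have GP: "G \<in> polyfun (Suc d)"
      unfolding G_def[abs_def] using R polyfun_mono[of _ d "Suc d"] by (intro polyfun_intros) auto
    \<comment> \<open>\<open>E\<close> is the product of all that must be nonzero for the slice
      argument below; the identity extends from there by density.\<close>
    define E where "E y = D d y * ((\<Prod>c\<in>T. F (y(d := c))) * F y)" for y
    have Fc: "(\<lambda>y. F (y(d := c))) \<in> polyfun (Suc d)" for c
      by (rule polyfun_mono[OF polyfun_fix_last[OF Suc.prems(1)]]) simp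
    have prodP: "(\<lambda>y. \<Prod>c\<in>T. F (y(d := c))) \<in> polyfun (Suc d)" using Fc by (intro polyfun_prod)
    have EP: "E \<in> polyfun (Suc d)"
      unfolding E_def[abs_def] using DQ[of d] prodP Suc.prems(1) by (intro pf_mult) auto
    have "\<exists>y. \<forall>c\<in>T. F (y(d := c)) \<noteq> 0"
      using T by (intro polyfun_prod_common_nonzero[OF T(1) Fc]) (auto simp: bad_def)
    then obtain y1 where "\<forall>c\<in>T. F (y1(d := c)) \<noteq> 0" by blast
    then have "(\<Prod>c\<in>T. F (y1(d := c))) \<noteq> 0" using T(1) by simp
    then obtain y2 where y2: "(\<Prod>c\<in>T. F (y2(d := c))) * F y2 \<noteq> 0"
      using polyfun_common_nonzero[OF prodP Suc.prems(1), of y1 y0] Suc.prems(3) by auto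
    have "(\<lambda>y. (\<Prod>c\<in>T. F (y(d := c))) * F y) \<in> polyfun (Suc d)" using prodP Suc.prems(1) by (intro pf_mult)
    moreover obtain y3 where "D d y3 \<noteq> 0" using DQ[of d] by auto
    ultimately obtain y4 where "E y4 \<noteq> 0"
      using polyfun_common_nonzero[of "D d" "Suc d" _ y3 y2] DQ[of d] y2 unfolding E_def by fastforce
    have "B y - F y * G y = 0" for y
    proof (rule polyfun_cancel[OF EP _ \<open>E y4 \<noteq> 0\<close>, of "\<lambda>y. B y - F y * G y"])
      show "(\<lambda>y. B y - F y * G y) \<in> polyfun (Suc d)" using Suc.prems GP by (intro polyfun_intros)
      fix y assume "E y \<noteq> 0"
      then have y: "D d y \<noteq> 0" "\<And>c. c \<in> T \<Longrightarrow> F (y(d := c)) \<noteq> 0" "F y \<noteq> 0" using T(1) by (auto simp: E_def)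
      obtain Fs where Fs: "\<forall>v. F (y(d := v)) = poly Fs v" using polyfun_slice[OF Suc.prems(1)] by meson
      obtain Qs where Qs: "\<forall>v. Q d (y(d := v)) = poly Qs v" using polyfun_slice DQ[of d] by (metis lessI)
      define Bs where "Bs = (\<Sum>i<n. monom (b i y) i)"
      have Bs: "B (y(d := v)) = poly Bs v" for v
        unfolding Bs_def b(2) using b(1) unfolding Co_def by (simp add: poly_sum poly_monom)
      \<comment> \<open>\<open>T0\<close> is the quotient of the slices of \<open>B\<close> and
        \<open>F\<close>. Both it and the interpolant \<open>Lg\<close> have degree below
        \<open>n\<close>, so agreement at the \<open>n\<close> points of \<open>T\<close> forces
        equality.\<close>
      define T0 where "T0 = smult (1 / D d y) Qs"
      have BFT: "Bs = Fs * T0"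
      proof (rule poly_ext)
        fix v
        have *: "\<forall>y. D d y * B y = F y * Q d y" "\<forall>y v. D d (y(d := v)) = D d y"
          using DQ[of d] by blast+
        have "D d (y(d := v)) * B (y(d := v)) = F (y(d := v)) * Q d (y(d := v))" "D d (y(d := v)) = D d y"
          by (rule *(1)[rule_format], rule *(2)[rule_format])
        then show "poly Bs v = poly (Fs * T0) v"
          using y(1) Fs Qs Bs by (simp add: T0_def field_simps)
      qed
      have "degree Bs \<le> n - 1" unfolding Bs_def
        by (rule degree_sum_le) (auto intro!: order_trans[OF degree_monom_le])
      moreover have "Fs \<noteq> 0" using y(3) Fs by (metis fun_upd_triv poly_0)
      ultimately have dT: "degree T0 \<le> n - 1"
        using BFT by (cases "T0 = 0") (auto simp: degree_mult_eq)
      define Lg where "Lg = (\<Sum>c\<in>T. smult (R c y) (\<Prod>c'\<in>T - {c}. smult (1 / (c - c')) [:- c', 1:]))"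
      have Lgv: "poly Lg v = G (y(d := v))" for v
      proof -
        have Rc: "R c y = R c (y(d := v))" if "c \<in> T" for c
          by (rule polyfun_cong[OF conjunct1[OF R[OF that]]]) simp
        have "(\<Prod>c'\<in>T - {c}. 1 / (c - c') * poly [:- c', 1:] v) =
            (\<Prod>c'\<in>T - {c}. ((y(d := v)) d - c') * (1 / (c - c')))" for c
          by (rule prod.cong) simp_all
        then show ?thesis unfolding Lg_def G_def poly_sum poly_smult poly_prod
          by (intro sum.cong refl arg_cong2[where f="(*)"] Rc)
      qed
      have "degree Lg \<le> n - 1" unfolding Lg_def
      proof (rule degree_sum_le[OF T(1)])
        fix c assume c: "c \<in> T"
        have "degree (smult (R c y) (\<Prod>c'\<in>T - {c}. smult (1 / (c - c')) [:- c', 1:])) \<le>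
            degree (\<Prod>c'\<in>T - {c}. smult (1 / (c - c')) [:- c', 1:])" by (rule degree_smult_le)
        also have "\<dots> \<le> (\<Sum>c'\<in>T - {c}. degree (smult (1 / (c - c')) [:- c', 1:]))"
          using degree_prod_sum_le[of "T - {c}" "\<lambda>c'. smult (1 / (c - c')) [:- c', 1:]"] T(1) by (simp add: o_def)
        also have "\<dots> \<le> (\<Sum>c'\<in>T - {c}. 1)" by (intro sum_mono order_trans[OF degree_smult_le]) simp
        also have "\<dots> = n - 1" using T c by simp
        finally show "degree (smult (R c y) (\<Prod>c'\<in>T - {c}. smult (1 / (c - c')) [:- c', 1:])) \<le> n - 1" .
      qed
      moreover have "poly T0 c = poly Lg c" if c: "c \<in> T" for c
      proof -
        have "poly Fs c \<noteq> 0" using y(2)[OF c] Fs by simp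
        moreover have "poly Fs c * poly T0 c = poly Fs c * R c y"
          using R[OF c] Fs Bs[of c] BFT by (metis poly_mult)
        ultimately have "poly T0 c = R c y" by simp
        also have "R c y = poly Lg c"
        proof -
          have "poly (\<Prod>c'\<in>T - {c1}. smult (1 / (c1 - c')) [:- c', 1:]) c = (if c1 = c then 1 else 0)" if "c1 \<in> T" for c1
          proof (cases "c1 = c")
            case True
            have "poly (\<Prod>c'\<in>T - {c}. smult (1 / (c - c')) [:- c', 1:]) c = (\<Prod>c'\<in>T - {c}. 1)"
              unfolding poly_prod by (intro prod.cong) (auto simp: field_simps)
            then show ?thesis using True by simp
          next
            case False
            have "poly (\<Prod>c'\<in>T - {c1}. smult (1 / (c1 - c')) [:- c', 1:]) c = 0"
              unfolding poly_prod using T(1) c False by (intro prod_zero) auto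
            then show ?thesis using False by simp
          qed
          then have "poly Lg c = (\<Sum>c1\<in>T. if c1 = c then R c y else 0)"
            unfolding Lg_def poly_sum poly_smult by (intro sum.cong) auto
          then show ?thesis using T(1) c by simp
        qed
        finally show ?thesis .
      qed
      ultimately have "T0 = Lg" using dT T(2) False by (intro poly_eqI_degree[of T]) auto
      then have "poly Bs (y d) = poly Fs (y d) * poly Lg (y d)" using BFT by simp
      then show "B y - F y * G y = 0" using Bs[of "y d"] Fs[rule_format, of "y d"] Lgv[of "y d"] by simp
    qed
    then show ?thesis using GP by auto
  qed
qed

section \<open>Extension across codimension two in a chart\<close>

lemma irreducible_closed_prime:
  assumes Z: "irreducible_closed N Z" and p: "p \<in> polyfun (4*N)" "q \<in> polyfun (4*N)"
    and pq: "\<And>x. x \<in> Z \<Longrightarrow> p x * q x = 0"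
  shows "(\<forall>x\<in>Z. p x = 0) \<or> (\<forall>x\<in>Z. q x = 0)"
proof -
  have ZX: "Z \<subseteq> Xvar N" using Z unfolding irreducible_closed_def zariski_closed_def by auto
  have cl: "zariski_closed N {x \<in> Xvar N. f x = 0}" if "f \<in> polyfun (4*N)" for f
    unfolding zariski_closed_def using that by (intro exI[of _ "{f}"]) auto
  have "Z \<subseteq> {x \<in> Xvar N. p x = 0} \<union> {x \<in> Xvar N. q x = 0}" using ZX pq by auto
  then have "Z \<subseteq> {x \<in> Xvar N. p x = 0} \<or> Z \<subseteq> {x \<in> Xvar N. q x = 0}"
    using Z cl[OF p(1)] cl[OF p(2)] unfolding irreducible_closed_def by blast
  then show ?thesis by blast
qed

lemma zariski_closed_subset: "zariski_closed N Z \<Longrightarrow> Z \<subseteq> Xvar N"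
  unfolding zariski_closed_def by auto

lemma zariski_closed_separate:
  assumes "zariski_closed N Z" "x \<in> Xvar N" "x \<notin> Z"
  shows "\<exists>p\<in>polyfun (4*N). (\<forall>z\<in>Z. p z = 0) \<and> p x \<noteq> 0"
  using assms unfolding zariski_closed_def by blast

text \<open>A chart is a polynomial map whose image contains the dense open set \<open>h \<noteq> 0\<close> of \<open>Xvar N\<close>; the
  inverse \<open>u / h\<close> is regular there.\<close>

locale chart =
  fixes N d :: nat and \<Phi> :: "(nat \<Rightarrow> complex) \<Rightarrow> nat \<Rightarrow> complex"
    and h :: "(nat \<Rightarrow> complex) \<Rightarrow> complex" and u :: "nat \<Rightarrow> (nat \<Rightarrow> complex) \<Rightarrow> complex"
  assumes Phi_poly: "j < 4*N \<Longrightarrow> (\<lambda>y. \<Phi> y j) \<in> polyfun d"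
    and Phi_X: "\<Phi> y \<in> Xvar N"
    and h_poly: "h \<in> polyfun (4*N)"
    and u_poly: "j < d \<Longrightarrow> u j \<in> polyfun (4*N)"
    and u_Phi: "j < d \<Longrightarrow> u j (\<Phi> y) = y j * h (\<Phi> y)"
    and onto: "x \<in> Xvar N \<Longrightarrow> h x \<noteq> 0 \<Longrightarrow> \<exists>y. x = \<Phi> y"
    and h_nonzero: "\<exists>x\<in>Xvar N. h x \<noteq> 0"
    and X_irr: "irreducible_closed N (Xvar N)"
begin

lemma pull: "p \<in> polyfun (4*N) \<Longrightarrow> (\<lambda>y. p (\<Phi> y)) \<in> polyfun d"
  using polyfun_compose[of p "4*N" \<Phi> d] Phi_poly by blast

text \<open>The variables are replaced by \<open>u j / h\<close> and the denominators
  cleared.\<close>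

lemma lift: "g \<in> polyfun d \<Longrightarrow> \<exists>k. \<exists>b\<in>polyfun (4*N). \<forall>y. b (\<Phi> y) = h (\<Phi> y) ^ k * g y"
proof (induction rule: polyfun.induct)
  case (pf_const c)
  show ?case by (intro exI[of _ 0] bexI[of _ "\<lambda>_. c"]) (auto intro: polyfun.pf_const)
next
  case (pf_var j)
  then show ?case using u_poly u_Phi by (intro exI[of _ 1] bexI[of _ "u j"]) auto
next
  case (pf_add p q)
  then obtain k b k' b' where *: "b \<in> polyfun (4*N)" "\<forall>y. b (\<Phi> y) = h (\<Phi> y) ^ k * p y"
    "b' \<in> polyfun (4*N)" "\<forall>y. b' (\<Phi> y) = h (\<Phi> y) ^ k' * q y" by blast
  have "(\<lambda>x. h x ^ k' * b x + h x ^ k * b' x) \<in> polyfun (4*N)" using * h_poly by (intro polyfun_intros)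
  then show ?case using *
    by (intro exI[of _ "k+k'"] bexI[of _ "\<lambda>x. h x ^ k' * b x + h x ^ k * b' x"]) (auto simp: power_add algebra_simps)
next
  case (pf_mult p q)
  then obtain k b k' b' where *: "b \<in> polyfun (4*N)" "\<forall>y. b (\<Phi> y) = h (\<Phi> y) ^ k * p y"
    "b' \<in> polyfun (4*N)" "\<forall>y. b' (\<Phi> y) = h (\<Phi> y) ^ k' * q y" by blast
  have "(\<lambda>x. b x * b' x) \<in> polyfun (4*N)" using * by (intro polyfun_intros)
  then show ?case using *
    by (intro exI[of _ "k+k'"] bexI[of _ "\<lambda>x. b x * b' x"]) (auto simp: power_add algebra_simps)
qed

text \<open>The chart reaches every point with \<open>h\<close> nonzero, and these are dense by
  irreducibility.\<close>

lemma X_zero: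
  assumes "p \<in> polyfun (4*N)" "\<And>y. h (\<Phi> y) \<noteq> 0 \<Longrightarrow> p (\<Phi> y) = 0" "x \<in> Xvar N"
  shows "p x = 0"
proof -
  have "h x * p x = 0" if "x \<in> Xvar N" for x using assms(2) onto[OF that] by auto
  from irreducible_closed_prime[OF X_irr h_poly assms(1) this] h_nonzero assms(3) show ?thesis by blast
qed

text \<open>A hypersurface \<open>p = 0\<close> of the chart is the generic part of an irreducible closed set of
  codimension one, hence it is not contained in \<open>Y\<close>.\<close>

lemma hypersurface_not_in_codim2:
  assumes j: "j < d" and p: "one_var.kprime d j p" and ph: "\<not> one_var.kdvd d j p (\<lambda>y. h (\<Phi> y))"
    and Y: "zariski_closed N Y" "codim_ge2 N Y"
  shows "\<exists>f\<in>polyfun (4*N). (\<forall>x\<in>Y. f x = 0) \<and> \<not> one_var.kdvd d j p (\<lambda>y. f (\<Phi> y))"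
proof (rule ccontr)
  assume contra: "\<not> ?thesis"
  interpret one_var d j by unfold_locales (rule j)
  have pP: "p \<in> polyfun d" "p \<notin> Co" using p unfolding kprime_def by auto
  \<comment> \<open>\<open>P\<close> consists of the functions whose pullback is divisible by
    \<open>p\<close>; \<open>Z\<close> is the closure of the image of the hypersurface.\<close>
  define P where "P = {q \<in> polyfun (4*N). kdvd p (\<lambda>y. q (\<Phi> y))}"
  define Z where "Z = {x \<in> Xvar N. \<forall>q\<in>P. q x = 0}"
  have Zcl: "zariski_closed N Z" unfolding zariski_closed_def Z_def P_def by (intro exI[of _ P]) (auto simp: P_def)
  \<comment> \<open>\<open>P\<close> is the full vanishing ideal of \<open>Z\<close>: for
    \<open>q\<close> outside \<open>P\<close>, \<open>kprime_point\<close> yields a point whose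
    image lies in \<open>Z\<close> and at which the pullback of \<open>q\<close> is nonzero.\<close>
  have IZ: "q \<in> P" if q: "q \<in> polyfun (4*N)" "\<forall>z\<in>Z. q z = 0" for q
  proof (rule ccontr)
    assume "q \<notin> P"
    then have "\<not> kdvd p (\<lambda>y. q (\<Phi> y))" using q by (simp add: P_def)
    from kprime_point[OF p pull[OF q(1)] this] obtain y where
      y: "q (\<Phi> y) \<noteq> 0" "\<forall>q'\<in>polyfun d. kdvd p q' \<longrightarrow> q' y = 0" by blast
    have "\<Phi> y \<in> Z" unfolding Z_def P_def using Phi_X y(2) pull by fastforce
    with q y show False by blast
  qed
  have ZY: "Z \<subseteq> Y"
  proof -
    obtain S where S: "S \<subseteq> polyfun (4*N)" "Y = {x \<in> Xvar N. \<forall>p\<in>S. p x = 0}"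
      using Y(1) unfolding zariski_closed_def by blast
    have "S \<subseteq> P" using contra S unfolding P_def by auto
    then show ?thesis unfolding S(2) Z_def by auto
  qed
  have hP: "h \<notin> P" using ph by (simp add: P_def)
  have Zirr: "irreducible_closed N Z"
    unfolding irreducible_closed_def
  proof (intro conjI allI impI Zcl)
    show "Z \<noteq> {}"
      using IZ[of "\<lambda>_. 1"] kprime_Co0[OF p Co0_one] by (auto simp: P_def intro: pf_const)
    fix A B assume A: "zariski_closed N A" and B: "zariski_closed N B" and sub: "Z \<subseteq> A \<union> B"
    show "Z \<subseteq> A \<or> Z \<subseteq> B"
    proof (rule ccontr)
      assume "\<not> ?thesis"
      then obtain x x' where x: "x \<in> Z" "x \<notin> A" "x' \<in> Z" "x' \<notin> B" by blast
      then have xX: "x \<in> Xvar N" "x' \<in> Xvar N" unfolding Z_def by auto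
      obtain a where a: "a \<in> polyfun (4*N)" "\<forall>z\<in>A. a z = 0" "a x \<noteq> 0"
        using zariski_closed_separate[OF A xX(1) x(2)] by blast
      obtain b where b: "b \<in> polyfun (4*N)" "\<forall>z\<in>B. b z = 0" "b x' \<noteq> 0"
        using zariski_closed_separate[OF B xX(2) x(4)] by blast
      have "(\<lambda>z. a z * b z) \<in> P" by (rule IZ) (use a b sub in \<open>auto intro: pf_mult\<close>)
      then have "kdvd p (\<lambda>y. a (\<Phi> y) * b (\<Phi> y))" by (simp add: P_def)
      from kprime_mult[OF p pull[OF a(1)] pull[OF b(1)] this] a b have "a \<in> P \<or> b \<in> P" by (simp add: P_def)
      with x a b show False unfolding Z_def by blast
    qed
  qed
  have "\<exists>Z1 Z2. irreducible_closed N Z1 \<and> irreducible_closed N Z2 \<and> Z \<subset> Z1 \<and> Z1 \<subset> Z2"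
    using Y(2)[unfolded codim_ge2_def, rule_format, of Z] Zirr ZY by simp
  then obtain Z1 Z2 where Z1: "irreducible_closed N Z1" and Z2: "irreducible_closed N Z2"
    and strict: "Z \<subset> Z1" "Z1 \<subset> Z2" by (elim exE conjE)
  have cl: "zariski_closed N Z1" "zariski_closed N Z2" using Z1 Z2 unfolding irreducible_closed_def by auto
  have ZX: "Z1 \<subseteq> Xvar N" "Z2 \<subseteq> Xvar N" using cl zariski_closed_subset by auto
  obtain x2 where x2: "x2 \<in> Z2" "x2 \<notin> Z1" using strict by blast
  then have "x2 \<in> Xvar N" using ZX by blast
  from zariski_closed_separate[OF cl(1) this x2(2)] obtain q1 where
    q1: "q1 \<in> polyfun (4*N)" "\<forall>z\<in>Z1. q1 z = 0" "q1 x2 \<noteq> 0" by blast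
  have vanP: "q \<in> P" if "q \<in> polyfun (4*N)" "\<forall>z\<in>Z1. q z = 0" for q using IZ that strict by blast
  have hZ1: "\<not> (\<forall>x\<in>Z1. h x = 0)" using vanP[OF h_poly] hP by blast
  \<comment> \<open>The ideal of the part of \<open>Z1\<close> seen by the chart where
    \<open>h\<close> is nonzero. It is prime, and nonzero because \<open>Z1\<close> lies strictly
    inside \<open>Z2\<close>.\<close>
  define Q where "Q = {g \<in> polyfun d. \<forall>y. \<Phi> y \<in> Z1 \<longrightarrow> h (\<Phi> y) \<noteq> 0 \<longrightarrow> g y = 0}"
  have QZ1: "\<forall>x\<in>Z1. q x = 0" if q: "q \<in> polyfun (4*N)" "(\<lambda>y. q (\<Phi> y)) \<in> Q" for q
  proof -
    have "h x * q x = 0" if "x \<in> Z1" for x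
      using onto[of x] q(2) that ZX unfolding Q_def by auto
    from irreducible_closed_prime[OF Z1 h_poly q(1) this] hZ1 show ?thesis by blast
  qed
  have Qprime: "g \<in> Q \<or> g' \<in> Q" if g: "g \<in> polyfun d" "g' \<in> polyfun d" "(\<lambda>y. g y * g' y) \<in> Q" for g g'
  proof -
    obtain k b where b: "b \<in> polyfun (4*N)" "\<forall>y. b (\<Phi> y) = h (\<Phi> y) ^ k * g y" using lift[OF g(1)] by blast
    obtain k' b' where b': "b' \<in> polyfun (4*N)" "\<forall>y. b' (\<Phi> y) = h (\<Phi> y) ^ k' * g' y" using lift[OF g(2)] by blast
    have hb': "(\<lambda>x. h x * b' x) \<in> polyfun (4*N)" using h_poly b' by (intro pf_mult)
    have "b x * (h x * b' x) = 0" if "x \<in> Z1" for x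
    proof (cases "h x = 0")
      case False
      then obtain y where y: "x = \<Phi> y" using onto ZX \<open>x \<in> Z1\<close> by blast
      then have "g y * g' y = 0" using g(3) that False unfolding Q_def by auto
      then show ?thesis unfolding y using b b' by auto
    qed simp
    from irreducible_closed_prime[OF Z1 b(1) hb' this]
    have "(\<forall>x\<in>Z1. b x = 0) \<or> (\<forall>x\<in>Z1. h x * b' x = 0)" by blast
    then have "(\<forall>x\<in>Z1. b x = 0) \<or> (\<forall>x\<in>Z1. b' x = 0)"
      using irreducible_closed_prime[OF Z1 h_poly b'(1)] hZ1 by blast
    then show ?thesis using b b' g unfolding Q_def by auto
  qed
  have Qid: "pideal Q" unfolding pideal_def Q_def by (auto intro: pf_add pf_mult)
  have q1Q: "(\<lambda>y. q1 (\<Phi> y)) \<in> Q" using q1 pull unfolding Q_def by auto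
  have "\<exists>y. q1 (\<Phi> y) \<noteq> 0"
    using X_zero[OF q1(1)] q1(3) \<open>x2 \<in> Xvar N\<close> by blast
  with q1Q obtain g where g: "g \<in> Q \<and> (\<exists>y. g y \<noteq> 0)" and gmin: "\<And>g'. g' \<in> Q \<and> (\<exists>y. g' y \<noteq> 0) \<Longrightarrow> sz g \<le> sz g'"
    using ex_has_least_nat[of "\<lambda>g. g \<in> Q \<and> (\<exists>y. g y \<noteq> 0)" "\<lambda>y. q1 (\<Phi> y)" sz] by blast
  have gP: "g \<in> polyfun d" using g unfolding Q_def by auto
  obtain y0 where y0: "g y0 \<noteq> 0" using g by blast
  have Qdvd: "kdvd p g'" if g': "g' \<in> Q" for g'
  proof -
    have g'P: "g' \<in> polyfun d" using g' unfolding Q_def by auto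
    obtain k b where b: "b \<in> polyfun (4*N)" "\<forall>y. b (\<Phi> y) = h (\<Phi> y) ^ k * g' y" using lift[OF g'P] by blast
    have "(\<lambda>y. b (\<Phi> y)) \<in> Q" using pull[OF b(1)] b(2) g' unfolding Q_def by auto
    then have "b \<in> P" using QZ1[OF b(1)] vanP[OF b(1)] by blast
    then have "kdvd p (\<lambda>y. h (\<Phi> y) ^ k * g' y)" using b(2) by (simp add: P_def)
    from kprime_mult[OF p polyfun_power[OF pull[OF h_poly]] g'P this]
    show ?thesis using kprime_power[OF p pull[OF h_poly]] ph by blast
  qed
  obtain a r where ar: "a \<in> Co0" "r \<in> polyfun d" "\<forall>y. a y * g y = p y * r y"
    using Qdvd[of g] g unfolding kdvd_def by blast
  have "(\<lambda>y. a y * g y) \<in> Q" using g Co0_polyfun[OF ar(1)] gP unfolding Q_def by (auto intro: pf_mult)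
  then have "(\<lambda>y. p y * r y) \<in> Q" using ar(3) by simp
  \<comment> \<open>The element \<open>g\<close> of least degree in \<open>Q\<close> is, up to a
    denominator, \<open>p\<close> times \<open>r\<close>. Having \<open>r\<close> in
    \<open>Q\<close> would contradict minimality, so \<open>p\<close> lies in \<open>Q\<close>,
    which forces \<open>Z1\<close> into \<open>Z\<close>.\<close>
  then have "p \<in> Q \<or> r \<in> Q" by (rule Qprime[OF pP(1) ar(2)])
  moreover have "r \<notin> Q"
  proof
    assume r: "r \<in> Q"
    have "kdvd g r" by (rule ideal_min[OF Qid conjunct1[OF g] y0 _ r]) (use gmin in blast)
    with kprime_proper_quotient[OF p ar(1) gP y0 ar(2)] ar(3) show False by blast
  qed
  ultimately have pQ: "p \<in> Q" by blast
  have "Z1 \<subseteq> Z"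
  proof -
    have "\<forall>x\<in>Z1. q x = 0" if q: "q \<in> P" for q
    proof -
      have qP: "q \<in> polyfun (4*N)" using q by (simp add: P_def)
      obtain a r where ar: "a \<in> Co0" "r \<in> polyfun d" "\<forall>y. a y * q (\<Phi> y) = p y * r y"
        using q unfolding P_def kdvd_def by blast
      have "(\<lambda>y. a y * q (\<Phi> y)) \<in> Q"
        unfolding ar(3)[rule_format] using pQ ar(2) pP unfolding Q_def by (auto intro: pf_mult)
      from Qprime[OF Co0_polyfun[OF ar(1)] pull[OF qP] this] show ?thesis
        using Qdvd[of a] kprime_Co0[OF p ar(1)] QZ1[OF qP] by blast
    qed
    then show ?thesis using ZX unfolding Z_def by blast
  qed
  with strict show False by blast
qed

text \<open>The functions that clear the denominator of \<open>B / F\<close>, up to powers of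
  \<open>h\<close>, form an ideal; let \<open>g\<close> generate it over the fraction field. A prime
  factor of \<open>g\<close> dividing \<open>h\<close> could be traded for one more power of
  \<open>h\<close>. Any other one would divide every function vanishing on \<open>Y\<close>, which
  the preceding lemma excludes. So \<open>g\<close> is free of \<open>y j\<close>.\<close>

lemma conductor:
  assumes j: "j < d" and Y: "zariski_closed N Y" "codim_ge2 N Y"
    and F: "F \<in> polyfun d" "F y0 \<noteq> 0" and B: "B \<in> polyfun d"
    and ext: "\<And>f. f \<in> polyfun (4*N) \<Longrightarrow> (\<forall>x\<in>Y. f x = 0) \<Longrightarrow>
      \<exists>k. \<exists>q\<in>polyfun d. \<forall>y. f (\<Phi> y) ^ k * B y = F y * q y"
  shows "\<exists>e. one_var.kdvd d j F (\<lambda>y. h (\<Phi> y) ^ e * B y)"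
proof -
  interpret one_var d j by unfold_locales (rule j)
  have hP: "(\<lambda>y. h (\<Phi> y)) \<in> polyfun d" by (rule pull[OF h_poly])
  define C where "C = {g \<in> polyfun d. \<exists>e. kdvd F (\<lambda>y. h (\<Phi> y) ^ e * (g y * B y))}"
  have Cid: "pideal C"
    unfolding pideal_def
  proof (intro conjI ballI)
    show "C \<subseteq> polyfun d" by (auto simp: C_def)
    fix f g assume "f \<in> C" "g \<in> C"
    then obtain e e' where fg: "f \<in> polyfun d" "g \<in> polyfun d" "kdvd F (\<lambda>y. h (\<Phi> y) ^ e * (f y * B y))"
      "kdvd F (\<lambda>y. h (\<Phi> y) ^ e' * (g y * B y))" by (auto simp: C_def)
    from kdvd_lincomb[OF fg(3,4) polyfun_power[OF hP, of e'] polyfun_power[OF hP, of e]]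
    have "kdvd F (\<lambda>y. h (\<Phi> y) ^ (e + e') * ((f y + g y) * B y))" by (simp add: power_add algebra_simps)
    then show "(\<lambda>y. f y + g y) \<in> C" using fg unfolding C_def by (auto intro: pf_add)
  next
    fix s f assume s: "s \<in> polyfun d" and "f \<in> C"
    then obtain e where f: "f \<in> polyfun d" "kdvd F (\<lambda>y. h (\<Phi> y) ^ e * (f y * B y))" by (auto simp: C_def)
    from kdvd_mult[OF f(2) s] have "kdvd F (\<lambda>y. h (\<Phi> y) ^ e * ((s y * f y) * B y))" by (simp add: mult_ac)
    then show "(\<lambda>y. s y * f y) \<in> C" using f s unfolding C_def by (auto intro: pf_mult)
  qed
  have "kdvd F (\<lambda>y. h (\<Phi> y) ^ 0 * (F y * B y))" using kdvd_refl_mult[OF B, of F] by simp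
  then have "F \<in> C" using F unfolding C_def by blast
  with F obtain g where g: "g \<in> C \<and> (\<exists>y. g y \<noteq> 0)" and gmin: "\<And>g'. g' \<in> C \<and> (\<exists>y. g' y \<noteq> 0) \<Longrightarrow> sz g \<le> sz g'"
    using ex_has_least_nat[of "\<lambda>g. g \<in> C \<and> (\<exists>y. g y \<noteq> 0)" F sz] by blast
  then obtain e y1 where e: "g \<in> polyfun d" "kdvd F (\<lambda>y. h (\<Phi> y) ^ e * (g y * B y))" "g y1 \<noteq> 0" by (auto simp: C_def)
  have min: "kdvd g f" if "f \<in> C" for f
    by (rule ideal_min[OF Cid conjunct1[OF g] e(3) _ that]) (use gmin in blast)
  have "g \<in> Co"
  proof (rule ccontr)
    assume "g \<notin> Co"
    then obtain p where p: "kprime p" "kdvd p g" using kprime_ex[OF e(1)] by blast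
    show False
    proof (cases "kdvd p (\<lambda>y. h (\<Phi> y))")
      case True
      then obtain b s where bs: "b \<in> Co0" "s \<in> polyfun d" "\<forall>y. b y * h (\<Phi> y) = p y * s y" unfolding kdvd_def by blast
      obtain a r where ar: "a \<in> Co0" "r \<in> polyfun d" "\<forall>y. a y * g y = p y * r y" using p(2) unfolding kdvd_def by blast
      have saP: "(\<lambda>y. s y * a y) \<in> polyfun d" using bs ar Co0_polyfun by (intro pf_mult) auto
      have "kdvd F (\<lambda>y. (s y * a y) * (h (\<Phi> y) ^ e * (g y * B y)))" by (rule kdvd_mult[OF e(2) saP])
      also have "(\<lambda>y. (s y * a y) * (h (\<Phi> y) ^ e * (g y * B y))) = (\<lambda>y. b y * (h (\<Phi> y) ^ Suc e * (r y * B y)))"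
      proof
        fix y
        have "(s y * a y) * (h (\<Phi> y) ^ e * (g y * B y)) = h (\<Phi> y) ^ e * s y * B y * (a y * g y)" by (simp add: mult_ac)
        also have "\<dots> = h (\<Phi> y) ^ e * r y * B y * (p y * s y)" unfolding ar(3)[rule_format] by (simp add: mult_ac)
        also have "\<dots> = b y * (h (\<Phi> y) ^ Suc e * (r y * B y))" unfolding bs(3)[rule_format, symmetric] by (simp add: mult_ac)
        finally show "(s y * a y) * (h (\<Phi> y) ^ e * (g y * B y)) = b y * (h (\<Phi> y) ^ Suc e * (r y * B y))" .
      qed
      finally have "kdvd F (\<lambda>y. h (\<Phi> y) ^ Suc e * (r y * B y))" by (rule kdvd_cancel[OF _ bs(1)])
      then have "r \<in> C" using ar(2) unfolding C_def by blast
      from min[OF this] kprime_proper_quotient[OF p(1) ar(1) e(1) e(3) ar(2)] ar(3) show False by blast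
    next
      case False
      obtain f where f: "f \<in> polyfun (4*N)" "\<forall>x\<in>Y. f x = 0" "\<not> kdvd p (\<lambda>y. f (\<Phi> y))"
        using hypersurface_not_in_codim2[OF j p(1) False Y] by blast
      obtain k q where k: "q \<in> polyfun d" "\<forall>y. f (\<Phi> y) ^ k * B y = F y * q y" using ext[OF f(1,2)] by blast
      have "kdvd F (\<lambda>y. h (\<Phi> y) ^ 0 * (f (\<Phi> y) ^ k * B y))"
        using kdvd_refl_mult[OF k(1), of F] k(2) by simp
      then have "(\<lambda>y. f (\<Phi> y) ^ k) \<in> C" using polyfun_power[OF pull[OF f(1)]] unfolding C_def by blast
      from kdvd_trans[OF p(2) min[OF this]] kprime_power[OF p(1) pull[OF f(1)]] f(3) show False by blast
    qed
  qed
  then have "g \<in> Co0" using e(3) unfolding Co0_def by blast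
  moreover have "kdvd F (\<lambda>y. g y * (h (\<Phi> y) ^ e * B y))" using e(2) by (simp add: mult_ac)
  ultimately have "kdvd F (\<lambda>y. h (\<Phi> y) ^ e * B y)" by (rule kdvd_cancel[rotated])
  then show ?thesis by blast
qed

text \<open>The hypothesis says that \<open>m0 / f0\<close> is regular away from \<open>Y\<close>.
  \<open>conductor\<close> controls the denominator for one variable at a time, and
  \<open>separately_polynomial\<close> combines the variables.\<close>

lemma hartogs:
  assumes Y: "zariski_closed N Y" "codim_ge2 N Y"
    and f0: "f0 \<in> polyfun (4*N)" "x0 \<in> Xvar N" "f0 x0 \<noteq> 0" and m0: "m0 \<in> polyfun (4*N)"
    and ext: "\<And>f. f \<in> polyfun (4*N) \<Longrightarrow> (\<forall>x\<in>Y. f x = 0) \<Longrightarrow>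
      \<exists>k. \<exists>p\<in>polyfun (4*N). \<forall>x\<in>Xvar N. f x ^ k * m0 x = f0 x * p x"
  shows "\<exists>k. \<exists>p\<in>polyfun (4*N). \<forall>x\<in>Xvar N. h x ^ k * m0 x = f0 x * p x"
proof -
  let ?F = "\<lambda>y. f0 (\<Phi> y)" and ?B = "\<lambda>y. m0 (\<Phi> y)"
  have FP: "?F \<in> polyfun d" and BP: "?B \<in> polyfun d" using pull f0 m0 by auto
  obtain y0 where y0: "?F y0 \<noteq> 0" using X_zero[OF f0(1) _ f0(2)] f0(3) by blast
  have ext': "\<exists>k. \<exists>q\<in>polyfun d. \<forall>y. f (\<Phi> y) ^ k * ?B y = ?F y * q y"
    if f: "f \<in> polyfun (4*N)" "\<forall>x\<in>Y. f x = 0" for f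
  proof -
    obtain k p where "p \<in> polyfun (4*N)" "\<forall>x\<in>Xvar N. f x ^ k * m0 x = f0 x * p x" using ext[OF f] by blast
    then show ?thesis using pull Phi_X by (intro exI[of _ k] bexI[of _ "\<lambda>y. p (\<Phi> y)"]) auto
  qed
  have "\<forall>j<d. \<exists>e. one_var.kdvd d j ?F (\<lambda>y. h (\<Phi> y) ^ e * ?B y)"
    using conductor[OF _ Y FP y0 BP ext'] by blast
  then obtain e where e: "\<And>j. j < d \<Longrightarrow> one_var.kdvd d j ?F (\<lambda>y. h (\<Phi> y) ^ e j * ?B y)" by metis
  define K where "K = (\<Sum>j<d. e j)"
  have hP: "(\<lambda>y. h (\<Phi> y)) \<in> polyfun d" by (rule pull[OF h_poly])
  have "\<exists>Q\<in>polyfun d. \<forall>y. h (\<Phi> y) ^ K * ?B y = ?F y * Q y"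
  proof (rule separately_polynomial[OF FP _ y0])
    show "(\<lambda>y. h (\<Phi> y) ^ K * m0 (\<Phi> y)) \<in> polyfun d" using hP BP by (intro polyfun_intros)
    fix j assume j: "j < d"
    interpret one_var d j by unfold_locales (rule j)
    have le: "e j \<le> K" unfolding K_def using j by (intro member_le_sum) auto
    obtain a r where ar: "a \<in> Co0" "r \<in> polyfun d" "\<forall>y. a y * (h (\<Phi> y) ^ e j * ?B y) = ?F y * r y"
      using e[OF j] unfolding kdvd_def by blast
    have rP: "(\<lambda>y. h (\<Phi> y) ^ (K - e j) * r y) \<in> polyfun d" using hP ar(2) by (intro polyfun_intros)
    have "a y * (h (\<Phi> y) ^ K * ?B y) = ?F y * (h (\<Phi> y) ^ (K - e j) * r y)" for y
    proof -
      have "h (\<Phi> y) ^ K = h (\<Phi> y) ^ (K - e j) * h (\<Phi> y) ^ e j" using le by (simp add: power_add[symmetric])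
      then have "a y * (h (\<Phi> y) ^ K * ?B y) = h (\<Phi> y) ^ (K - e j) * (a y * (h (\<Phi> y) ^ e j * ?B y))" by (simp add: mult_ac)
      then show ?thesis unfolding ar(3)[rule_format] by (simp add: mult_ac)
    qed
    then show "\<exists>D\<in>polyfun d. \<exists>Q\<in>polyfun d. (\<forall>y v. D (y(j := v)) = D y) \<and> (\<exists>y. D y \<noteq> 0) \<and>
        (\<forall>y. D y * (h (\<Phi> y) ^ K * m0 (\<Phi> y)) = f0 (\<Phi> y) * Q y)"
      using ar(1) rP Co0_polyfun[OF ar(1)] unfolding Co0_def Co_def
      by (intro bexI[OF _ rP] bexI[of _ a]) auto
  qed
  then obtain Q where Q: "Q \<in> polyfun d" "\<forall>y. h (\<Phi> y) ^ K * ?B y = ?F y * Q y" by blast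
  obtain k b where b: "b \<in> polyfun (4*N)" "\<forall>y. b (\<Phi> y) = h (\<Phi> y) ^ k * Q y" using lift[OF Q(1)] by blast
  have "h x ^ (k + K) * m0 x - f0 x * b x = 0" if x: "x \<in> Xvar N" for x
  proof (rule X_zero[OF _ _ x, of "\<lambda>x. h x ^ (k + K) * m0 x - f0 x * b x"])
    show "(\<lambda>x. h x ^ (k + K) * m0 x - f0 x * b x) \<in> polyfun (4*N)" using h_poly m0 f0 b by (intro polyfun_intros)
    fix y
    have "h (\<Phi> y) ^ (k + K) * ?B y = h (\<Phi> y) ^ k * (h (\<Phi> y) ^ K * ?B y)" by (simp add: power_add)
    then show "h (\<Phi> y) ^ (k + K) * ?B y - ?F y * b (\<Phi> y) = 0"
      unfolding Q(2)[rule_format] b(2)[rule_format] by simp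
  qed
  then show ?thesis using b(1) by (intro exI[of _ "k + K"] bexI[of _ b]) auto
qed

end

section \<open>The torus quotient \<open>Xhat N \<rightarrow> Xvar N\<close>\<close>

text \<open>The flag \<open>\<tau>\<close> distinguishes \<open>k\<^sub>l = \<lambda>\<^sub>l \<mu>\<^sub>l\<^sup>T\<close> from \<open>k\<^sub>l = \<mu>\<^sub>l \<lambda>\<^sub>l\<^sup>T\<close>;
  \<open>cidx \<tau> l \<alpha> \<beta>\<close> is the coordinate of \<open>k\<^sub>l\<close> that equals \<open>\<lambda>\<^sub>l\<^sub>\<alpha> \<mu>\<^sub>l\<^sub>\<beta>\<close>.\<close>

definition cidx :: "bool \<Rightarrow> nat \<Rightarrow> nat \<Rightarrow> nat \<Rightarrow> nat" where
  "cidx \<tau> l \<alpha> \<beta> = 4*l + (if \<tau> then 2*\<alpha>+\<beta> else \<alpha>+2*\<beta>)"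

definition proj :: "bool \<Rightarrow> nat \<Rightarrow> (nat \<Rightarrow> complex) \<Rightarrow> nat \<Rightarrow> complex" where
  "proj \<tau> N z j = (if j < 4*N then
      (if \<tau> then z (4*(j div 4) + (j mod 4) div 2) * z (4*(j div 4) + (2 + (j mod 4) mod 2))
       else z (4*(j div 4) + (j mod 4) mod 2) * z (4*(j div 4) + (2 + (j mod 4) div 2)))
    else 0)"

lemma cidx_less: "l < N \<Longrightarrow> \<alpha> < 2 \<Longrightarrow> \<beta> < 2 \<Longrightarrow> cidx \<tau> l \<alpha> \<beta> < 4*N"
  unfolding cidx_def by auto

lemma cidx_cases:
  assumes "j < 4*N"
  obtains l \<alpha> \<beta> where "l < N" "\<alpha> < 2" "\<beta> < 2" "j = cidx \<tau> l \<alpha> \<beta>"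
proof (cases \<tau>)
  case True
  have "j = cidx \<tau> (j div 4) ((j mod 4) div 2) ((j mod 4) mod 2)" using True unfolding cidx_def by simp
  moreover have "j div 4 < N" "(j mod 4) div 2 < 2" "(j mod 4) mod 2 < 2" using assms by (auto simp: less_mult_imp_div_less mult.commute)
  ultimately show ?thesis using that by blast
next
  case False
  have "j = cidx \<tau> (j div 4) ((j mod 4) mod 2) ((j mod 4) div 2)" using False unfolding cidx_def by simp
  moreover have "j div 4 < N" "(j mod 4) div 2 < 2" "(j mod 4) mod 2 < 2" using assms by (auto simp: less_mult_imp_div_less mult.commute)
  ultimately show ?thesis using that by blast
qed

lemma proj_cidx:
  assumes "l < N" "\<alpha> < 2" "\<beta> < 2"
  shows "proj \<tau> N z (cidx \<tau> l \<alpha> \<beta>) = z (4*l+\<alpha>) * z (4*l+(2+\<beta>))"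
proof -
  let ?r = "if \<tau> then 2*\<alpha>+\<beta> else \<alpha>+2*\<beta>"
  have r: "?r < 4" using assms by auto
  have d: "cidx \<tau> l \<alpha> \<beta> div 4 = l" "cidx \<tau> l \<alpha> \<beta> mod 4 = ?r"
    unfolding cidx_def by (rule block_divmod[OF r])+
  have "(2*\<alpha>+\<beta>) div 2 = \<alpha>" "(2*\<alpha>+\<beta>) mod 2 = \<beta>" "(\<alpha>+2*\<beta>) div 2 = \<beta>" "(\<alpha>+2*\<beta>) mod 2 = \<alpha>"
    using assms by auto
  then show ?thesis using cidx_less[OF assms, of \<tau>] unfolding proj_def d by simp
qed

lemma proj_ge: "4*N \<le> j \<Longrightarrow> proj \<tau> N z j = 0"
  unfolding proj_def by simp

lemma all_less_2: "(\<forall>\<alpha><2. P \<alpha>) \<longleftrightarrow> P 0 \<and> P (1::nat)"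
  by (auto simp: less_2_cases_iff)

lemma Xvar_cidx: "x \<in> Xvar N \<longleftrightarrow> (\<forall>j\<ge>4*N. x j = 0) \<and>
   (\<forall>l<N. x (cidx \<tau> l 0 0) * x (cidx \<tau> l 1 1) = x (cidx \<tau> l 0 1) * x (cidx \<tau> l 1 0)) \<and>
   (\<forall>\<alpha><2. \<forall>\<beta><2. (\<Sum>l<N. x (cidx \<tau> l \<alpha> \<beta>)) = 0)"
  unfolding all_less_2 Xvar_def cidx_def by (cases \<tau>) (auto simp: mult.commute numeral_3_eq_3)

lemma proj_Xvar:
  assumes "z \<in> Xhat N"
  shows "proj \<tau> N z \<in> Xvar N"
  unfolding Xvar_cidx[of _ N \<tau>]
proof (intro conjI allI impI)
  fix \<alpha> \<beta> :: nat assume ab: "\<alpha> < 2" "\<beta> < 2"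
  have "(\<Sum>l<N. proj \<tau> N z (cidx \<tau> l \<alpha> \<beta>)) = eqn N \<alpha> \<beta> z"
    unfolding eqn_def by (intro sum.cong refl proj_cidx ab) simp
  with assms ab show "(\<Sum>l<N. proj \<tau> N z (cidx \<tau> l \<alpha> \<beta>)) = 0" unfolding Xhat_def by simp
qed (simp_all add: proj_ge proj_cidx)

lemma rank_one:
  fixes a b c d :: complex
  assumes "a * d = b * c"
  shows "\<exists>p q r s. a = p * r \<and> b = p * s \<and> c = q * r \<and> d = q * s"
proof (cases "a = 0")
  case False
  then show ?thesis using assms
    by (intro exI[of _ 1] exI[of _ "c / a"] exI[of _ a] exI[of _ b]) (simp add: field_simps)
next
  case a: True
  show ?thesis
  proof (cases "b = 0")
    case True
    then show ?thesis using a by (intro exI[of _ 0] exI[of _ 1] exI[of _ c] exI[of _ d]) simp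
  next
    case False
    then have "c = 0" using assms a by simp
    then show ?thesis using a False by (intro exI[of _ 1] exI[of _ "d / b"] exI[of _ 0] exI[of _ b]) simp
  qed
qed

text \<open>Each block has determinant zero and is a column times a row, also when it is the zero
  matrix. Hence identities on X may be checked on \<open>Xhat N\<close>.\<close>

lemma proj_onto:
  assumes x: "x \<in> Xvar N"
  shows "\<exists>z\<in>Xhat N. x = proj \<tau> N z"
proof -
  have "\<exists>v. l < N \<longrightarrow> x (cidx \<tau> l 0 0) = v 0 * v 2 \<and> x (cidx \<tau> l 0 1) = v 0 * v 3 \<and>
     x (cidx \<tau> l 1 0) = v 1 * v 2 \<and> x (cidx \<tau> l 1 1) = v 1 * v (3::nat)" for l
  proof (cases "l < N")
    case True
    with x have "x (cidx \<tau> l 0 0) * x (cidx \<tau> l 1 1) = x (cidx \<tau> l 0 1) * x (cidx \<tau> l 1 0)"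
      unfolding Xvar_cidx[of _ N \<tau>] by blast
    from rank_one[OF this] obtain p q r s where "x (cidx \<tau> l 0 0) = p * r" "x (cidx \<tau> l 0 1) = p * s"
      "x (cidx \<tau> l 1 0) = q * r" "x (cidx \<tau> l 1 1) = q * s" by blast
    then show ?thesis by (intro exI[of _ "(!) [p, q, r, s]"]) (simp add: numeral_eq_Suc)
  qed simp
  then have "\<forall>l. \<exists>v. l < N \<longrightarrow> x (cidx \<tau> l 0 0) = v 0 * v 2 \<and> x (cidx \<tau> l 0 1) = v 0 * v 3 \<and>
     x (cidx \<tau> l 1 0) = v 1 * v 2 \<and> x (cidx \<tau> l 1 1) = v 1 * v (3::nat)" by blast
  from choice[OF this] obtain v where v: "\<And>l. l < N \<Longrightarrow> x (cidx \<tau> l 0 0) = v l 0 * v l 2 \<and>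
     x (cidx \<tau> l 0 1) = v l 0 * v l 3 \<and> x (cidx \<tau> l 1 0) = v l 1 * v l 2 \<and> x (cidx \<tau> l 1 1) = v l 1 * v l (3::nat)"
    by blast
  define z where "z j = v (j div 4) (j mod 4)" for j
  have z: "z (4*l+r) = v l r" if "r < 4" for l r
    unfolding z_def block_divmod[OF that] ..
  have xz: "x (cidx \<tau> l \<alpha> \<beta>) = z (4*l+\<alpha>) * z (4*l+(2+\<beta>))" if "l < N" "\<alpha> < 2" "\<beta> < 2" for l \<alpha> \<beta>
  proof -
    have p: "x (cidx \<tau> l 0 0) = z (4*l+0) * z (4*l+(2+0))" "x (cidx \<tau> l 0 1) = z (4*l+0) * z (4*l+(2+1))"
      "x (cidx \<tau> l 1 0) = z (4*l+1) * z (4*l+(2+0))" "x (cidx \<tau> l 1 1) = z (4*l+1) * z (4*l+(2+1))"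
      using v[OF that(1)] z[of 0 l] z[of 1 l] z[of "2+0" l] z[of "2+1" l] by simp_all
    from less_2_zero_one[OF that(2)] less_2_zero_one[OF that(3)] show ?thesis
      by (elim disjE) (simp_all only: p)
  qed
  have "x j = proj \<tau> N z j" for j
  proof (cases "j < 4*N")
    case True
    then obtain l \<alpha> \<beta> where "l < N" "\<alpha> < 2" "\<beta> < 2" "j = cidx \<tau> l \<alpha> \<beta>" by (rule cidx_cases)
    then show ?thesis using xz proj_cidx by simp
  next
    case False
    then show ?thesis using x proj_ge unfolding Xvar_cidx[of _ N \<tau>] by simp
  qed
  moreover have "z \<in> Xhat N"
    unfolding Xhat_def
  proof (intro CollectI allI impI)
    fix \<alpha> \<beta> :: nat assume ab: "\<alpha> < 2" "\<beta> < 2"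
    have "eqn N \<alpha> \<beta> z = (\<Sum>l<N. x (cidx \<tau> l \<alpha> \<beta>))"
      unfolding eqn_def by (intro sum.cong refl xz[symmetric] ab) simp
    with x ab show "eqn N \<alpha> \<beta> z = 0" unfolding Xvar_cidx[of _ N \<tau>] by simp
  qed
  ultimately show ?thesis by blast
qed

lemma polyfun_proj: "j < 4*N \<Longrightarrow> (\<lambda>z. proj \<tau> N z j) \<in> polyfun (4*N)"
proof -
  assume "j < 4*N"
  then obtain l \<alpha> \<beta> where "l < N" "\<alpha> < 2" "\<beta> < 2" "j = cidx \<tau> l \<alpha> \<beta>" by (rule cidx_cases)
  then show ?thesis by (simp only: proj_cidx) (intro polyfun_intros; simp)
qed

lemma pull_proj: "p \<in> polyfun (4*N) \<Longrightarrow> (\<lambda>z. p (proj \<tau> N z)) \<in> polyfun (4*N)"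
  using polyfun_compose[of p "4*N" "proj \<tau> N"] polyfun_proj by blast

text \<open>Irreducibility passes from \<open>Xhat N\<close> to its image under
  \<open>proj\<close>.\<close>

lemma Xvar_irreducible:
  assumes N: "4 \<le> N"
  shows "irreducible_closed N (Xvar N)"
  unfolding irreducible_closed_def
proof (intro conjI allI impI)
  show "zariski_closed N (Xvar N)" unfolding zariski_closed_def by (intro exI[of _ "{}"]) auto
  have "(\<lambda>_. 0) \<in> Xvar N" unfolding Xvar_def by simp
  then show "Xvar N \<noteq> {}" by blast
  fix A B assume A: "zariski_closed N A" and B: "zariski_closed N B" and sub: "Xvar N \<subseteq> A \<union> B"
  show "Xvar N \<subseteq> A \<or> Xvar N \<subseteq> B"
  proof (rule ccontr)
    assume "\<not> ?thesis"
    then obtain x x' where x: "x \<in> Xvar N" "x \<notin> A" "x' \<in> Xvar N" "x' \<notin> B" by blast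
    obtain a where a: "a \<in> polyfun (4*N)" "\<forall>z\<in>A. a z = 0" "a x \<noteq> 0"
      using zariski_closed_separate[OF A x(1,2)] by blast
    obtain b where b: "b \<in> polyfun (4*N)" "\<forall>z\<in>B. b z = 0" "b x' \<noteq> 0"
      using zariski_closed_separate[OF B x(3,4)] by blast
    obtain z where z: "z \<in> Xhat N" "x = proj True N z" using proj_onto[OF x(1)] by blast
    obtain z' where z': "z' \<in> Xhat N" "x' = proj True N z'" using proj_onto[OF x(3)] by blast
    have "b (proj True N z') = 0"
    proof (rule Xhat_irreducible[OF N pull_proj[OF a(1)] pull_proj[OF b(1)] z(1) _ _ z'(1)])
      show "a (proj True N z) \<noteq> 0" using a(3) z(2) by simp
      fix y assume "y \<in> Xhat N"
      then have "proj True N y \<in> A \<union> B" using proj_Xvar sub by blast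
      then show "a (proj True N y) * b (proj True N y) = 0" using a(2) b(2) by auto
    qed
    then show False using b(3) z'(2) by simp
  qed
qed

section \<open>Charts of \<open>Xvar N\<close>\<close>

text \<open>The torus is fixed by normalising one coordinate of each \<lambda> to 1. The first
  \<open>N\<close> parameters are the other \<lambda> coordinates, the last \<open>2*(N-2)\<close>
  are the \<mu> of the blocks from 2 on. The entries at the \<mu> of blocks 0 and 1 are meaningless
  and are not read by \<open>Psi\<close>.\<close>

definition gauge :: "nat \<Rightarrow> (nat \<Rightarrow> nat) \<Rightarrow> (nat \<Rightarrow> complex) \<Rightarrow> nat \<Rightarrow> complex" where
  "gauge N \<alpha> y j = (if j mod 4 < 2 then (if j mod 4 = \<alpha> (j div 4) then 1 else y (j div 4))
     else y (N + 2*(j div 4 - 2) + (j mod 4 - 2)))"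

text \<open>The minor \<open>cr 1 0\<close> is not torus invariant; one \<mu> coordinate from each
  of the blocks 0 and 1 makes it so, as \<open>hfun_proj\<close> displays. The product inverts one
  entry of each matrix.\<close>

definition hfun :: "bool \<Rightarrow> nat \<Rightarrow> (nat \<Rightarrow> nat) \<Rightarrow> (nat \<Rightarrow> nat) \<Rightarrow> (nat \<Rightarrow> complex) \<Rightarrow> complex" where
  "hfun \<tau> N \<alpha> \<beta> x = (x (cidx \<tau> 1 0 (\<beta> 1)) * x (cidx \<tau> 0 1 (\<beta> 0)) - x (cidx \<tau> 1 1 (\<beta> 1)) * x (cidx \<tau> 0 0 (\<beta> 0)))
     * (\<Prod>l<N. x (cidx \<tau> l (\<alpha> l) (\<beta> l)))"

text \<open>Numerators of the chart coordinates over the common denominator \<open>hfun\<close>. For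
  \<open>j < N\<close> one factor of the product is replaced by its neighbour, which gives a ratio
  of \<lambda> coordinates. For larger \<open>j\<close> the two entries from blocks 0 and 1 supply
  the \<mu> coordinates contained in \<open>hfun\<close>.\<close>

definition ufun :: "bool \<Rightarrow> nat \<Rightarrow> (nat \<Rightarrow> nat) \<Rightarrow> (nat \<Rightarrow> nat) \<Rightarrow> nat \<Rightarrow> (nat \<Rightarrow> complex) \<Rightarrow> complex" where
  "ufun \<tau> N \<alpha> \<beta> j x = (if j < N then
      (x (cidx \<tau> 1 0 (\<beta> 1)) * x (cidx \<tau> 0 1 (\<beta> 0)) - x (cidx \<tau> 1 1 (\<beta> 1)) * x (cidx \<tau> 0 0 (\<beta> 0)))
        * (x (cidx \<tau> j (1 - \<alpha> j) (\<beta> j)) * (\<Prod>l\<in>{..<N} - {j}. x (cidx \<tau> l (\<alpha> l) (\<beta> l))))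
    else x (cidx \<tau> (2 + (j - N) div 2) (\<alpha> (2 + (j - N) div 2)) ((j - N) mod 2))
        * (x (cidx \<tau> 0 (\<alpha> 0) (\<beta> 0)) * x (cidx \<tau> 1 (\<alpha> 1) (\<beta> 1)) * (\<Prod>l<N. x (cidx \<tau> l (\<alpha> l) (\<beta> l)))))"

lemma hfun_proj:
  assumes "4 \<le> N" "\<And>l. \<alpha> l < 2" "\<And>l. \<beta> l < 2"
  shows "hfun \<tau> N \<alpha> \<beta> (proj \<tau> N z) = z (4*0+(2+\<beta> 0)) * z (4*1+(2+\<beta> 1)) * cr 1 0 z * (\<Prod>l<N. z (4*l+\<alpha> l) * z (4*l+(2+\<beta> l)))"
proof -
  have "(\<Prod>l<N. proj \<tau> N z (cidx \<tau> l (\<alpha> l) (\<beta> l))) = (\<Prod>l<N. z (4*l+\<alpha> l) * z (4*l+(2+\<beta> l)))"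
    by (intro prod.cong refl proj_cidx assms) simp
  moreover have "proj \<tau> N z (cidx \<tau> 1 0 (\<beta> 1)) * proj \<tau> N z (cidx \<tau> 0 1 (\<beta> 0)) - proj \<tau> N z (cidx \<tau> 1 1 (\<beta> 1)) * proj \<tau> N z (cidx \<tau> 0 0 (\<beta> 0))
     = z (4*0+(2+\<beta> 0)) * z (4*1+(2+\<beta> 1)) * cr 1 0 z"
    using assms by (subst (1 2 3 4) proj_cidx) (auto simp: cr_def algebra_simps)
  ultimately show ?thesis unfolding hfun_def by simp
qed

lemma polyfun_hfun:
  assumes "4 \<le> N" "\<And>l. \<alpha> l < 2" "\<And>l. \<beta> l < 2"
  shows "hfun \<tau> N \<alpha> \<beta> \<in> polyfun (4*N)"
  unfolding hfun_def[abs_def] using assms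
  by (intro pf_mult polyfun_diff polyfun_prod pf_var cidx_less) auto

lemma polyfun_ufun:
  assumes "4 \<le> N" "\<And>l. \<alpha> l < 2" "\<And>l. \<beta> l < 2" "j < N + 2*(N-2)"
  shows "ufun \<tau> N \<alpha> \<beta> j \<in> polyfun (4*N)"
proof (cases "j < N")
  case True
  then have "ufun \<tau> N \<alpha> \<beta> j = (\<lambda>x. (x (cidx \<tau> 1 0 (\<beta> 1)) * x (cidx \<tau> 0 1 (\<beta> 0)) - x (cidx \<tau> 1 1 (\<beta> 1)) * x (cidx \<tau> 0 0 (\<beta> 0)))
        * (x (cidx \<tau> j (1 - \<alpha> j) (\<beta> j)) * (\<Prod>l\<in>{..<N} - {j}. x (cidx \<tau> l (\<alpha> l) (\<beta> l)))))"
    unfolding ufun_def[abs_def] by simp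
  also have "\<dots> \<in> polyfun (4*N)" using assms True
    by (intro pf_mult polyfun_diff polyfun_prod pf_var cidx_less) auto
  finally show ?thesis .
next
  case False
  then have l: "2 + (j - N) div 2 < N" using assms by linarith
  from False have "ufun \<tau> N \<alpha> \<beta> j = (\<lambda>x. x (cidx \<tau> (2 + (j - N) div 2) (\<alpha> (2 + (j - N) div 2)) ((j - N) mod 2))
        * (x (cidx \<tau> 0 (\<alpha> 0) (\<beta> 0)) * x (cidx \<tau> 1 (\<alpha> 1) (\<beta> 1)) * (\<Prod>l<N. x (cidx \<tau> l (\<alpha> l) (\<beta> l)))))"
    unfolding ufun_def[abs_def] by simp
  also have "\<dots> \<in> polyfun (4*N)" using assms l
    by (intro pf_mult polyfun_diff polyfun_prod pf_var cidx_less) auto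
  finally show ?thesis .
qed

lemma gauge_lam:
  assumes "\<And>l. \<alpha> l < 2"
  shows "gauge N \<alpha> y (4*l+\<alpha> l) = 1" "gauge N \<alpha> y (4*l+(1-\<alpha> l)) = y l"
proof -
  have a: "\<alpha> l < 4" "1 - \<alpha> l < 4" "1 - \<alpha> l < 2" "1 - \<alpha> l \<noteq> \<alpha> l"
    using less_2_zero_one[OF assms[of l]] by auto
  show "gauge N \<alpha> y (4*l+\<alpha> l) = 1" unfolding gauge_def block_divmod[OF a(1)] using assms[of l] by simp
  show "gauge N \<alpha> y (4*l+(1-\<alpha> l)) = y l" unfolding gauge_def block_divmod[OF a(2)] using a by simp
qed

lemma gauge_mu: "b < 2 \<Longrightarrow> gauge N \<alpha> y (4*l+(2+b)) = y (N + 2*(l-2) + b)"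
proof -
  assume "b < 2"
  then have b: "2 + b < 4" by simp
  show ?thesis unfolding gauge_def block_divmod[OF b] by simp
qed

lemma Xhat_rescale:
  assumes z: "z \<in> Xhat N" and s: "\<And>l. s l \<noteq> 0"
    and z': "\<And>l r. r < 2 \<Longrightarrow> z' (4*l+r) = z (4*l+r) / s l" "\<And>l r. r < 2 \<Longrightarrow> z' (4*l+(2+r)) = z (4*l+(2+r)) * s l"
  shows "z' \<in> Xhat N" "proj \<tau> N z' = proj \<tau> N z"
proof -
  have p: "z' (4*l+\<alpha>) * z' (4*l+(2+\<beta>)) = z (4*l+\<alpha>) * z (4*l+(2+\<beta>))" if "\<alpha> < 2" "\<beta> < 2" for l \<alpha> \<beta>
    using z'(1)[OF that(1), of l] z'(2)[OF that(2), of l] s[of l] by simp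
  then have "eqn N \<alpha> \<beta> z' = eqn N \<alpha> \<beta> z" if "\<alpha> < 2" "\<beta> < 2" for \<alpha> \<beta> using that unfolding eqn_def by simp
  then show "z' \<in> Xhat N" using z unfolding Xhat_def by simp
  show "proj \<tau> N z' = proj \<tau> N z"
  proof
    fix j show "proj \<tau> N z' j = proj \<tau> N z j"
    proof (cases "j < 4*N")
      case True
      then obtain l \<alpha> \<beta> where "l < N" "\<alpha> < 2" "\<beta> < 2" "j = cidx \<tau> l \<alpha> \<beta>" by (rule cidx_cases)
      then show ?thesis using p proj_cidx by simp
    qed (simp add: proj_ge)
  qed
qed

lemma Xhat_mult_nonzero:
  assumes "4 \<le> N" "p \<in> polyfun (4*N)" "q \<in> polyfun (4*N)" "\<exists>z\<in>Xhat N. p z \<noteq> 0" "\<exists>z\<in>Xhat N. q z \<noteq> 0"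
  shows "\<exists>z\<in>Xhat N. p z * q z \<noteq> 0"
  using Xhat_irreducible[OF assms(1-3)] assms(4,5) by blast

lemma Xhat_coord_nonzero: "\<exists>z\<in>Xhat N. z i \<noteq> 0"
proof (intro bexI[of _ "\<lambda>j. if j = i then 1 else 0"])
  have "eqn N \<alpha> \<beta> (\<lambda>j. if j = i then 1 else 0) = 0" if "\<alpha> < 2" for \<alpha> \<beta>
    unfolding eqn_def using that by (intro sum.neutral) auto
  then show "(\<lambda>j. if j = i then 1 else 0) \<in> Xhat N" unfolding Xhat_def by simp
qed simp

lemma Xhat_cr_nonzero: "\<exists>z\<in>Xhat N. cr 1 0 z \<noteq> 0"
proof (intro bexI[of _ "\<lambda>j. if j = 1 \<or> j = 4 then 1 else 0"])
  have "(4*l+(2+\<beta>)) \<noteq> 1 \<and> (4*l+(2+\<beta>)) \<noteq> 4" if "\<beta> < 2" for l \<beta> :: nat using that by presburger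
  then have "eqn N \<alpha> \<beta> (\<lambda>j. if j = 1 \<or> j = 4 then 1 else 0) = 0" if "\<beta> < 2" for \<alpha> \<beta>
    unfolding eqn_def using that by (intro sum.neutral) auto
  then show "(\<lambda>j. if j = 1 \<or> j = 4 then 1 else 0) \<in> Xhat N" unfolding Xhat_def by simp
qed (simp add: cr_def)

lemma Xhat_prod_nonzero:
  assumes "4 \<le> N" "finite A" "\<And>i. i \<in> A \<Longrightarrow> f i \<in> polyfun (4*N) \<and> (\<exists>z\<in>Xhat N. f i z \<noteq> 0)"
  shows "\<exists>z\<in>Xhat N. (\<Prod>i\<in>A. f i z) \<noteq> 0"
  using assms(2,3)
proof (induction A rule: finite_induct)
  case empty
  then show ?case using Xhat_coord_nonzero by auto
next
  case (insert a A)
  have "(\<lambda>z. \<Prod>i\<in>A. f i z) \<in> polyfun (4*N)" using insert by (intro polyfun_prod) auto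
  from Xhat_mult_nonzero[OF assms(1) _ this, of "f a"] insert show ?case by simp
qed

lemma hfun_nonzero:
  assumes "4 \<le> N" "\<And>l. \<alpha> l < 2" "\<And>l. \<beta> l < 2"
  shows "\<exists>x\<in>Xvar N. hfun \<tau> N \<alpha> \<beta> x \<noteq> 0"
proof -
  let ?f = "\<lambda>l (z :: nat \<Rightarrow> complex). z (4*l+\<alpha> l) * z (4*l+(2+\<beta> l))"
  have v: "(\<lambda>z. z (4*l+\<alpha> l)) \<in> polyfun (4*N)" "(\<lambda>z. z (4*l+(2+\<beta> l))) \<in> polyfun (4*N)" if "l < N" for l
    using that assms(2,3)[of l] by (auto intro!: pf_var)
  have f: "?f l \<in> polyfun (4*N) \<and> (\<exists>z\<in>Xhat N. ?f l z \<noteq> 0)" if "l < N" for l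
    using v[OF that] Xhat_mult_nonzero[OF assms(1) v[OF that] Xhat_coord_nonzero Xhat_coord_nonzero] by (auto intro: pf_mult)
  have prodP: "(\<lambda>z. \<Prod>l<N. ?f l z) \<in> polyfun (4*N)" using f by (intro polyfun_prod) auto
  have prod: "\<exists>z\<in>Xhat N. (\<Prod>l<N. ?f l z) \<noteq> 0"
    using f by (intro Xhat_prod_nonzero[OF assms(1)]) auto
  have mu: "\<exists>z\<in>Xhat N. z (4*0+(2+\<beta> 0)) * z (4*1+(2+\<beta> 1)) \<noteq> 0"
    using assms(1) by (intro Xhat_mult_nonzero[OF assms(1) v(2) v(2)] Xhat_coord_nonzero) auto
  have muP: "(\<lambda>z. z (4*0+(2+\<beta> 0)) * z (4*1+(2+\<beta> 1))) \<in> polyfun (4*N)"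
    using assms(1) by (intro pf_mult v(2)) auto
  have c: "cr 1 0 \<in> polyfun (4*N)" using assms(1) by (intro polyfun_cr) auto
  obtain z where "z \<in> Xhat N" "z (4*0+(2+\<beta> 0)) * z (4*1+(2+\<beta> 1)) * cr 1 0 z * (\<Prod>l<N. ?f l z) \<noteq> 0"
    using Xhat_mult_nonzero[OF assms(1) pf_mult[OF muP c] prodP Xhat_mult_nonzero[OF assms(1) muP c mu Xhat_cr_nonzero] prod]
    by blast
  then show ?thesis using hfun_proj[OF assms, where \<tau>=\<tau> and z=z] proj_Xvar by (intro bexI[of _ "proj \<tau> N z"]) simp_all
qed

text \<open>A point with \<open>hfun\<close> nonzero is lifted to \<open>Xhat N\<close>, moved into
  the gauge by the torus, and its parameters are read off. Their number is 3N-4, the dimension of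
  X.\<close>

lemma chart_gauge:
  assumes N: "4 \<le> N" and al: "\<And>l. \<alpha> l < 2" and be: "\<And>l. \<beta> l < 2"
  shows "chart N (N + 2*(N-2)) (\<lambda>y. proj \<tau> N (Psi N (gauge N \<alpha> y))) (hfun \<tau> N \<alpha> \<beta>) (ufun \<tau> N \<alpha> \<beta>)"
proof
  let ?d = "N + 2*(N-2)"
  have N2: "2 \<le> N" using N by simp
  show "hfun \<tau> N \<alpha> \<beta> \<in> polyfun (4*N)" by (rule polyfun_hfun[OF N al be])
  show "ufun \<tau> N \<alpha> \<beta> j \<in> polyfun (4*N)" if "j < ?d" for j by (rule polyfun_ufun[OF N al be that])
  show "\<exists>x\<in>Xvar N. hfun \<tau> N \<alpha> \<beta> x \<noteq> 0" by (rule hfun_nonzero[OF N al be])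
  show "irreducible_closed N (Xvar N)" by (rule Xvar_irreducible[OF N])
  show "proj \<tau> N (Psi N (gauge N \<alpha> y)) \<in> Xvar N" for y by (intro proj_Xvar Psi_Xhat N2)
  have lam: "Psi N (gauge N \<alpha> y) (4*l+\<alpha> l) = 1" "Psi N (gauge N \<alpha> y) (4*l+(1-\<alpha> l)) = y l" for y l
  proof -
    have "1 - \<alpha> l < 2" by simp
    then show "Psi N (gauge N \<alpha> y) (4*l+\<alpha> l) = 1" "Psi N (gauge N \<alpha> y) (4*l+(1-\<alpha> l)) = y l"
      using Psi_lam[OF al[of l], of N "gauge N \<alpha> y" l] Psi_lam[of "1 - \<alpha> l" N "gauge N \<alpha> y" l]
        gauge_lam[OF al, where N=N and y=y and l=l] by simp_all
  qed
  have gP: "(\<lambda>y. gauge N \<alpha> y (4*l+r)) \<in> polyfun ?d" if "l < N" "r < 4" "2 \<le> r \<Longrightarrow> 2 \<le> l" for l r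
  proof (cases "r < 2")
    case True
    then have "(\<lambda>y. gauge N \<alpha> y (4*l+r)) = (\<lambda>y. if r = \<alpha> l then 1 else y l)"
      unfolding gauge_def block_divmod[OF that(2)] by simp
    then show ?thesis using that(1) by (cases "r = \<alpha> l") (simp_all add: pf_const pf_var)
  next
    case False
    then have "(\<lambda>y. gauge N \<alpha> y (4*l+r)) = (\<lambda>y. y (N + 2*(l-2) + (r-2)))"
      unfolding gauge_def block_divmod[OF that(2)] by simp
    moreover have "N + 2*(l-2) + (r-2) < ?d" using that False by simp
    ultimately show ?thesis by (auto intro: pf_var)
  qed
  have crP: "(\<lambda>y. cr l l' (gauge N \<alpha> y)) \<in> polyfun ?d" if "l < N" "l' < N" for l l'
    unfolding cr_def using that gP[of l 0] gP[of l 1] gP[of l' 0] gP[of l' 1] by (intro polyfun_diff pf_mult) auto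
  have PsiP: "(\<lambda>y. Psi N (gauge N \<alpha> y) (4*l+r)) \<in> polyfun ?d" if l: "l < N" and r: "r < 4" for l r
  proof (cases "r < 2")
    case True
    then show ?thesis using gP[OF l r] by (simp add: Psi_lam)
  next
    case False
    define b where "b = r - 2"
    have b: "b < 2" "r = 2 + b" using r False by (auto simp: b_def)
    have sumP: "(\<lambda>y. \<Sum>l\<in>{2..<N}. cr l l' (gauge N \<alpha> y) * gauge N \<alpha> y (4*l+(2+b))) \<in> polyfun ?d" if "l' < N" for l'
      using that b N by (intro polyfun_sum pf_mult crP gP) auto
    consider "l = 0" | "l = 1" | "2 \<le> l" by linarith
    then show ?thesis
    proof cases
      case 1
      then show ?thesis using sumP[of 1] N unfolding b(2) by (simp add: Psi_mu(1)[OF b(1), simplified])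
    next
      case 2
      have "(\<lambda>y. Psi N (gauge N \<alpha> y) (4*1+(2+b))) = (\<lambda>y. - (\<Sum>l\<in>{2..<N}. cr l 0 (gauge N \<alpha> y) * gauge N \<alpha> y (4*l+(2+b))))"
        using Psi_mu(2)[OF b(1), of N] by (auto simp only: mult_1_right)
      then show ?thesis using sumP[of 0] N 2 unfolding b(2) by (auto intro: polyfun_uminus)
    next
      case 3
      have "(\<lambda>y. Psi N (gauge N \<alpha> y) (4*l+(2+b))) = (\<lambda>y. cr 1 0 (gauge N \<alpha> y) * gauge N \<alpha> y (4*l+(2+b)))"
        using Psi_mu(3)[OF b(1) 3, of N] by auto
      moreover have "(\<lambda>y. cr 1 0 (gauge N \<alpha> y) * gauge N \<alpha> y (4*l+(2+b))) \<in> polyfun ?d"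
        using l b(1) 3 N by (intro pf_mult crP gP) auto
      ultimately show ?thesis unfolding b(2) by simp
    qed
  qed
  show "(\<lambda>y. proj \<tau> N (Psi N (gauge N \<alpha> y)) j) \<in> polyfun ?d" if "j < 4*N" for j
  proof -
    from that obtain l a b where *: "l < N" "a < 2" "b < 2" "j = cidx \<tau> l a b" by (rule cidx_cases)
    show ?thesis unfolding *(4) proj_cidx[OF *(1-3)] using * by (intro pf_mult PsiP) auto
  qed
  show "ufun \<tau> N \<alpha> \<beta> j (proj \<tau> N (Psi N (gauge N \<alpha> y))) = y j * hfun \<tau> N \<alpha> \<beta> (proj \<tau> N (Psi N (gauge N \<alpha> y)))"
    if j: "j < ?d" for j y
  proof -
    let ?z = "Psi N (gauge N \<alpha> y)"
    let ?x = "proj \<tau> N ?z"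
    show ?thesis
    proof (cases "j < N")
      case True
      have "1 - \<alpha> j < 2" by simp
      then have "?x (cidx \<tau> j (1 - \<alpha> j) (\<beta> j)) = y j * ?x (cidx \<tau> j (\<alpha> j) (\<beta> j))"
        using proj_cidx[OF True al be] proj_cidx[OF True _ be, of "1 - \<alpha> j"] lam[of y j] by simp
      moreover have "(\<Prod>l<N. ?x (cidx \<tau> l (\<alpha> l) (\<beta> l))) = ?x (cidx \<tau> j (\<alpha> j) (\<beta> j)) * (\<Prod>l\<in>{..<N}-{j}. ?x (cidx \<tau> l (\<alpha> l) (\<beta> l)))"
        using True by (intro prod.remove) auto
      ultimately show ?thesis using True unfolding ufun_def hfun_def by simp
    next
      case False
      define l where "l = 2 + (j - N) div 2"
      define b where "b = (j - N) mod 2"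
      have l: "l < N" "2 \<le> l" using j False N unfolding l_def by linarith+
      have b: "b < 2" unfolding b_def by simp
      have jlb: "j = N + 2*(l-2) + b" using False unfolding l_def b_def by simp
      have "?x (cidx \<tau> l (\<alpha> l) b) = cr 1 0 ?z * y j"
        using proj_cidx[OF l(1) al b, of \<tau> ?z] lam[of y l] Psi_mu(3)[OF b l(2), of N] gauge_mu[OF b, of N \<alpha> y l] jlb
        by (simp add: cr_Psi)
      moreover have "?x (cidx \<tau> 0 (\<alpha> 0) (\<beta> 0)) = ?z (4*0+(2+\<beta> 0))" "?x (cidx \<tau> 1 (\<alpha> 1) (\<beta> 1)) = ?z (4*1+(2+\<beta> 1))"
        using proj_cidx[OF _ al be, of 0 N \<tau> ?z 0] proj_cidx[OF _ al be, of 1 N \<tau> ?z 1] lam[of y 0] lam[of y 1] N by auto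
      moreover have "(\<Prod>l<N. ?x (cidx \<tau> l (\<alpha> l) (\<beta> l))) = (\<Prod>l<N. ?z (4*l+\<alpha> l) * ?z (4*l+(2+\<beta> l)))"
        by (intro prod.cong refl proj_cidx al be) simp
      ultimately show ?thesis unfolding hfun_proj[OF N al be] using False unfolding ufun_def l_def[symmetric] b_def[symmetric] by simp
    qed
  qed
  show "\<exists>y. x = proj \<tau> N (Psi N (gauge N \<alpha> y))" if x: "x \<in> Xvar N" "hfun \<tau> N \<alpha> \<beta> x \<noteq> 0" for x
  proof -
    obtain z where z: "z \<in> Xhat N" "x = proj \<tau> N z" using proj_onto[OF x(1)] by blast
    have nz: "cr 1 0 z \<noteq> 0" "(\<Prod>l<N. z (4*l+\<alpha> l) * z (4*l+(2+\<beta> l))) \<noteq> 0"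
      using x(2) unfolding z(2) hfun_proj[OF N al be] by auto
    then have nza: "z (4*l+\<alpha> l) \<noteq> 0" if "l < N" for l using that by auto
    \<comment> \<open>The torus element that normalises the chosen \<lambda> coordinates; the value
      1 beyond \<open>N\<close> keeps it invertible.\<close>
    define s where "s l = (if l < N then z (4*l+\<alpha> l) else 1)" for l
    have s: "s l \<noteq> 0" for l using nza by (simp add: s_def)
    define z' where "z' j = (if j mod 4 < 2 then z j / s (j div 4) else z j * s (j div 4))" for j
    have z'1: "z' (4*l+r) = z (4*l+r) / s l" if "r < 2" for l r
      using that block_divmod[of r l] unfolding z'_def by simp
    have z'2: "z' (4*l+(2+r)) = z (4*l+(2+r)) * s l" if "r < 2" for l r
      using that block_divmod[of "2+r" l] unfolding z'_def by simp
    note z' = Xhat_rescale[OF z(1) s z'1 z'2]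
    have z'a: "z' (4*l+\<alpha> l) = 1" if "l < N" for l using z'1[OF al, of l] that s[of l] unfolding s_def by simp
    have "cr 1 0 z' = cr 1 0 z / (s 0 * s 1)"
    proof -
      have "z' (4*1) = z (4*1) / s 1" "z' (4*1+1) = z (4*1+1) / s 1" "z' (4*0) = z (4*0) / s 0" "z' (4*0+1) = z (4*0+1) / s 0"
        using z'1[of 0 0] z'1[of 1 0] z'1[of 0 1] z'1[of 1 1] by simp_all
      then show ?thesis unfolding cr_def using s[of 0] s[of 1] by (simp only:) (simp add: field_simps)
    qed
    then have c': "cr 1 0 z' \<noteq> 0" using nz s by simp
    \<comment> \<open>The \<mu> are divided by the minor because \<open>Psi\<close> multiplies by
      it.\<close>
    define y where "y j = (if j < N then z' (4*j+(1-\<alpha> j))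
       else z' (4*(2 + (j-N) div 2) + (2 + (j-N) mod 2)) / cr 1 0 z')" for j
    let ?G = "gauge N \<alpha> y"
    have Gl: "?G (4*l+r) = z' (4*l+r)" if "l < N" "r < 2" for l r
    proof (cases "r = \<alpha> l")
      case True
      then show ?thesis using gauge_lam(1)[OF al] z'a[OF that(1)] by simp
    next
      case False
      then have "r = 1 - \<alpha> l" using al[of l] that by simp
      then show ?thesis using gauge_lam(2)[OF al, where N=N and y=y and l=l] that by (simp add: y_def)
    qed
    have Gm: "?G (4*l+(2+r)) = z' (4*l+(2+r)) / cr 1 0 z'" if "2 \<le> l" "r < 2" for l r
    proof -
      have "(N + 2*(l-2) + r - N) div 2 = l - 2" "(N + 2*(l-2) + r - N) mod 2 = r" using that by auto
      moreover have "\<not> N + 2*(l-2) + r < N" "2 + (l - 2) = l" using that by auto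
      ultimately show ?thesis unfolding gauge_mu[OF that(2)] y_def by (simp only: if_False)
    qed
    have crG: "cr l l' ?G = cr l l' z'" if "l < N" "l' < N" for l l'
      unfolding cr_def using Gl[OF that(1), of 0] Gl[OF that(1), of 1] Gl[OF that(2), of 0] Gl[OF that(2), of 1] by simp
    have cG: "cr 1 0 ?G = cr 1 0 z'" using crG N by simp
    have mu: "Psi N ?G (4*l+(2+b)) = z' (4*l+(2+b))" if "l < N" "b < 2" for l b
    proof -
      have sum: "(\<Sum>l\<in>{2..<N}. cr l l' ?G * ?G (4*l+(2+b))) = (\<Sum>l\<in>{2..<N}. cr l l' z' * z' (4*l+(2+b))) / cr 1 0 z'"
        if "l' < N" for l'
        unfolding sum_divide_distrib
      proof (rule sum.cong[OF refl])
        fix l assume "l \<in> {2..<N}"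
        then have "2 \<le> l" "l < N" by auto
        then show "cr l l' ?G * ?G (4*l+(2+b)) = cr l l' z' * z' (4*l+(2+b)) / cr 1 0 z'"
          unfolding Gm[OF \<open>2 \<le> l\<close> \<open>b < 2\<close>] crG[OF \<open>l < N\<close> that] by simp
      qed
      have ph: "Psi N z' (4*l+(2+b)) = cr 1 0 z' * z' (4*l+(2+b))" by (rule Psi_on_Xhat[OF N2 z'(1) that(2)])
      have ph': "z' (4*l+(2+b)) = Psi N z' (4*l+(2+b)) / cr 1 0 z'" unfolding ph using c' by simp
      consider "l = 0" | "l = 1" | "2 \<le> l" by linarith
      then show ?thesis
      proof cases
        case 1
        have "Psi N ?G (2+b) = Psi N z' (2+b) / cr 1 0 z'"
          unfolding Psi_mu(1)[OF that(2)] by (rule sum) (use N in simp)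
        then show ?thesis using ph' 1 by simp
      next
        case 2
        have "Psi N ?G (4+(2+b)) = Psi N z' (4+(2+b)) / cr 1 0 z'"
          unfolding Psi_mu(2)[OF that(2)] using sum[of 0] N by simp
        then show ?thesis using ph' 2 by simp
      next
        case 3
        then show ?thesis using Psi_mu(3)[OF that(2), of l N ?G] Gm[OF 3 that(2)] cG c' by simp
      qed
    qed
    have "proj \<tau> N (Psi N ?G) j = proj \<tau> N z' j" for j
    proof (cases "j < 4*N")
      case True
      then obtain l a b where *: "l < N" "a < 2" "b < 2" "j = cidx \<tau> l a b" by (rule cidx_cases)
      show ?thesis unfolding *(4) proj_cidx[OF *(1-3)] mu[OF *(1,3)] Psi_lam[OF *(2)] Gl[OF *(1,2)] ..
    qed (simp add: proj_ge)
    then show ?thesis using z'(2)[of \<tau>] z(2) by (intro exI[of _ y]) auto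
  qed
qed

section \<open>Cancelling denominators on \<open>Xhat N\<close>\<close>

locale fraction_on_Xhat =
  fixes N :: nat and F f :: "(nat \<Rightarrow> complex) \<Rightarrow> complex"
  assumes N4: "4 \<le> N" and F: "F \<in> polyfun (4*N)" and f: "f \<in> polyfun (4*N)" and fnz: "\<exists>z\<in>Xhat N. f z \<noteq> 0"
begin

text \<open>\<open>Dv W\<close> means that \<open>W\<close> clears the denominator of \<open>F / f\<close>.\<close>

definition Dv :: "((nat \<Rightarrow> complex) \<Rightarrow> complex) \<Rightarrow> bool" where
  "Dv W \<longleftrightarrow> (\<exists>E\<in>polyfun (4*N). \<forall>z\<in>Xhat N. W z * F z = f z * E z)"

lemma Dv_mult: "Dv W \<Longrightarrow> V \<in> polyfun (4*N) \<Longrightarrow> Dv (\<lambda>z. V z * W z)"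
proof -
  assume "Dv W" and V: "V \<in> polyfun (4*N)"
  then obtain E where E: "E \<in> polyfun (4*N)" "\<forall>z\<in>Xhat N. W z * F z = f z * E z" unfolding Dv_def by blast
  then have "\<forall>z\<in>Xhat N. (V z * W z) * F z = f z * (V z * E z)" by (simp add: mult_ac)
  then show ?thesis unfolding Dv_def using pf_mult[OF V E(1)] by (intro bexI[of _ "\<lambda>z. V z * E z"])
qed

lemma Xhat_cancel:
  assumes "p \<in> polyfun (4*N)" "\<exists>z\<in>Xhat N. p z \<noteq> 0" "q \<in> polyfun (4*N)" "r \<in> polyfun (4*N)"
    "\<And>z. z \<in> Xhat N \<Longrightarrow> p z * q z = p z * r z" "z \<in> Xhat N"
  shows "q z = r z"
proof -
  obtain z0 where z0: "z0 \<in> Xhat N" "p z0 \<noteq> 0" using assms(2) by blast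
  have "q z - r z = 0"
    by (rule Xhat_irreducible[OF N4 assms(1) polyfun_diff[OF assms(3,4)] z0 _ assms(6)])
      (simp add: right_diff_distrib assms(5))
  then show ?thesis by simp
qed

text \<open>Cancelling \<open>f\<close> in the two representations gives
  \<open>g' * E = g * E'\<close>; the regular pair then makes \<open>E\<close> a multiple of
  \<open>g\<close>, and \<open>g\<close> is cancelled in turn.\<close>

lemma Dv_cancel:
  assumes rp: "regular_pair N g g'" and g: "g \<in> polyfun (4*N)" "g' \<in> polyfun (4*N)" "\<exists>z\<in>Xhat N. g z \<noteq> 0"
    and W: "W \<in> polyfun (4*N)" and D: "Dv (\<lambda>z. g z * W z)" "Dv (\<lambda>z. g' z * W z)"
  shows "Dv W"
proof -
  obtain E where E: "E \<in> polyfun (4*N)" "\<forall>z\<in>Xhat N. g z * W z * F z = f z * E z" using D(1) unfolding Dv_def by blast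
  obtain E' where E': "E' \<in> polyfun (4*N)" "\<forall>z\<in>Xhat N. g' z * W z * F z = f z * E' z" using D(2) unfolding Dv_def by blast
  have "g' z * E z = g z * E' z" if z: "z \<in> Xhat N" for z
  proof (rule Xhat_cancel[OF f fnz pf_mult[OF g(2) E(1)] pf_mult[OF g(1) E'(1)] _ z])
    fix z assume z: "z \<in> Xhat N"
    have eq: "f z * E z = g z * W z * F z" "f z * E' z = g' z * W z * F z" using E(2) E'(2) z by auto
    have "f z * (g' z * E z) = g' z * (f z * E z)" by (simp only: mult_ac)
    also have "\<dots> = g z * (f z * E' z)" unfolding eq by (simp only: mult_ac)
    also have "\<dots> = f z * (g z * E' z)" by (simp only: mult_ac)
    finally show "f z * (g' z * E z) = f z * (g z * E' z)" .
  qed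
  then obtain H where H: "H \<in> polyfun (4*N)" "\<forall>z\<in>Xhat N. E z = g z * H z"
    using rp E(1) E'(1) unfolding regular_pair_def by blast
  have "W z * F z = f z * H z" if z: "z \<in> Xhat N" for z
  proof (rule Xhat_cancel[OF g(1,3) pf_mult[OF W F] pf_mult[OF f H(1)] _ z])
    fix z assume z: "z \<in> Xhat N"
    have "g z * (W z * F z) = f z * E z" using E(2) z by (simp add: mult.assoc)
    then show "g z * (W z * F z) = g z * (f z * H z)" using H(2) z by simp
  qed
  then show ?thesis unfolding Dv_def using H(1) by blast
qed

text \<open>\<open>Dv_cancel\<close> is applied to one factor at a time: first to the powers of
  \<open>g'\<close> against a single \<open>g\<close>, then to the powers of
  \<open>g\<close>.\<close>

lemma Dv_cancel_power:
  assumes rp: "regular_pair N g g'" and g: "g \<in> polyfun (4*N)" "g' \<in> polyfun (4*N)" "\<exists>z\<in>Xhat N. g z \<noteq> 0"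
    and W: "W \<in> polyfun (4*N)" and D: "Dv (\<lambda>z. g z ^ a * W z)" "Dv (\<lambda>z. g' z ^ b * W z)"
  shows "Dv W"
proof -
  have one: "Dv V" if V: "V \<in> polyfun (4*N)" and D: "Dv (\<lambda>z. g z * V z)" "Dv (\<lambda>z. g' z ^ b * V z)" for V b
    using D(2)
  proof (induction b)
    case (Suc b)
    have "Dv (\<lambda>z. g' z ^ b * V z)"
    proof (rule Dv_cancel[OF rp g])
      show "(\<lambda>z. g' z ^ b * V z) \<in> polyfun (4*N)" using g V by (intro polyfun_intros)
      show "Dv (\<lambda>z. g z * (g' z ^ b * V z))"
        using Dv_mult[OF D(1) polyfun_power[OF g(2), of b]] by (simp add: mult_ac)
      show "Dv (\<lambda>z. g' z * (g' z ^ b * V z))" using Suc.prems by (simp add: mult_ac)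
    qed
    then show ?case by (rule Suc.IH)
  qed simp
  show ?thesis using D(1)
  proof (induction a)
    case (Suc a)
    have "Dv (\<lambda>z. g z ^ a * W z)"
    proof (rule one)
      show "(\<lambda>z. g z ^ a * W z) \<in> polyfun (4*N)" using g W by (intro polyfun_intros)
      show "Dv (\<lambda>z. g z * (g z ^ a * W z))" using Suc.prems by (simp add: mult_ac)
      show "Dv (\<lambda>z. g' z ^ b * (g z ^ a * W z))"
        using Dv_mult[OF D(2) polyfun_power[OF g(1), of a]] by (simp add: mult_ac)
    qed
    then show ?case by (rule Suc.IH)
  qed simp
qed

text \<open>The four choices of coordinates in one block are compared: the two coordinates of
  \<lambda> are a regular pair, and so are those of \<mu>, so the block drops out of the
  denominator.\<close>

lemma Dv_cancel_coords:
  assumes D: "D \<in> polyfun (4*N)"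
    and all: "\<And>\<alpha> \<beta>. (\<And>l. \<alpha> l < 2) \<Longrightarrow> (\<And>l. \<beta> l < (2::nat)) \<Longrightarrow>
      \<exists>K. Dv (\<lambda>z. D z ^ K * (\<Prod>l<N. z (4*l+\<alpha> l) * z (4*l+(2+\<beta> l))) ^ K)"
  shows "\<exists>K. Dv (\<lambda>z. D z ^ K)"
proof -
  \<comment> \<open>In \<open>V\<close> the blocks below \<open>m\<close> are already cancelled. For
    \<open>m = N\<close> only the power of \<open>D\<close> remains and the choices no longer
    matter.\<close>
  define V where "V K \<alpha> \<beta> m z = D z ^ K * (\<Prod>l\<in>{m..<N}. z (4*l+\<alpha> l) * z (4*l+(2+\<beta> l))) ^ K"
    for K \<alpha> \<beta> m and z :: "nat \<Rightarrow> complex"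
  have VP: "V K \<alpha> \<beta> m \<in> polyfun (4*N)" if "\<And>l. \<alpha> l < 2" "\<And>l. \<beta> l < 2" for K \<alpha> \<beta> m
  proof -
    have "4*l+\<alpha> l < 4*N" "4*l+(2+\<beta> l) < 4*N" if "l < N" for l
      using that \<open>\<And>l. \<alpha> l < 2\<close>[of l] \<open>\<And>l. \<beta> l < 2\<close>[of l] by auto
    then show ?thesis unfolding V_def[abs_def] using D by (intro polyfun_intros) auto
  qed
  have raise: "Dv (V K \<alpha> \<beta> m)" if ab: "\<And>l. \<alpha> l < 2" "\<And>l. \<beta> l < 2" and k: "Dv (V k \<alpha> \<beta> m)" "k \<le> K" for k K \<alpha> \<beta> m
  proof -
    have "V K \<alpha> \<beta> m = (\<lambda>z. V (K - k) \<alpha> \<beta> m z * V k \<alpha> \<beta> m z)"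
    proof
      fix z
      have e: "x ^ K = x ^ (K - k) * x ^ k" for x :: complex using k(2) by (simp add: power_add[symmetric])
      show "V K \<alpha> \<beta> m z = V (K - k) \<alpha> \<beta> m z * V k \<alpha> \<beta> m z" unfolding V_def e by (simp only: mult_ac)
    qed
    then show ?thesis using Dv_mult[OF k(1) VP[OF ab, where K="K - k" and m=m]] by simp
  qed
  have "\<exists>K. Dv (V K \<alpha> \<beta> m)" if "m \<le> N" "\<And>l. \<alpha> l < 2" "\<And>l. \<beta> l < 2" for m \<alpha> \<beta>
    using that
  proof (induction m arbitrary: \<alpha> \<beta>)
    case 0
    then show ?case using all[of \<alpha> \<beta>] unfolding V_def[abs_def] by (simp add: lessThan_atLeast0)
  next
    case (Suc m)
    then have m: "m < N" by simp
    have upd: "(\<alpha>(m := a)) l < 2" "(\<beta>(m := a)) l < 2" if "a < 2" for a l using that Suc.prems by auto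
    have "\<exists>k. Dv (V k (\<alpha>(m := a)) (\<beta>(m := b)) m)" if "a < 2" "b < 2" for a b
      by (rule Suc.IH) (use upd[OF that(1)] upd[OF that(2)] m in simp_all)
    then obtain k where k: "\<And>a b. a < 2 \<Longrightarrow> b < 2 \<Longrightarrow> Dv (V (k a b) (\<alpha>(m := a)) (\<beta>(m := b)) m)" by metis
    \<comment> \<open>A common exponent for the four choices in block \<open>m\<close>.\<close>
    define K where "K = k 0 0 + k 0 1 + k 1 0 + k 1 1"
    have le: "k a b \<le> K" if "a < 2" "b < 2" for a b
      using less_2_zero_one[OF that(1)] less_2_zero_one[OF that(2)] unfolding K_def by auto
    have DK: "Dv (\<lambda>z. z (4*m+a) ^ K * (z (4*m+(2+b)) ^ K * V K \<alpha> \<beta> (Suc m) z))" if ab: "a < 2" "b < 2" for a b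
    proof -
      have "Dv (V K (\<alpha>(m := a)) (\<beta>(m := b)) m)"
        by (rule raise[OF upd(1)[OF ab(1)] upd(2)[OF ab(2)] k[OF ab] le[OF ab]])
      moreover have Vz: "V K (\<alpha>(m := a)) (\<beta>(m := b)) m z = z (4*m+a) ^ K * (z (4*m+(2+b)) ^ K * V K \<alpha> \<beta> (Suc m) z)" for z
      proof -
        have "{m..<N} = insert m {Suc m..<N}" using m by auto
        then have "(\<Prod>l\<in>{m..<N}. z (4*l+(\<alpha>(m := a)) l) * z (4*l+(2+(\<beta>(m := b)) l))) =
           z (4*m+a) * z (4*m+(2+b)) * (\<Prod>l\<in>{Suc m..<N}. z (4*l+(\<alpha>(m := a)) l) * z (4*l+(2+(\<beta>(m := b)) l)))" by simp
        also have "(\<Prod>l\<in>{Suc m..<N}. z (4*l+(\<alpha>(m := a)) l) * z (4*l+(2+(\<beta>(m := b)) l))) =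
           (\<Prod>l\<in>{Suc m..<N}. z (4*l+\<alpha> l) * z (4*l+(2+\<beta> l)))" by (intro prod.cong) auto
        finally show ?thesis unfolding V_def by (simp add: power_mult_distrib mult_ac)
      qed
      have "V K (\<alpha>(m := a)) (\<beta>(m := b)) m = (\<lambda>z. z (4*m+a) ^ K * (z (4*m+(2+b)) ^ K * V K \<alpha> \<beta> (Suc m) z))"
        by (rule ext) (rule Vz)
      ultimately show ?thesis by (simp only:)
    qed
    have c: "(\<lambda>z. z (4*m+r)) \<in> polyfun (4*N)" if "r < 4" for r using m that by (intro pf_var) simp
    have V1: "V K \<alpha> \<beta> (Suc m) \<in> polyfun (4*N)" by (rule VP) (use Suc.prems in auto)
    have Db: "Dv (\<lambda>z. z (4*m+(2+b)) ^ K * V K \<alpha> \<beta> (Suc m) z)" if "b < 2" for b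
    proof (rule Dv_cancel_power[OF regular_pair_coords[OF N4 m, of 0]])
      show "(\<lambda>z. z (4*m+(2+b)) ^ K * V K \<alpha> \<beta> (Suc m) z) \<in> polyfun (4*N)"
        using that by (intro pf_mult polyfun_power c V1) simp
    qed (use DK[of 0 b] DK[of 1 b] that c[of 0] c[of 1] Xhat_coord_nonzero in auto)
    have "Dv (V K \<alpha> \<beta> (Suc m))"
      by (rule Dv_cancel_power[OF regular_pair_coords[OF N4 m, of 2] _ _ _ V1])
        (use Db[of 0] Db[of 1] c[of 2] c[of "2+1"] Xhat_coord_nonzero in auto)
    then show ?case by blast
  qed
  from this[of N "\<lambda>_. 0" "\<lambda>_. 0"] obtain K where "Dv (V K (\<lambda>_. 0) (\<lambda>_. 0) N)" by auto
  then show ?thesis unfolding V_def[abs_def] by auto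
qed

end

section \<open>Torus weights\<close>

text \<open>The row index of the Kronecker factor of a block is carried by \<lambda> for sign + and
  by \<mu> for sign -. \<open>ps\<close> addresses this spinor, \<open>qs\<close> the one that
  carries the column index.\<close>

definition ps :: "(nat \<Rightarrow> bool) \<Rightarrow> nat \<Rightarrow> nat \<Rightarrow> nat" where
  "ps \<sigma> l a = 4*l + (if \<sigma> l then a else 2+a)"

definition qs :: "(nat \<Rightarrow> bool) \<Rightarrow> nat \<Rightarrow> nat \<Rightarrow> nat" where
  "qs \<sigma> l a = 4*l + (if \<sigma> l then 2+a else a)"

definition pmon :: "(nat \<Rightarrow> bool) \<Rightarrow> nat \<Rightarrow> nat \<Rightarrow> (nat \<Rightarrow> nat) \<Rightarrow> (nat \<Rightarrow> complex) \<Rightarrow> complex" where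
  "pmon \<sigma> N n I z = (\<Prod>l<N. z (ps \<sigma> l 0) ^ (n - I l) * z (ps \<sigma> l 1) ^ I l)"

definition qmon :: "(nat \<Rightarrow> bool) \<Rightarrow> nat \<Rightarrow> nat \<Rightarrow> (nat \<Rightarrow> nat) \<Rightarrow> (nat \<Rightarrow> complex) \<Rightarrow> complex" where
  "qmon \<sigma> N n J z = (\<Prod>l<N. z (qs \<sigma> l 0) ^ (n - J l) * z (qs \<sigma> l 1) ^ J l)"

text \<open>On a matrix that is a column times a row, both branches of \<open>Smat\<close> become
  the same monomial, so the matrix is an outer product.\<close>

lemma Smat_rank_one:
  assumes "i \<le> n" "j \<le> n"
  shows "Smat n (p0 * q0) (p0 * q1) (p1 * q0) (p1 * q1) i j = (p0 ^ (n - i) * p1 ^ i) * (q0 ^ (n - j) * q1 ^ j)"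
proof (cases "i + j \<le> n")
  case True
  then have "p0 ^ (n - i) = p0 ^ (n - i - j) * p0 ^ j" "q0 ^ (n - j) = q0 ^ (n - i - j) * q0 ^ i"
    by (simp_all add: power_add[symmetric])
  then show ?thesis using True unfolding Smat_def by (simp add: power_mult_distrib mult_ac)
next
  case False
  then have "p1 ^ i = p1 ^ (n - j) * p1 ^ (i + j - n)" "q1 ^ j = q1 ^ (n - i) * q1 ^ (i + j - n)"
    using assms by (simp_all add: power_add[symmetric])
  then show ?thesis using False unfolding Smat_def by (simp add: power_mult_distrib mult_ac)
qed

lemma proj_block:
  assumes "l < N"
  shows "proj True N z (4*l) = z (4*l) * z (4*l+2)" "proj True N z (4*l+1) = z (4*l) * z (4*l+3)"
    "proj True N z (4*l+2) = z (4*l+1) * z (4*l+2)" "proj True N z (4*l+3) = z (4*l+1) * z (4*l+3)"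
  using proj_cidx[OF assms, of 0 0 True z] proj_cidx[OF assms, of 0 1 True z]
    proj_cidx[OF assms, of 1 0 True z] proj_cidx[OF assms, of 1 1 True z]
  unfolding cidx_def by (simp_all add: numeral_3_eq_3)

text \<open>All columns are multiples of one vector, with entries \<open>pmon\<close>. An element of
  M is therefore this vector times a single function, and the extension problem becomes
  scalar.\<close>

lemma kron_proj:
  assumes "I \<in> multi_idx N n" "J \<in> multi_idx N n"
  shows "kron N n \<sigma> (proj True N z) I J = pmon \<sigma> N n I z * qmon \<sigma> N n J z"
  unfolding kron_def pmon_def qmon_def prod.distrib[symmetric]
proof (rule prod.cong[OF refl])
  fix l assume "l \<in> {..<N}"
  then have l: "l < N" "I l \<le> n" "J l \<le> n" using assms unfolding multi_idx_def by auto
  have "Ssig n (\<sigma> l) (z (4*l) * z (4*l+2)) (z (4*l) * z (4*l+3)) (z (4*l+1) * z (4*l+2)) (z (4*l+1) * z (4*l+3)) (I l) (J l)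
    = z (ps \<sigma> l 0) ^ (n - I l) * z (ps \<sigma> l 1) ^ I l * (z (qs \<sigma> l 0) ^ (n - J l) * z (qs \<sigma> l 1) ^ J l)"
  proof (cases "\<sigma> l")
    case True
    have "ps \<sigma> l 0 = 4*l" "ps \<sigma> l 1 = 4*l+1" "qs \<sigma> l 0 = 4*l+2" "qs \<sigma> l 1 = 4*l+3"
      using True unfolding ps_def qs_def by auto
    then show ?thesis unfolding Ssig_def using True by (simp only: if_True Smat_rank_one[OF l(2,3)])
  next
    case False
    have "ps \<sigma> l 0 = 4*l+2" "ps \<sigma> l 1 = 4*l+3" "qs \<sigma> l 0 = 4*l" "qs \<sigma> l 1 = 4*l+1"
      using False unfolding ps_def qs_def by auto
    then show ?thesis using False by (simp only: Ssig_def if_False Smat_rank_one[OF l(3,2)]) (rule mult.commute)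
  qed
  then show "Ssig n (\<sigma> l) (proj True N z (4*l)) (proj True N z (4*l+1)) (proj True N z (4*l+2)) (proj True N z (4*l+3)) (I l) (J l)
    = z (ps \<sigma> l 0) ^ (n - I l) * z (ps \<sigma> l 1) ^ I l * (z (qs \<sigma> l 0) ^ (n - J l) * z (qs \<sigma> l 1) ^ J l)"
    unfolding proj_block[OF l(1)] .
qed

lemma finite_multi_idx: "finite (multi_idx N n)"
proof -
  have "I \<in> {I. \<forall>l. (l \<in> {..<N} \<longrightarrow> I l \<in> {..n}) \<and> (l \<notin> {..<N} \<longrightarrow> I l = 0)}" if "I \<in> multi_idx N n" for I
  proof -
    have "I l \<le> n" if "l < N" for l using \<open>I \<in> multi_idx N n\<close> that unfolding multi_idx_def by blast
    moreover have "I l = 0" if "\<not> l < N" for l using \<open>I \<in> multi_idx N n\<close> that leI unfolding multi_idx_def by blast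
    ultimately show ?thesis by simp
  qed
  then show ?thesis
    by (intro finite_subset[OF subsetI finite_set_of_finite_funs[of "{..<N}" "{..n}" 0]]) auto
qed

lemma polyfun_qmon: "qmon \<sigma> N n J \<in> polyfun (4*N)"
  unfolding qmon_def[abs_def] qs_def by (intro polyfun_intros) auto

lemma polyfun_Smat:
  assumes "a \<in> polyfun m" "b \<in> polyfun m" "c \<in> polyfun m" "d \<in> polyfun m"
  shows "(\<lambda>x. Smat n (a x) (b x) (c x) (d x) i j) \<in> polyfun m"
  unfolding Smat_def using assms by (cases "i + j \<le> n") (auto intro!: polyfun_intros)

lemma polyfun_kron: "(\<lambda>x. kron N n \<sigma> x I J) \<in> polyfun (4*N)"
  unfolding kron_def
proof (rule polyfun_prod)
  fix l assume "l \<in> {..<N}"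
  then have v: "(\<lambda>x. x (4*l)) \<in> polyfun (4*N)" "(\<lambda>x. x (4*l+1)) \<in> polyfun (4*N)"
    "(\<lambda>x. x (4*l+2)) \<in> polyfun (4*N)" "(\<lambda>x. x (4*l+3)) \<in> polyfun (4*N)" by (auto intro: pf_var)
  show "(\<lambda>x. Ssig n (\<sigma> l) (x (4*l)) (x (4*l+1)) (x (4*l+2)) (x (4*l+3)) (I l) (J l)) \<in> polyfun (4*N)"
    unfolding Ssig_def using polyfun_Smat[OF v] by (cases "\<sigma> l") auto
qed

lemma Mmod_polyfun: "m \<in> Mmod N n \<sigma> \<Longrightarrow> (\<lambda>x. m x I) \<in> polyfun (4*N)"
  unfolding Mmod_def by (auto intro!: polyfun_sum pf_mult polyfun_kron)

section \<open>The torus action and weights of monomials\<close>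

definition pdeg :: "(nat \<Rightarrow> bool) \<Rightarrow> nat \<Rightarrow> (nat \<Rightarrow> nat) \<Rightarrow> nat" where
  "pdeg \<sigma> l e = e (ps \<sigma> l 0) + e (ps \<sigma> l 1)"

definition qdeg :: "(nat \<Rightarrow> bool) \<Rightarrow> nat \<Rightarrow> (nat \<Rightarrow> nat) \<Rightarrow> nat" where
  "qdeg \<sigma> l e = e (qs \<sigma> l 0) + e (qs \<sigma> l 1)"

lemma mon_blocks:
  "mon (4*N) e z = (\<Prod>l<N. (z (ps \<sigma> l 0) ^ e (ps \<sigma> l 0) * z (ps \<sigma> l 1) ^ e (ps \<sigma> l 1)) *
     (z (qs \<sigma> l 0) ^ e (qs \<sigma> l 0) * z (qs \<sigma> l 1) ^ e (qs \<sigma> l 1)))"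
proof (induction N)
  case (Suc N)
  have e4: "4 * Suc N = Suc (Suc (Suc (Suc (4*N))))" by simp
  have "mon (4 * Suc N) e z = mon (4*N) e z * (z (4*N) ^ e (4*N) * z (4*N+1) ^ e (4*N+1) * z (4*N+2) ^ e (4*N+2) * z (4*N+3) ^ e (4*N+3))"
    unfolding mon_def e4 by (simp only: prod.lessThan_Suc) (simp add: mult_ac numeral_3_eq_3)
  also have "z (4*N) ^ e (4*N) * z (4*N+1) ^ e (4*N+1) * z (4*N+2) ^ e (4*N+2) * z (4*N+3) ^ e (4*N+3) =
     (z (ps \<sigma> N 0) ^ e (ps \<sigma> N 0) * z (ps \<sigma> N 1) ^ e (ps \<sigma> N 1)) * (z (qs \<sigma> N 0) ^ e (qs \<sigma> N 0) * z (qs \<sigma> N 1) ^ e (qs \<sigma> N 1))"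
    unfolding ps_def qs_def by (cases "\<sigma> N") (simp_all add: mult_ac numeral_3_eq_3)
  finally show ?case using Suc by simp
qed (simp add: mon_def)

text \<open>The torus factor of block \<open>l\<close>, oriented by the sign: the spinor of
  \<open>ps\<close> is divided by \<open>t\<close> and that of \<open>qs\<close> multiplied, so that
  \<open>qmon\<close> has weight \<open>n\<close>. The test
  \<open>(j mod 4 < 2) = \<sigma> l\<close> recognises the spinor of \<open>ps\<close>.\<close>

definition tscale :: "(nat \<Rightarrow> bool) \<Rightarrow> nat \<Rightarrow> complex \<Rightarrow> (nat \<Rightarrow> complex) \<Rightarrow> nat \<Rightarrow> complex" where
  "tscale \<sigma> l t z j = (if j div 4 = l then (if (j mod 4 < 2) = \<sigma> l then z j / t else z j * t) else z j)"

lemma tscale_ps: "a < 2 \<Longrightarrow> tscale \<sigma> l t z (ps \<sigma> l' a) = (if l' = l then z (ps \<sigma> l' a) / t else z (ps \<sigma> l' a))"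
  using block_divmod[of a l'] block_divmod[of "2+a" l'] unfolding tscale_def ps_def by auto

lemma tscale_qs: "a < 2 \<Longrightarrow> tscale \<sigma> l t z (qs \<sigma> l' a) = (if l' = l then z (qs \<sigma> l' a) * t else z (qs \<sigma> l' a))"
  using block_divmod[of a l'] block_divmod[of "2+a" l'] unfolding tscale_def qs_def by auto

lemma tscale_Xhat:
  assumes "z \<in> Xhat N" "t \<noteq> 0"
  shows "tscale \<sigma> l t z \<in> Xhat N" "proj \<tau> N (tscale \<sigma> l t z) = proj \<tau> N z"
proof -
  define s where "s l' = (if l' = l then (if \<sigma> l then t else 1 / t) else 1)" for l'
  have s: "s l' \<noteq> 0" for l' using assms(2) by (simp add: s_def)
  have 1: "tscale \<sigma> l t z (4*l'+r) = z (4*l'+r) / s l'" if "r < 2" for l' r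
    using block_divmod[of r l'] that unfolding tscale_def s_def by auto
  have 2: "tscale \<sigma> l t z (4*l'+(2+r)) = z (4*l'+(2+r)) * s l'" if "r < 2" for l' r
    using block_divmod[of "2+r" l'] that unfolding tscale_def s_def by auto
  show "tscale \<sigma> l t z \<in> Xhat N" "proj \<tau> N (tscale \<sigma> l t z) = proj \<tau> N z"
    using Xhat_rescale[OF assms(1) s 1 2] by blast+
qed

lemma prod_single_factor:
  fixes g h :: "nat \<Rightarrow> complex"
  assumes "l < N" "\<And>l'. l' \<noteq> l \<Longrightarrow> g l' = h l'" "g l * x = h l * y"
  shows "(\<Prod>l'<N. g l') * x = (\<Prod>l'<N. h l') * y"
proof -
  have "(\<Prod>l'<N. g l') = g l * (\<Prod>l'\<in>{..<N}-{l}. g l')" "(\<Prod>l'<N. h l') = h l * (\<Prod>l'\<in>{..<N}-{l}. h l')"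
    using assms(1) by (intro prod.remove; simp)+
  moreover have "(\<Prod>l'\<in>{..<N}-{l}. g l') = (\<Prod>l'\<in>{..<N}-{l}. h l')" using assms(2) by (intro prod.cong) auto
  ultimately show ?thesis using assms(3) by (simp add: mult_ac)
qed

text \<open>Powers of \<open>t\<close> stand on both sides to avoid negative exponents.\<close>

lemma tscale_mon:
  assumes "l < N" "t \<noteq> 0"
  shows "mon (4*N) e (tscale \<sigma> l t z) * t ^ pdeg \<sigma> l e = mon (4*N) e z * t ^ qdeg \<sigma> l e"
  unfolding mon_blocks[where \<sigma>=\<sigma>]
proof (rule prod_single_factor[OF assms(1)])
  show "tscale \<sigma> l t z (ps \<sigma> l 0) ^ e (ps \<sigma> l 0) * tscale \<sigma> l t z (ps \<sigma> l 1) ^ e (ps \<sigma> l 1) *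
      (tscale \<sigma> l t z (qs \<sigma> l 0) ^ e (qs \<sigma> l 0) * tscale \<sigma> l t z (qs \<sigma> l 1) ^ e (qs \<sigma> l 1)) * t ^ pdeg \<sigma> l e =
    z (ps \<sigma> l 0) ^ e (ps \<sigma> l 0) * z (ps \<sigma> l 1) ^ e (ps \<sigma> l 1) *
      (z (qs \<sigma> l 0) ^ e (qs \<sigma> l 0) * z (qs \<sigma> l 1) ^ e (qs \<sigma> l 1)) * t ^ qdeg \<sigma> l e"
    using assms(2) unfolding pdeg_def qdeg_def
    by (simp add: tscale_ps tscale_qs power_divide power_mult_distrib power_add field_simps)
qed (simp add: tscale_ps tscale_qs)

lemma tscale_qmon:
  assumes "l < N" "J \<in> multi_idx N n"
  shows "qmon \<sigma> N n J (tscale \<sigma> l t z) = t ^ n * qmon \<sigma> N n J z"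
proof -
  have "J l \<le> n" using assms unfolding multi_idx_def by auto
  then have e: "t ^ n = t ^ (n - J l) * t ^ J l" by (simp add: power_add[symmetric])
  have "(\<Prod>l'<N. tscale \<sigma> l t z (qs \<sigma> l' 0) ^ (n - J l') * tscale \<sigma> l t z (qs \<sigma> l' 1) ^ J l') * 1 =
    (\<Prod>l'<N. z (qs \<sigma> l' 0) ^ (n - J l') * z (qs \<sigma> l' 1) ^ J l') * t ^ n"
    by (rule prod_single_factor[OF assms(1)]) (simp_all add: tscale_qs e power_mult_distrib mult_ac)
  then show ?thesis unfolding qmon_def by (simp add: mult.commute)
qed

lemma poly_eq_nonzero:
  fixes p q :: "complex poly"
  assumes "\<And>t. t \<noteq> 0 \<Longrightarrow> poly p t = poly q t"
  shows "p = q"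
proof (rule ccontr)
  assume "p \<noteq> q"
  then have "finite {t. poly (p - q) t = 0}" by (intro poly_roots_finite) simp
  moreover have "- {0} \<subseteq> {t. poly (p - q) t = 0}" using assms by auto
  ultimately have "finite (- {0::complex})" by (rule rev_finite_subset)
  then show False using infinite_UNIV_char_0[where 'a=complex] by (metis finite_compl finite.emptyI finite_insert)
qed

text \<open>A polynomial quotient of a function of weight \<open>n\<close> by an invariant function may be replaced by its
  component of weight \<open>n\<close>, one torus factor at a time.\<close>

lemma weight_component:
  assumes E: "E \<in> polyfun (4*N)" and FE: "\<And>z. z \<in> Xhat N \<Longrightarrow> F z = f z * E z"
    and Fw: "\<And>l t z. l < N \<Longrightarrow> t \<noteq> 0 \<Longrightarrow> z \<in> Xhat N \<Longrightarrow> F (tscale \<sigma> l t z) = t ^ n * F z"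
    and fw: "\<And>l t z. l < N \<Longrightarrow> t \<noteq> 0 \<Longrightarrow> z \<in> Xhat N \<Longrightarrow> f (tscale \<sigma> l t z) = f z"
  shows "\<exists>A c. finite A \<and> A \<subseteq> exps (4*N) \<and> (\<forall>e\<in>A. \<forall>l<N. qdeg \<sigma> l e = n + pdeg \<sigma> l e) \<and>
    (\<forall>z\<in>Xhat N. F z = f z * (\<Sum>e\<in>A. c e * mon (4*N) e z))"
proof -
  have "\<exists>A c. finite A \<and> A \<subseteq> exps (4*N) \<and> (\<forall>e\<in>A. \<forall>l<m. qdeg \<sigma> l e = n + pdeg \<sigma> l e) \<and>
    (\<forall>z\<in>Xhat N. F z = f z * (\<Sum>e\<in>A. c e * mon (4*N) e z))" if "m \<le> N" for m
    using that
  proof (induction m)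
    case 0
    obtain A c where A: "finite A" "A \<subseteq> exps (4*N)" "E = (\<lambda>z. \<Sum>e\<in>A. c e * mon (4*N) e z)"
      using polyfun_lcomb_mon[OF E] unfolding lcomb_def by blast
    then show ?case using FE by (intro exI[of _ A] exI[of _ c]) simp
  next
    case (Suc m)
    then obtain A c where A: "finite A" "A \<subseteq> exps (4*N)" "\<forall>e\<in>A. \<forall>l<m. qdeg \<sigma> l e = n + pdeg \<sigma> l e"
      and FA: "\<forall>z\<in>Xhat N. F z = f z * (\<Sum>e\<in>A. c e * mon (4*N) e z)" by auto
    have m: "m < N" using Suc.prems by simp
    \<comment> \<open>The factor \<open>t ^ D\<close> clears all negative powers of
      \<open>t\<close>. Both sides are then polynomials in \<open>t\<close>, and the component of
      weight \<open>n\<close> is the coefficient at \<open>n + D\<close>.\<close>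
    define D where "D = (\<Sum>e\<in>A. pdeg \<sigma> m e)"
    have D: "pdeg \<sigma> m e \<le> D" if "e \<in> A" for e unfolding D_def using A(1) that by (intro member_le_sum) auto
    define B where "B = {e \<in> A. qdeg \<sigma> m e = n + pdeg \<sigma> m e}"
    have "F z = f z * (\<Sum>e\<in>B. c e * mon (4*N) e z)" if z: "z \<in> Xhat N" for z
    proof -
      let ?P = "monom (F z) (n + D)"
      let ?Q = "\<Sum>e\<in>A. monom (f z * (c e * mon (4*N) e z)) (qdeg \<sigma> m e + (D - pdeg \<sigma> m e))"
      have "?P = ?Q"
      proof (rule poly_eq_nonzero)
        fix t :: complex assume t: "t \<noteq> 0"
        have scaled: "mon (4*N) e (tscale \<sigma> m t z) * t ^ D = mon (4*N) e z * t ^ (qdeg \<sigma> m e + (D - pdeg \<sigma> m e))" if "e \<in> A" for e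
        proof -
          have "t ^ D = t ^ pdeg \<sigma> m e * t ^ (D - pdeg \<sigma> m e)" using D[OF that] by (simp add: power_add[symmetric])
          then show ?thesis using tscale_mon[OF m t, of e \<sigma> z] by (simp add: power_add mult.assoc[symmetric])
        qed
        have "poly ?P t = t ^ n * F z * t ^ D" by (simp add: poly_monom power_add)
        also have "\<dots> = F (tscale \<sigma> m t z) * t ^ D" using Fw[OF m t z] by simp
        also have "\<dots> = f z * (\<Sum>e\<in>A. c e * mon (4*N) e (tscale \<sigma> m t z)) * t ^ D"
          using FA tscale_Xhat(1)[OF z t] fw[OF m t z] by simp
        also have "\<dots> = (\<Sum>e\<in>A. f z * (c e * (mon (4*N) e (tscale \<sigma> m t z) * t ^ D)))"
          by (simp add: sum_distrib_left sum_distrib_right mult_ac)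
        also have "\<dots> = (\<Sum>e\<in>A. f z * (c e * (mon (4*N) e z * t ^ (qdeg \<sigma> m e + (D - pdeg \<sigma> m e)))))"
          by (intro sum.cong refl) (simp only: scaled)
        also have "\<dots> = poly ?Q t" by (simp add: poly_sum poly_monom mult.assoc)
        finally show "poly ?P t = poly ?Q t" .
      qed
      then have "F z = coeff ?Q (n + D)" by (metis coeff_monom)
      also have "\<dots> = (\<Sum>e\<in>A. if e \<in> B then f z * (c e * mon (4*N) e z) else 0)"
        unfolding coeff_sum
      proof (rule sum.cong[OF refl])
        fix e assume e: "e \<in> A"
        have "(qdeg \<sigma> m e + (D - pdeg \<sigma> m e) = n + D) = (e \<in> B)" using D[OF e] e unfolding B_def by auto
        then show "coeff (monom (f z * (c e * mon (4*N) e z)) (qdeg \<sigma> m e + (D - pdeg \<sigma> m e))) (n + D) =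
          (if e \<in> B then f z * (c e * mon (4*N) e z) else 0)" by simp
      qed
      also have "\<dots> = (\<Sum>e\<in>B. f z * (c e * mon (4*N) e z))"
        using A(1) by (intro sum.mono_neutral_cong_right) (auto simp: B_def)
      finally show ?thesis by (simp add: sum_distrib_left)
    qed
    moreover have "finite B" "B \<subseteq> exps (4*N)" using A by (auto simp: B_def)
    moreover have "\<forall>e\<in>B. \<forall>l<Suc m. qdeg \<sigma> l e = n + pdeg \<sigma> l e" using A(3) by (auto simp: B_def less_Suc_eq)
    ultimately show ?case by (intro exI[of _ B] exI[of _ c]) simp
  qed
  from this[of N] show ?thesis by simp
qed

lemma proj_psqs:
  assumes "l < N" "a < 2" "b < 2"
  shows "\<exists>i<4*N. \<forall>z. proj True N z i = z (ps \<sigma> l a) * z (qs \<sigma> l b)"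
proof (cases "\<sigma> l")
  case True
  then show ?thesis using proj_cidx[OF assms, of True] cidx_less[OF assms, of True] unfolding ps_def qs_def
    by (intro exI[of _ "cidx True l a b"]) auto
next
  case False
  then show ?thesis using proj_cidx[OF assms(1,3,2), of True] cidx_less[OF assms(1,3,2), of True] unfolding ps_def qs_def
    by (intro exI[of _ "cidx True l b a"]) (auto simp: mult.commute)
qed

text \<open>Each factor from \<open>ps\<close> is paired with one from \<open>qs\<close> to an entry
  of the matrix of the block; exactly \<open>n\<close> factors from \<open>qs\<close>
  remain.\<close>

lemma block_weight:
  assumes l: "l < N"
  shows "c + d = n + (a + b) \<Longrightarrow> \<exists>r\<in>polyfun (4*N). \<exists>j\<le>n. \<forall>z.
    (z (ps \<sigma> l 0) ^ a * z (ps \<sigma> l 1) ^ b) * (z (qs \<sigma> l 0) ^ c * z (qs \<sigma> l 1) ^ d) =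
    r (proj True N z) * (z (qs \<sigma> l 0) ^ (n - j) * z (qs \<sigma> l 1) ^ j)"
proof (induction "a + b" arbitrary: a b c d)
  case 0
  then have "a = 0" "b = 0" "c = n - d" "d \<le> n" by auto
  then show ?case by (intro bexI[of _ "\<lambda>_. 1"] exI[of _ d]) (auto intro: pf_const)
next
  case (Suc k)
  obtain s a' b' where s: "s < 2" "a' + b' = k" "\<And>z :: nat \<Rightarrow> complex. z (ps \<sigma> l 0) ^ a * z (ps \<sigma> l 1) ^ b = z (ps \<sigma> l s) * (z (ps \<sigma> l 0) ^ a' * z (ps \<sigma> l 1) ^ b')"
  proof (cases a)
    case 0
    then have "b = Suc k" using Suc.hyps(2) by simp
    then show ?thesis using 0 by (intro that[of 1 0 k]) auto
  next
    case (Suc a')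
    then show ?thesis using Suc.hyps(2) \<open>Suc k = a + b\<close> by (intro that[of 0 a' b]) auto
  qed
  have cd: "0 < c + d" using Suc.prems Suc.hyps(2) by linarith
  obtain s' c' d' where s': "s' < 2" "Suc (c' + d') = c + d" "\<And>z :: nat \<Rightarrow> complex. z (qs \<sigma> l 0) ^ c * z (qs \<sigma> l 1) ^ d = z (qs \<sigma> l s') * (z (qs \<sigma> l 0) ^ c' * z (qs \<sigma> l 1) ^ d')"
  proof (cases c)
    case 0
    then obtain d' where "d = Suc d'" using cd by (cases d) auto
    then show ?thesis using 0 by (intro that[of 1 0 d']) auto
  next
    case (Suc c')
    then show ?thesis by (intro that[of 0 c' d]) auto
  qed
  obtain i where i: "i < 4*N" "\<forall>z. proj True N z i = z (ps \<sigma> l s) * z (qs \<sigma> l s')"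
    using proj_psqs[OF l s(1) s'(1)] by blast
  have "c' + d' = n + (a' + b')" using s(2) s'(2) Suc.prems Suc.hyps(2) by simp
  then obtain r j where r: "r \<in> polyfun (4*N)" "j \<le> n" "\<forall>z.
    (z (ps \<sigma> l 0) ^ a' * z (ps \<sigma> l 1) ^ b') * (z (qs \<sigma> l 0) ^ c' * z (qs \<sigma> l 1) ^ d') =
    r (proj True N z) * (z (qs \<sigma> l 0) ^ (n - j) * z (qs \<sigma> l 1) ^ j)"
    using Suc.hyps(1)[of a' b' c' d'] s(2) by auto
  have "(z (ps \<sigma> l 0) ^ a * z (ps \<sigma> l 1) ^ b) * (z (qs \<sigma> l 0) ^ c * z (qs \<sigma> l 1) ^ d) =
    (proj True N z i * r (proj True N z)) * (z (qs \<sigma> l 0) ^ (n - j) * z (qs \<sigma> l 1) ^ j)" for z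
  proof -
    have "(z (ps \<sigma> l 0) ^ a * z (ps \<sigma> l 1) ^ b) * (z (qs \<sigma> l 0) ^ c * z (qs \<sigma> l 1) ^ d) =
      (z (ps \<sigma> l s) * z (qs \<sigma> l s')) * ((z (ps \<sigma> l 0) ^ a' * z (ps \<sigma> l 1) ^ b') * (z (qs \<sigma> l 0) ^ c' * z (qs \<sigma> l 1) ^ d'))"
      unfolding s(3) s'(3) by (simp only: mult_ac)
    also have "\<dots> = proj True N z i * (r (proj True N z) * (z (qs \<sigma> l 0) ^ (n - j) * z (qs \<sigma> l 1) ^ j))"
      by (simp only: i(2) r(3))
    finally show ?thesis by (simp only: mult.assoc)
  qed
  then show ?case using r(1,2) i(1)
    by (intro bexI[of _ "\<lambda>x. x i * r x"] exI[of _ j]) (auto intro: pf_mult pf_var)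
qed

lemma mon_weight:
  assumes "\<And>l. l < N \<Longrightarrow> qdeg \<sigma> l e = n + pdeg \<sigma> l e"
  shows "\<exists>r\<in>polyfun (4*N). \<exists>J\<in>multi_idx N n. \<forall>z. mon (4*N) e z = r (proj True N z) * qmon \<sigma> N n J z"
proof -
  have "\<exists>r j. l < N \<longrightarrow> r \<in> polyfun (4*N) \<and> j \<le> n \<and> (\<forall>z.
    (z (ps \<sigma> l 0) ^ e (ps \<sigma> l 0) * z (ps \<sigma> l 1) ^ e (ps \<sigma> l 1)) * (z (qs \<sigma> l 0) ^ e (qs \<sigma> l 0) * z (qs \<sigma> l 1) ^ e (qs \<sigma> l 1)) =
    r (proj True N z) * (z (qs \<sigma> l 0) ^ (n - j) * z (qs \<sigma> l 1) ^ j))" for l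
    using block_weight[of l N "e (qs \<sigma> l 0)" "e (qs \<sigma> l 1)" n "e (ps \<sigma> l 0)" "e (ps \<sigma> l 1)" \<sigma>] assms[of l]
    unfolding pdeg_def qdeg_def by blast
  then obtain r j where rj: "\<And>l. l < N \<Longrightarrow> r l \<in> polyfun (4*N) \<and> j l \<le> n \<and> (\<forall>z.
    (z (ps \<sigma> l 0) ^ e (ps \<sigma> l 0) * z (ps \<sigma> l 1) ^ e (ps \<sigma> l 1)) * (z (qs \<sigma> l 0) ^ e (qs \<sigma> l 0) * z (qs \<sigma> l 1) ^ e (qs \<sigma> l 1)) =
    r l (proj True N z) * (z (qs \<sigma> l 0) ^ (n - j l) * z (qs \<sigma> l 1) ^ j l))" by metis
  define J where "J l = (if l < N then j l else 0)" for l
  have J: "J \<in> multi_idx N n" unfolding multi_idx_def J_def using rj by auto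
  have r: "(\<lambda>x. \<Prod>l<N. r l x) \<in> polyfun (4*N)" using rj by (intro polyfun_prod) auto
  have "mon (4*N) e z = (\<Prod>l<N. r l (proj True N z)) * qmon \<sigma> N n J z" for z
    unfolding mon_blocks[where \<sigma>=\<sigma>] qmon_def prod.distrib[symmetric]
    by (rule prod.cong[OF refl]) (simp only: J_def lessThan_iff if_True rj)
  then show ?thesis by (intro bexI[OF _ r] bexI[OF _ J] allI)
qed

text \<open>A converse of \<open>kron_proj\<close>: functions of weight \<open>n\<close>, multiplied
  by the vector of the \<open>pmon\<close>, come from M. Their monomials are grouped by the
  remaining \<open>qmon\<close>.\<close>

lemma Mmod_of_weight:
  assumes A: "finite A" "\<And>e l. e \<in> A \<Longrightarrow> l < N \<Longrightarrow> qdeg \<sigma> l e = n + pdeg \<sigma> l e"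
  shows "\<exists>m\<in>Mmod N n \<sigma>. \<forall>z. \<forall>I\<in>multi_idx N n. m (proj True N z) I = pmon \<sigma> N n I z * (\<Sum>e\<in>A. c e * mon (4*N) e z)"
proof -
  have "\<exists>r J. e \<in> A \<longrightarrow> r \<in> polyfun (4*N) \<and> J \<in> multi_idx N n \<and> (\<forall>z. mon (4*N) e z = r (proj True N z) * qmon \<sigma> N n J z)" for e
    using mon_weight[of N \<sigma> e n] A(2) by blast
  then obtain r J where rJ: "\<And>e. e \<in> A \<Longrightarrow> r e \<in> polyfun (4*N) \<and> J e \<in> multi_idx N n \<and>
      (\<forall>z. mon (4*N) e z = r e (proj True N z) * qmon \<sigma> N n (J e) z)" by metis
  define R where "R K x = (\<Sum>e\<in>A. if J e = K then c e * r e x else 0)" for K x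
  have "R K \<in> polyfun (4*N)" for K
    unfolding R_def[abs_def]
  proof (rule polyfun_sum)
    fix e assume "e \<in> A"
    then show "(\<lambda>x. if J e = K then c e * r e x else 0) \<in> polyfun (4*N)"
      using rJ by (cases "J e = K") (auto intro: polyfun_intros)
  qed
  then have "(\<lambda>x I. \<Sum>K\<in>multi_idx N n. R K x * kron N n \<sigma> x I K) \<in> Mmod N n \<sigma>" unfolding Mmod_def by (intro CollectI exI[of _ R]) simp
  moreover have "(\<Sum>K\<in>multi_idx N n. R K (proj True N z) * kron N n \<sigma> (proj True N z) I K) =
      pmon \<sigma> N n I z * (\<Sum>e\<in>A. c e * mon (4*N) e z)" if I: "I \<in> multi_idx N n" for z I
  proof -
    let ?x = "proj True N z"
    have "(\<Sum>K\<in>multi_idx N n. R K ?x * kron N n \<sigma> ?x I K) =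
      (\<Sum>K\<in>multi_idx N n. \<Sum>e\<in>A. if J e = K then c e * r e ?x * kron N n \<sigma> ?x I K else 0)"
      unfolding R_def sum_distrib_right by (intro sum.cong refl) simp
    also have "\<dots> = (\<Sum>e\<in>A. \<Sum>K\<in>multi_idx N n. if J e = K then c e * r e ?x * kron N n \<sigma> ?x I K else 0)"
      by (rule sum.swap)
    also have "\<dots> = (\<Sum>e\<in>A. c e * r e ?x * kron N n \<sigma> ?x I (J e))"
      using rJ finite_multi_idx by (intro sum.cong refl) simp
    also have "\<dots> = (\<Sum>e\<in>A. pmon \<sigma> N n I z * (c e * mon (4*N) e z))"
    proof (rule sum.cong[OF refl])
      fix e assume e: "e \<in> A"
      have "kron N n \<sigma> ?x I (J e) = pmon \<sigma> N n I z * qmon \<sigma> N n (J e) z" using rJ[OF e] I by (intro kron_proj) auto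
      moreover have "mon (4*N) e z = r e ?x * qmon \<sigma> N n (J e) z" using rJ[OF e] by blast
      ultimately show "c e * r e ?x * kron N n \<sigma> ?x I (J e) = pmon \<sigma> N n I z * (c e * mon (4*N) e z)" by (simp only: mult_ac)
    qed
    finally show ?thesis by (simp only: sum_distrib_left)
  qed
  ultimately show ?thesis by (intro bexI[of _ "\<lambda>x I. \<Sum>K\<in>multi_idx N n. R K x * kron N n \<sigma> x I K"]) auto
qed

section \<open>Extension of sections\<close>

text \<open>\<open>swp False\<close> exchanges \<open>\<lambda>\<close> and \<open>\<mu>\<close>. The transposed charts thereby supply the minor of
  \<open>\<mu>\<close>, which together with the minor \<open>cr 1 0\<close> of \<open>\<lambda>\<close> is a regular pair.\<close>

definition swp :: "bool \<Rightarrow> (nat \<Rightarrow> complex) \<Rightarrow> nat \<Rightarrow> complex" where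
  "swp \<tau> z j = (if \<tau> then z j else z (4*(j div 4) + (j mod 4 + 2) mod 4))"

lemma swp_True: "swp True z = z"
  unfolding swp_def by simp

lemma swp_lam: "r < 2 \<Longrightarrow> swp \<tau> z (4*l+r) = z (4*l + (if \<tau> then r else 2+r))"
  unfolding swp_def using block_divmod[of r l] by (simp add: add.commute)

lemma swp_mu: "r < 2 \<Longrightarrow> swp \<tau> z (4*l+(2+r)) = z (4*l + (if \<tau> then 2+r else r))"
proof -
  assume r: "r < 2"
  then have "(2+r+2) mod 4 = r" by presburger
  moreover have "(4*l+(2+r)) div 4 = l" "(4*l+(2+r)) mod 4 = 2+r" using block_divmod[of "2+r" l] r by auto
  ultimately show ?thesis unfolding swp_def by simp
qed

lemma polyfun_swp: "l < N \<Longrightarrow> r < 4 \<Longrightarrow> (\<lambda>z. swp \<tau> z (4*l+r)) \<in> polyfun (4*N)"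
proof -
  assume l: "l < N" and r: "r < 4"
  have "4*((4*l+r) div 4) + ((4*l+r) mod 4 + 2) mod 4 < 4*N"
    unfolding block_divmod[OF r] using l by (intro block_less) auto
  then show ?thesis using block_less[OF l r] unfolding swp_def by (cases \<tau>) (simp_all add: pf_var)
qed

lemma proj_swp: "proj \<tau> N (swp \<tau> z) = proj True N z"
proof (cases \<tau>)
  case True
  then show ?thesis by (simp add: swp_True)
next
  case False
  have "proj False N (swp False z) j = proj True N z j" for j
  proof (cases "j < 4*N")
    case True
    then obtain l \<alpha> \<beta> where *: "l < N" "\<alpha> < 2" "\<beta> < 2" "j = cidx True l \<alpha> \<beta>" by (rule cidx_cases)
    have "cidx True l \<alpha> \<beta> = cidx False l \<beta> \<alpha>" unfolding cidx_def by simp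
    then have "proj False N (swp False z) j = swp False z (4*l+\<beta>) * swp False z (4*l+(2+\<alpha>))"
      using proj_cidx[OF *(1,3,2), of False "swp False z"] *(4) by simp
    then show ?thesis unfolding *(4) proj_cidx[OF *(1-3)] swp_lam[OF *(3)] swp_mu[OF *(2)] by (simp add: mult.commute)
  qed (simp add: proj_ge)
  then show ?thesis using False by auto
qed

lemma swp_ps:
  assumes "\<alpha> < 2" "\<beta> < 2"
  shows "z (ps \<sigma> l (if \<sigma> l = \<tau> then \<alpha> else \<beta>)) = (if \<sigma> l = \<tau> then swp \<tau> z (4*l+\<alpha>) else swp \<tau> z (4*l+(2+\<beta>)))"
  unfolding ps_def swp_lam[OF assms(1)] swp_mu[OF assms(2)] by auto

lemma prod_split2:
  assumes "2 \<le> N"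
  shows "(\<Prod>l<N. g l) = g 0 * g 1 * (\<Prod>l\<in>{2..<N}. g (l::nat) :: complex)"
proof -
  have "{..<N} = {0,1} \<union> {2..<N}" using assms by auto
  then show ?thesis by (simp add: prod.union_disjoint)
qed

text \<open>By \<open>kron_proj\<close> the element \<open>m0\<close> is the vector of the
  \<open>pmon\<close> times one function \<open>F\<close>. It suffices to make \<open>F / f\<close>
  polynomial on \<open>Xhat N\<close>, to take the component of weight \<open>n\<close>, and to
  return to M.\<close>

lemma Mmod_extension:
  assumes N: "4 \<le> N" and Y: "zariski_closed N Y" "codim_ge2 N Y"
    and f0: "f0 \<in> polyfun (4*N)" "x0 \<in> Xvar N" "f0 x0 \<noteq> 0" and m0: "m0 \<in> Mmod N n \<sigma>"
    and ext: "\<And>I g. I \<in> multi_idx N n \<Longrightarrow> g \<in> polyfun (4*N) \<Longrightarrow> (\<forall>x\<in>Y. g x = 0) \<Longrightarrow>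
      \<exists>k. \<exists>p\<in>polyfun (4*N). \<forall>x\<in>Xvar N. g x ^ k * m0 x I = f0 x * p x"
  shows "\<exists>m\<in>Mmod N n \<sigma>. \<forall>x\<in>Xvar N. \<forall>I\<in>multi_idx N n. m0 x I = f0 x * m x I"
proof -
  have N2: "2 \<le> N" using N by simp
  obtain r0 where r0: "\<forall>J\<in>multi_idx N n. r0 J \<in> polyfun (4*N)"
    "m0 = (\<lambda>x I. \<Sum>J\<in>multi_idx N n. r0 J x * kron N n \<sigma> x I J)" using m0 unfolding Mmod_def by blast
  define F where "F z = (\<Sum>J\<in>multi_idx N n. r0 J (proj True N z) * qmon \<sigma> N n J z)" for z
  define f where "f z = f0 (proj True N z)" for z
  have m0F: "m0 (proj True N z) I = pmon \<sigma> N n I z * F z" if I: "I \<in> multi_idx N n" for z I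
    unfolding r0(2) F_def sum_distrib_left
    by (intro sum.cong refl) (simp add: kron_proj[OF I] mult_ac)
  have FP: "F \<in> polyfun (4*N)"
    unfolding F_def[abs_def] using r0(1) by (intro polyfun_sum pf_mult pull_proj polyfun_qmon) auto
  have fP: "f \<in> polyfun (4*N)" unfolding f_def[abs_def] by (rule pull_proj[OF f0(1)])
  have fnz: "\<exists>z\<in>Xhat N. f z \<noteq> 0" using proj_onto[OF f0(2), of True] f0(3) unfolding f_def by auto
  interpret fraction_on_Xhat N F f by unfold_locales (rule N FP fP fnz)+
  have key: "\<exists>K. Dv (\<lambda>z. cr 1 0 (swp \<tau> z) ^ K * (\<Prod>l<N. swp \<tau> z (4*l+\<alpha> l) * swp \<tau> z (4*l+(2+\<beta> l))) ^ K)"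
    if al: "\<And>l. \<alpha> l < 2" and be: "\<And>l. \<beta> l < (2::nat)" for \<tau> \<alpha> \<beta>
  proof -
    interpret c: chart N "N + 2*(N-2)" "\<lambda>y. proj \<tau> N (Psi N (gauge N \<alpha> y))" "hfun \<tau> N \<alpha> \<beta>" "ufun \<tau> N \<alpha> \<beta>"
      by (rule chart_gauge[OF N al be])
    \<comment> \<open>An extreme multi-index: it makes \<open>pmon\<close> a product of powers of
      coordinates that already occur in the chart denominator.\<close>
    define I where "I l = (if l < N \<and> (if \<sigma> l = \<tau> then \<alpha> l else \<beta> l) = 1 then n else 0)" for l
    have I: "I \<in> multi_idx N n" unfolding multi_idx_def I_def by auto
    obtain k p where p: "p \<in> polyfun (4*N)" "\<forall>x\<in>Xvar N. hfun \<tau> N \<alpha> \<beta> x ^ k * m0 x I = f0 x * p x"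
      using c.hartogs[OF Y f0 Mmod_polyfun[OF m0, of I] ext[OF I]] by blast
    define a where "a l z = swp \<tau> z (4*l+\<alpha> l)" for l z
    define b where "b l z = swp \<tau> z (4*l+(2+\<beta> l))" for l z
    have aP: "a l \<in> polyfun (4*N)" if "l < N" for l unfolding a_def[abs_def] using al[of l] that by (intro polyfun_swp) auto
    have bP: "b l \<in> polyfun (4*N)" if "l < N" for l unfolding b_def[abs_def] using be[of l] that by (intro polyfun_swp) auto
    have cP: "(\<lambda>z. cr 1 0 (swp \<tau> z)) \<in> polyfun (4*N)"
      unfolding cr_def using N polyfun_swp[of 1 N 0 \<tau>] polyfun_swp[of 1 N 1 \<tau>] polyfun_swp[of 0 N 0 \<tau>] polyfun_swp[of 0 N 1 \<tau>]
      by (intro polyfun_diff pf_mult) auto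
    have hz: "hfun \<tau> N \<alpha> \<beta> (proj True N z) = b 0 z * b 1 z * cr 1 0 (swp \<tau> z) * (\<Prod>l<N. a l z * b l z)" for z
      using hfun_proj[OF N al be, where \<tau>=\<tau> and z="swp \<tau> z"] unfolding proj_swp a_def b_def .
    have pz: "pmon \<sigma> N n I z = (\<Prod>l<N. (if \<sigma> l = \<tau> then a l z else b l z) ^ n)" for z
      unfolding pmon_def
    proof (rule prod.cong[OF refl])
      fix l assume "l \<in> {..<N}"
      let ?\<gamma> = "if \<sigma> l = \<tau> then \<alpha> l else \<beta> l"
      have "?\<gamma> = 0 \<or> ?\<gamma> = 1" using less_2_zero_one[OF al[of l]] less_2_zero_one[OF be[of l]] by auto
      then have "z (ps \<sigma> l 0) ^ (n - I l) * z (ps \<sigma> l 1) ^ I l = z (ps \<sigma> l ?\<gamma>) ^ n"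
        using \<open>l \<in> {..<N}\<close> unfolding I_def by (elim disjE) (simp_all only: lessThan_iff simp_thms if_True if_False zero_neq_one diff_zero diff_self_eq_0 power_0 mult_1_left mult_1_right)
      then show "z (ps \<sigma> l 0) ^ (n - I l) * z (ps \<sigma> l 1) ^ I l = (if \<sigma> l = \<tau> then a l z else b l z) ^ n"
        unfolding swp_ps[OF al be] a_def b_def .
    qed
    have D1: "Dv (\<lambda>z. hfun \<tau> N \<alpha> \<beta> (proj True N z) ^ k * pmon \<sigma> N n I z)"
      unfolding Dv_def
    proof (intro bexI[of _ "\<lambda>z. p (proj True N z)"] ballI pull_proj p)
      fix z assume "z \<in> Xhat N"
      then show "hfun \<tau> N \<alpha> \<beta> (proj True N z) ^ k * pmon \<sigma> N n I z * F z = f z * p (proj True N z)"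
        using p(2) proj_Xvar[of z N True] m0F[OF I, of z] unfolding f_def by (metis mult.assoc)
    qed
    \<comment> \<open>\<open>W\<close> supplies the missing factors, so that the product with the
      denominator from \<open>D1\<close> is a power of the minor and of all chosen coordinates with
      the common exponent \<open>2*k+n\<close>.\<close>
    define W where "W z = cr 1 0 (swp \<tau> z) ^ (k+n) * (a 0 z * a 1 z * (\<Prod>l\<in>{2..<N}. a l z * b l z)) ^ k *
      (\<Prod>l<N. (if \<sigma> l = \<tau> then b l z else a l z) ^ n)" for z
    have WP: "W \<in> polyfun (4*N)"
    proof -
      have o: "(\<lambda>z. if \<sigma> l = \<tau> then b l z else a l z) \<in> polyfun (4*N)" if "l < N" for l
        using aP[OF that] bP[OF that] by (cases "\<sigma> l = \<tau>") simp_all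
      show ?thesis unfolding W_def[abs_def] using N aP bP cP o by (intro pf_mult polyfun_power polyfun_prod) auto
    qed
    have "cr 1 0 (swp \<tau> z) ^ (2*k+n) * (\<Prod>l<N. a l z * b l z) ^ (2*k+n) =
      W z * (hfun \<tau> N \<alpha> \<beta> (proj True N z) ^ k * pmon \<sigma> N n I z)" for z
    proof -
      let ?c = "cr 1 0 (swp \<tau> z)" and ?P = "\<Prod>l<N. a l z * b l z"
      let ?R = "\<Prod>l\<in>{2..<N}. a l z * b l z"
      let ?g = "\<Prod>l<N. (if \<sigma> l = \<tau> then a l z else b l z) ^ n" and ?o = "\<Prod>l<N. (if \<sigma> l = \<tau> then b l z else a l z) ^ n"
      have "?P ^ n = ?g * ?o"
        unfolding prod_power_distrib[symmetric] prod.distrib[symmetric] power_mult_distrib[symmetric]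
        by (intro arg_cong[where f="\<lambda>x. x ^ n"] prod.cong) auto
      moreover have "?P = (b 0 z * b 1 z) * (a 0 z * a 1 z * ?R)" unfolding prod_split2[OF N2] by (simp only: mult_ac)
      then have "?P ^ k = (b 0 z * b 1 z) ^ k * (a 0 z * a 1 z * ?R) ^ k" by (simp only: power_mult_distrib)
      moreover have "?P ^ (2*k+n) = ?P ^ k * ?P ^ k * ?P ^ n" by (simp add: power_add mult_2)
      moreover have "?c ^ (2*k+n) = ?c ^ (k+n) * ?c ^ k" by (simp add: power_add mult_2)
      ultimately have "?c ^ (2*k+n) * ?P ^ (2*k+n) =
        ?c ^ (k+n) * ?c ^ k * ((b 0 z * b 1 z) ^ k * (a 0 z * a 1 z * ?R) ^ k * ?P ^ k * (?g * ?o))" by simp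
      also have "\<dots> = W z * ((b 0 z * b 1 z * ?c * ?P) ^ k * ?g)"
        unfolding W_def power_mult_distrib[of "b 0 z * b 1 z * ?c" ?P] power_mult_distrib[of "b 0 z * b 1 z" ?c]
        by (simp only: mult_ac)
      finally show ?thesis unfolding hz pz .
    qed
    then show ?thesis using Dv_mult[OF D1 WP] unfolding a_def b_def by (intro exI[of _ "2*k+n"]) simp
  qed
  have c: "cr 1 0 \<in> polyfun (4*N)" using N by (intro polyfun_cr) auto
  have mP: "minor_mu \<in> polyfun (4*N)" unfolding minor_mu_def[abs_def] using N by (intro polyfun_intros) auto
  obtain K1 where K1: "Dv (\<lambda>z. cr 1 0 z ^ K1)"
    using Dv_cancel_coords[OF c] key[where \<tau>=True] unfolding swp_True by blast
  have minor: "cr 1 0 (swp False z) = - minor_mu z" for z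
    unfolding cr_def minor_mu_def using swp_lam[of 0 False z 1] swp_lam[of 1 False z 1] swp_lam[of 0 False z 0] swp_lam[of 1 False z 0]
    by (simp add: numeral_3_eq_3 numeral_2_eq_2)
  have "\<exists>K. Dv (\<lambda>z. (- minor_mu z) ^ K)"
  proof (rule Dv_cancel_coords[OF polyfun_uminus[OF mP]])
    fix \<alpha> \<beta> :: "nat \<Rightarrow> nat" assume ab: "\<And>l. \<alpha> l < 2" "\<And>l. \<beta> l < 2"
    \<comment> \<open>The choices for \<lambda> and \<mu> are interchanged because the transposed
      chart reads them on the swapped spinors.\<close>
    obtain K where "Dv (\<lambda>z. cr 1 0 (swp False z) ^ K * (\<Prod>l<N. swp False z (4*l+\<beta> l) * swp False z (4*l+(2+\<alpha> l))) ^ K)"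
      using key[where \<alpha>=\<beta> and \<beta>=\<alpha> and \<tau>=False] ab by blast
    moreover have "swp False z (4*l+\<beta> l) * swp False z (4*l+(2+\<alpha> l)) = z (4*l+\<alpha> l) * z (4*l+(2+\<beta> l))" for z l
      using swp_lam[OF ab(2), of False z l] swp_mu[OF ab(1), of False z l] by simp
    ultimately show "\<exists>K. Dv (\<lambda>z. (- minor_mu z) ^ K * (\<Prod>l<N. z (4*l+\<alpha> l) * z (4*l+(2+\<beta> l))) ^ K)"
      unfolding minor by auto
  qed
  then obtain K2 where "Dv (\<lambda>z. (- minor_mu z) ^ K2)" by blast
  from Dv_mult[OF this pf_const[of "(-1) ^ K2"]] have K2: "Dv (\<lambda>z. minor_mu z ^ K2)"
    by (simp add: power_mult_distrib[symmetric])
  \<comment> \<open>The powers of the two minors cancel each other, so \<open>F / f\<close> has no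
    denominator left.\<close>
  have "Dv (\<lambda>z. 1)"
    by (rule Dv_cancel_power[OF regular_pair_minors[OF N] c mP Xhat_cr_nonzero pf_const])
      (use K1 K2 in simp_all)
  then obtain E where E: "E \<in> polyfun (4*N)" "\<And>z. z \<in> Xhat N \<Longrightarrow> F z = f z * E z" unfolding Dv_def by auto
  have "\<exists>A c. finite A \<and> A \<subseteq> exps (4*N) \<and> (\<forall>e\<in>A. \<forall>l<N. qdeg \<sigma> l e = n + pdeg \<sigma> l e) \<and>
    (\<forall>z\<in>Xhat N. F z = f z * (\<Sum>e\<in>A. c e * mon (4*N) e z))"
  proof (rule weight_component[OF E])
    fix l and t :: complex and z assume l: "l < N" "t \<noteq> 0" "z \<in> Xhat N"
    show "f (tscale \<sigma> l t z) = f z" unfolding f_def tscale_Xhat(2)[OF l(3,2)] ..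
    show "F (tscale \<sigma> l t z) = t ^ n * F z"
      unfolding F_def tscale_Xhat(2)[OF l(3,2)] sum_distrib_left
      by (intro sum.cong refl) (simp add: tscale_qmon[OF l(1)] mult_ac)
  qed
  then obtain A c where A: "finite A" "\<And>e l. e \<in> A \<Longrightarrow> l < N \<Longrightarrow> qdeg \<sigma> l e = n + pdeg \<sigma> l e"
    and FA: "\<forall>z\<in>Xhat N. F z = f z * (\<Sum>e\<in>A. c e * mon (4*N) e z)" by blast
  obtain m where m: "m \<in> Mmod N n \<sigma>"
    "\<forall>z. \<forall>I\<in>multi_idx N n. m (proj True N z) I = pmon \<sigma> N n I z * (\<Sum>e\<in>A. c e * mon (4*N) e z)"
    using Mmod_of_weight[OF A] by blast
  have "m0 x I = f0 x * m x I" if x: "x \<in> Xvar N" and I: "I \<in> multi_idx N n" for x I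
  proof -
    obtain z where z: "z \<in> Xhat N" "x = proj True N z" using proj_onto[OF x] by blast
    have "m0 x I = pmon \<sigma> N n I z * (f z * (\<Sum>e\<in>A. c e * mon (4*N) e z))"
      unfolding z(2) m0F[OF I] using FA z(1) by simp
    also have "\<dots> = f0 x * m x I" using m(2) I unfolding z(2) f_def by (simp add: mult_ac)
    finally show ?thesis .
  qed
  then show ?thesis using m(1) by blast
qed

theorem mainTheorem17:
  fixes N n :: nat and \<sigma> :: "nat \<Rightarrow> bool" and Y :: "(nat \<Rightarrow> complex) set"
  assumes "N \<ge> 4"
    and "zariski_closed N Y"
    and "codim_ge2 N Y"
  shows "(\<forall>m1\<in>Mmod N n \<sigma>. \<forall>m2\<in>Mmod N n \<sigma>.
            (\<forall>x\<in>Xvar N - Y. \<forall>I\<in>multi_idx N n. m1 x I = m2 x I) \<longrightarrow>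
            (\<forall>x\<in>Xvar N. \<forall>I\<in>multi_idx N n. m1 x I = m2 x I))
       \<and> (\<forall>s. is_section N n \<sigma> (Xvar N - Y) s \<longrightarrow>
            (\<exists>m\<in>Mmod N n \<sigma>. \<forall>x\<in>Xvar N - Y. \<forall>I\<in>multi_idx N n. s x I = m x I))"
proof -
  have irr: "irreducible_closed N (Xvar N)" by (rule Xvar_irreducible[OF assms(1)])
  \<comment> \<open>No closed set is larger than X, so X violates the chain condition and cannot lie
    in \<open>Y\<close>. Hence some \<open>f0\<close> vanishes on \<open>Y\<close> but not on
    X.\<close>
  have "\<not> Xvar N \<subseteq> Y"
  proof
    assume "Xvar N \<subseteq> Y"
    then have "\<exists>Z1 Z2. irreducible_closed N Z1 \<and> irreducible_closed N Z2 \<and> Xvar N \<subset> Z1 \<and> Z1 \<subset> Z2"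
      using assms(3)[unfolded codim_ge2_def, rule_format, of "Xvar N"] irr by simp
    then obtain Z1 where "irreducible_closed N Z1" "Xvar N \<subset> Z1" by (elim exE conjE)
    then show False using zariski_closed_subset[of N Z1] unfolding irreducible_closed_def by blast
  qed
  then obtain x0 where x0: "x0 \<in> Xvar N" "x0 \<notin> Y" by blast
  obtain f0 where f0: "f0 \<in> polyfun (4*N)" "\<forall>x\<in>Y. f0 x = 0" "f0 x0 \<noteq> 0"
    using zariski_closed_separate[OF assms(2) x0] by blast
  have cancel: "q x = 0" if g: "g \<in> polyfun (4*N)" "x1 \<in> Xvar N" "g x1 \<noteq> 0" and q: "q \<in> polyfun (4*N)"
    "\<And>x. x \<in> Xvar N \<Longrightarrow> g x \<noteq> 0 \<Longrightarrow> q x = 0" and x: "x \<in> Xvar N" for g x1 q x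
  proof -
    have "g y * q y = 0" if "y \<in> Xvar N" for y using q(2)[OF that] by (cases "g y = 0") simp_all
    from irreducible_closed_prime[OF irr g(1) q(1) this] show ?thesis
    proof
      assume "\<forall>x\<in>Xvar N. g x = 0"
      with g(2,3) show ?thesis by simp
    next
      assume "\<forall>x\<in>Xvar N. q x = 0"
      with x show ?thesis by simp
    qed
  qed
  show ?thesis
  proof (intro conjI ballI allI)
    fix m1 m2 assume m: "m1 \<in> Mmod N n \<sigma>" "m2 \<in> Mmod N n \<sigma>"
    show "(\<forall>x\<in>Xvar N - Y. \<forall>I\<in>multi_idx N n. m1 x I = m2 x I) \<longrightarrow>
      (\<forall>x\<in>Xvar N. \<forall>I\<in>multi_idx N n. m1 x I = m2 x I)"
    proof (intro impI ballI)
      fix x I assume eq: "\<forall>x\<in>Xvar N - Y. \<forall>I\<in>multi_idx N n. m1 x I = m2 x I"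
        and x: "x \<in> Xvar N" and I: "I \<in> multi_idx N n"
      have "m1 x I - m2 x I = 0"
      proof (rule cancel[OF f0(1) x0(1) f0(3) _ _ x])
        show "(\<lambda>x. m1 x I - m2 x I) \<in> polyfun (4*N)"
          by (rule polyfun_diff[OF Mmod_polyfun[OF m(1)] Mmod_polyfun[OF m(2)]])
        fix x assume x: "x \<in> Xvar N" "f0 x \<noteq> 0"
        with f0(2) have "x \<in> Xvar N - Y" by blast
        from eq[rule_format, OF this I] show "m1 x I - m2 x I = 0" by simp
      qed
      then show "m1 x I = m2 x I" by simp
    qed
  next
    fix s
    show "is_section N n \<sigma> (Xvar N - Y) s \<longrightarrow>
      (\<exists>m\<in>Mmod N n \<sigma>. \<forall>x\<in>Xvar N - Y. \<forall>I\<in>multi_idx N n. s x I = m x I)"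
    proof
      assume s: "is_section N n \<sigma> (Xvar N - Y) s"
      have sec: "\<exists>m\<in>Mmod N n \<sigma>. \<exists>k. \<forall>x\<in>Xvar N. f x \<noteq> 0 \<longrightarrow> (\<forall>I\<in>multi_idx N n. s x I = m x I / f x ^ k)"
        if "f \<in> polyfun (4*N)" "\<forall>x\<in>Y. f x = 0" for f
      proof -
        have "{x \<in> Xvar N. f x \<noteq> 0} \<subseteq> Xvar N - Y" using that(2) by auto
        then show ?thesis using s that(1) unfolding is_section_def by blast
      qed
      obtain m0 k where m0: "m0 \<in> Mmod N n \<sigma>"
        and sm0: "\<And>x I. x \<in> Xvar N \<Longrightarrow> f0 x \<noteq> 0 \<Longrightarrow> I \<in> multi_idx N n \<Longrightarrow> s x I = m0 x I / f0 x ^ k"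
        using sec[OF f0(1,2)] by blast
      have "\<exists>m\<in>Mmod N n \<sigma>. \<forall>x\<in>Xvar N. \<forall>I\<in>multi_idx N n. m0 x I = f0 x ^ k * m x I"
      proof (rule Mmod_extension[OF assms polyfun_power[OF f0(1)] x0(1) _ m0])
        show "f0 x0 ^ k \<noteq> 0" using f0(3) by simp
        fix I g assume I: "I \<in> multi_idx N n" and g: "g \<in> polyfun (4*N)" "\<forall>x\<in>Y. g x = 0"
        obtain m' k' where m': "m' \<in> Mmod N n \<sigma>"
          "\<And>x I. x \<in> Xvar N \<Longrightarrow> g x \<noteq> 0 \<Longrightarrow> I \<in> multi_idx N n \<Longrightarrow> s x I = m' x I / g x ^ k'"
          using sec[OF g] by blast
        \<comment> \<open>The additional factor \<open>g x\<close> makes the identity trivial where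
          \<open>g\<close> vanishes, since there \<open>s\<close> is not given by
          \<open>m'\<close>.\<close>
        have "g x ^ Suc k' * m0 x I - f0 x ^ k * (g x * m' x I) = 0" if x: "x \<in> Xvar N" for x
        proof (rule cancel[OF f0(1) x0(1) f0(3) _ _ x])
          show "(\<lambda>x. g x ^ Suc k' * m0 x I - f0 x ^ k * (g x * m' x I)) \<in> polyfun (4*N)"
            using g(1) f0(1) Mmod_polyfun[OF m0] Mmod_polyfun[OF m'(1)] by (intro polyfun_diff pf_mult polyfun_power)
          fix x assume x: "x \<in> Xvar N" "f0 x \<noteq> 0"
          show "g x ^ Suc k' * m0 x I - f0 x ^ k * (g x * m' x I) = 0"
          proof (cases "g x = 0")
            case False
            from sm0[OF x I] m'(2)[OF x(1) False I] have "m0 x I / f0 x ^ k = m' x I / g x ^ k'" by simp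
            then have "g x ^ k' * m0 x I = f0 x ^ k * m' x I" using x(2) False by (simp add: field_simps)
            then show ?thesis by simp
          qed simp
        qed
        moreover have "(\<lambda>x. g x * m' x I) \<in> polyfun (4*N)" using g(1) Mmod_polyfun[OF m'(1)] by (intro pf_mult)
        ultimately show "\<exists>k'. \<exists>p\<in>polyfun (4*N). \<forall>x\<in>Xvar N. g x ^ k' * m0 x I = f0 x ^ k * p x"
          by (intro exI[of _ "Suc k'"] bexI[of _ "\<lambda>x. g x * m' x I"]) auto
      qed
      then obtain m where m: "m \<in> Mmod N n \<sigma>" "\<And>x I. x \<in> Xvar N \<Longrightarrow> I \<in> multi_idx N n \<Longrightarrow> m0 x I = f0 x ^ k * m x I"
        by blast
      \<comment> \<open>So far \<open>s\<close> and \<open>m\<close> agree only where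
        \<open>f0\<close> is nonzero. At any other point outside \<open>Y\<close> a function
        \<open>g\<close> that is nonzero there gives a second representation of \<open>s\<close>,
        compared with \<open>m\<close> by density.\<close>
      have "s x I = m x I" if x: "x \<in> Xvar N - Y" and I: "I \<in> multi_idx N n" for x I
      proof -
        have xX: "x \<in> Xvar N" "x \<notin> Y" using x by auto
        obtain g where g: "g \<in> polyfun (4*N)" "\<forall>x\<in>Y. g x = 0" "g x \<noteq> 0"
          using zariski_closed_separate[OF assms(2) xX] by blast
        obtain m' k' where m': "m' \<in> Mmod N n \<sigma>"
          "\<And>x I. x \<in> Xvar N \<Longrightarrow> g x \<noteq> 0 \<Longrightarrow> I \<in> multi_idx N n \<Longrightarrow> s x I = m' x I / g x ^ k'"
          using sec[OF g(1,2)] by blast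
        have qP: "(\<lambda>x. m' x I - g x ^ k' * m x I) \<in> polyfun (4*N)"
          using g(1) Mmod_polyfun[OF m(1)] Mmod_polyfun[OF m'(1)] by (intro polyfun_diff pf_mult polyfun_power)
        have gq: "g y * (m' y I - g y ^ k' * m y I) = 0" if y: "y \<in> Xvar N" for y
        proof (rule cancel[OF f0(1) x0(1) f0(3) pf_mult[OF g(1) qP] _ y])
          fix y assume y: "y \<in> Xvar N" "f0 y \<noteq> 0"
          show "g y * (m' y I - g y ^ k' * m y I) = 0"
          proof (cases "g y = 0")
            case False
            have "m y I = m' y I / g y ^ k'"
              using sm0[OF y I] m'(2)[OF y(1) False I] m(2)[OF y(1) I] y(2) by simp
            then show ?thesis using False by simp
          qed simp
        qed
        have "m' x I - g x ^ k' * m x I = 0" using gq[OF xX(1)] g(3) by simp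
        then show ?thesis using m'(2)[OF xX(1) g(3) I] g(3) by (simp add: field_simps)
      qed
      then show "\<exists>m\<in>Mmod N n \<sigma>. \<forall>x\<in>Xvar N - Y. \<forall>I\<in>multi_idx N n. s x I = m x I" using m(1) by blast
    qed
  qed
qed

end
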